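(* Let $(B,\psi)$ be a finite quantum space with faithful $\delta$-form $\psi$, let $B=\bigoplus_{a=1}^{N}M_{n_a}(\mathbb{C})$, and let $T_{\dim(B)}=(B,\psi,\mathrm{id}_B)$ be the trivial quantum graph on $(B,\psi)$. For every positive integer $k$, consider the $\mathrm{C}^*$-subcorrespondence $$\bigoplus_{a=1}^{N}\bigl(L^2(M_{n_a}(\mathbb{C}),\psi_a)^{\otimes(k-1)}\otimes M_{n_a}(\mathbb{C})\bigr)\subseteq L^2(B,\psi)^{\otimes(k-1)}\otimes B$$ over $B$. Then $$\tfrac{1}{\delta}\,f_k\circ(\mathrm{id}_{B^{\otimes(k-1)}}\otimes m^* )\colon\ \bigoplus_{a=1}^{N}\bigl(L^2(M_{n_a}(\mathbb{C}),\psi_a)^{\otimes(k-1)}\otimes M_{n_a}(\mathbb{C})\bigr)\longrightarrow\mathcal{E}_{T_{\dim(B)}}^{k}$$ is an isomorphism of $\mathrm{C}^*$-correspondences over $B$.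
   Context: Quantum graphs. A finite quantum space is a pair $(B,\psi)$ where $B$ is a finite-dimensional $\mathrm{C}^*$-algebra and $\psi\colon B\to\mathbb{C}$ is a faithful state that is a $\delta$-form for some $\delta\in\mathbb{R}$: writing $L^2(B)=L^2(B,\psi)$ for $B$ with the inner product $\langle x,y\rangle=\psi(x^*y)$ and $m^*\colon L^2(B)\to L^2(B)\otimes L^2(B)$ for the Hilbert space adjoint of the multiplication map $m\colon B\otimes B\to B$, one has $mm^*=\delta^2\,\mathrm{id}_B$. A finite directed quantum graph $\mathcal{G}=(B,\psi,A)$ is a finite quantum space together with a linear operator $A\colon L^2(B)\to L^2(B)$ satisfying $m(A\otimes A)m^*=\delta^2A$. The trivial quantum graph is the case $A=\mathrm{id}_B$. Modular group and $T$. Let $Q\in B$ be the positive invertible density of $\psi$ with respect to the usual trace $\mathrm{Tr}$ (the sum of the unnormalized matrix traces): $\psi(b)=\mathrm{Tr}(Qb)$. Set $\sigma_z^\psi(b)=Q^{iz}bQ^{-iz}$ (so $\sigma_{-i}^\psi(b)=QbQ^{-1}$). Let $\chi$ be the tensor flip on $B\otimes B$ and $T=m\circ\chi\circ(\sigma_{-i}^\psi\otimes\mathrm{id}_B)\colon B\otimes B\to B$, i.e. $T(x\otimes y)=y\,\sigma_{-i}^\psi(x)$; its Hilbert space adjoint is $T^*=(\sigma_{-i}^\psi\otimes\mathrm{id}_B)\circ\chi\circ m^*$. Path indicators and path spaces. For a quantum graph $\mathcal{G}=(B,\psi,A)$ set $\epsilon_{\mathcal{G}}^0=1_B$ and, for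 $k\ge1$, $\epsilon_{\mathcal{G}}^k=\frac{1}{\delta^2}\bigl(\mathrm{id}_{B^{\otimes(k-1)}}\otimes(\mathrm{id}_B\otimes A)T^*\bigr)\epsilon_{\mathcal{G}}^{k-1}\in B^{\otimes(k+1)}$. For $k\geq 1$ the $k$-length quantum path space is $\mathcal{E}_{\mathcal{G}}^k=\mathrm{span}\{(x\otimes1_B)\,\epsilon_{\mathcal{G}}^k\,(1_B\otimes y)\mid x,y\in B^{\otimes k}\}\subseteq B^{\otimes(k+1)}$ (products taken in the algebra $B^{\otimes(k+1)}$). Correspondence structures over $B$. $B^{\otimes(k+1)}$ is a $\mathrm{C}^*$-correspondence over $B$ with $\langle\xi_1,\xi_2\rangle_B=(\psi^{\otimes k}\otimes\mathrm{id}_B)(\xi_1^*\xi_2)$ and $b_1\cdot(x_1\otimes\cdots\otimes x_{k+1})\cdot b_2=b_1x_1\otimes\cdots\otimes x_{k+1}b_2$; $\mathcal{E}_{\mathcal{G}}^k$ is a $\mathrm{C}^*$-subcorrespondence. $L^2(B,\psi)^{\otimes(k-1)}\otimes B$ and $L^2(B,\psi)^{\otimes(k-1)}\otimes(B\otimes B)$ are the external tensor products of the Hilbert space $L^2(B,\psi)^{\otimes(k-1)}$ with the standard correspondence $B$ over $B$ (with $\langle b,b'\rangle_B=b^*b'$ and left and right multiplication) and with the correspondence $B\otimes B$ over $B$, respectively; both left and right actions are on the second tensorand. Here $\psi_a$ is the restriction of $\psi$ to the summand $M_{n_a}(\mathbb{C})$. The map $f_k\colon L^2(B,\psi)^{\otimes(k-1)}\otimes(B\otimes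 B)\to B^{\otimes(k+1)}$ is the isomorphism of $\mathrm{C}^*$-correspondences determined by $f_k(x\otimes a\otimes b)=a\otimes x\otimes b$ for $a,b\in B$, $x\in B^{\otimes(k-1)}$. *)

theory Defs
  imports Complex_Main "HOL-Library.Function_Algebras"
begin

section \<open>Tensor powers of a multimatrix algebra\<close>

text \<open>
  The list \<open>ns = [n\<^sub>0, \<dots>, n\<^sub>N\<^sub>-\<^sub>1]\<close> encodes \<open>B = \<Oplus>\<^sub>a M(n\<^sub>a)\<close>, realised as the block diagonal matrices
  whose rows and columns are indexed by the pairs \<open>(a, i)\<close> with \<open>a < N\<close> and \<open>i < n\<^sub>a\<close>. Its \<open>k\<close>-th
  tensor power is realised through Kronecker products: rows and columns are then indexed by lists
  of \<open>k\<close> such pairs, and row and column must lie in the same sequence of blocks. In particular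
  \<open>B\<close> itself is \<open>tpow ns 1\<close> and \<open>\<complex>\<close> is \<open>tpow ns 0\<close>. All entries outside these
  positions are \<open>0\<close>. Addition is the pointwise one of functions; the pointwise product and unit of
  functions are never used.
\<close>

type_synonym index = "(nat \<times> nat) list"
type_synonym tensor = "index \<Rightarrow> index \<Rightarrow> complex"

definition block_idx :: "nat list \<Rightarrow> (nat \<times> nat) set" where
  "block_idx ns = {(a, i). a < length ns \<and> i < ns ! a}"

definition unit_idx :: "nat list \<Rightarrow> nat \<Rightarrow> (index \<times> index) set" where
  "unit_idx ns k =
     {(p, q). length p = k \<and> set p \<subseteq> block_idx ns \<and> set q \<subseteq> block_idx ns \<and>
        map fst p = map fst q}"

definition tpow :: "nat list \<Rightarrow> nat \<Rightarrow> tensor set" where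
  "tpow ns k = {x. \<forall>p q. (p, q) \<notin> unit_idx ns k \<longrightarrow> x p q = 0}"

definition scale :: "complex \<Rightarrow> tensor \<Rightarrow> tensor" where
  "scale c x = (\<lambda>p q. c * x p q)"

definition mat_unit :: "index \<Rightarrow> index \<Rightarrow> tensor" where
  "mat_unit p q = (\<lambda>p' q'. if p' = p \<and> q' = q then 1 else 0)"

definition unit_el :: "nat list \<Rightarrow> nat \<Rightarrow> tensor" where
  "unit_el ns k = (\<lambda>p q. if p = q \<and> (p, q) \<in> unit_idx ns k then 1 else 0)"

definition mul :: "nat list \<Rightarrow> tensor \<Rightarrow> tensor \<Rightarrow> tensor" where
  "mul ns x y = (\<lambda>p q. \<Sum>r | length r = length p \<and> set r \<subseteq> block_idx ns. x p r * y r q)"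

definition star :: "tensor \<Rightarrow> tensor" where
  "star x = (\<lambda>p q. cnj (x q p))"

text \<open>\<open>kron j x y\<close> is the elementary tensor \<open>x \<otimes> y\<close> for \<open>x\<close> in the \<open>j\<close>-th tensor power.\<close>

definition kron :: "nat \<Rightarrow> tensor \<Rightarrow> tensor \<Rightarrow> tensor" where
  "kron j x y = (\<lambda>p q. x (take j p) (take j q) * y (drop j p) (drop j q))"

text \<open>
  \<open>lin_ext ns j r F\<close> is the linear map on the \<open>(j + r)\<close>-th tensor power determined by
  \<open>x \<otimes> y \<mapsto> F x y\<close>, where \<open>F\<close> is bilinear on the \<open>j\<close>-th times the \<open>r\<close>-th tensor power
  (see \<open>lin_ext_kron\<close> below).
\<close>

definition lin_ext :: "nat list \<Rightarrow> nat \<Rightarrow> nat \<Rightarrow> (tensor \<Rightarrow> tensor \<Rightarrow> tensor) \<Rightarrow> tensor \<Rightarrow> tensor" where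
  "lin_ext ns j r F x =
     (\<Sum>(p, q)\<in>unit_idx ns j. \<Sum>(p', q')\<in>unit_idx ns r.
        scale (x (p @ p') (q @ q')) (F (mat_unit p q) (mat_unit p' q')))"

text \<open>\<open>amp ns j r F\<close> is \<open>id \<otimes> F\<close>, with \<open>id\<close> on the \<open>j\<close>-th and \<open>F\<close> on the \<open>r\<close>-th tensor power.\<close>

definition amp :: "nat list \<Rightarrow> nat \<Rightarrow> nat \<Rightarrow> (tensor \<Rightarrow> tensor) \<Rightarrow> tensor \<Rightarrow> tensor" where
  "amp ns j r F = lin_ext ns j r (\<lambda>x y. kron j x (F y))"

lemma vector_space_scale: "vector_space scale"
  by unfold_locales (auto simp: scale_def fun_eq_iff algebra_simps)

lemma finite_block_idx: "finite (block_idx ns)"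
  by (rule finite_subset[of _ "\<Union>a\<in>{..<length ns}. {a} \<times> {..<ns ! a}"]) (auto simp: block_idx_def)

lemma unit_idx_lengthD: "(p, q) \<in> unit_idx ns k \<Longrightarrow> length p = k \<and> length q = k"
  by (auto simp: unit_idx_def dest: map_eq_imp_length_eq)

lemma finite_unit_idx: "finite (unit_idx ns k)"
proof (rule finite_subset)
  let ?L = "{p. set p \<subseteq> block_idx ns \<and> length p = k}"
  show "unit_idx ns k \<subseteq> ?L \<times> ?L"
    by (auto simp: unit_idx_def dest: map_eq_imp_length_eq)
  show "finite (?L \<times> ?L)"
    using finite_lists_length_eq[OF finite_block_idx] by blast
qed

lemma sum_fun_apply2: "(\<Sum>i\<in>I. f i) p q = (\<Sum>i\<in>I. f i p q :: 'a :: comm_monoid_add)"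
  by (induction I rule: infinite_finite_induct) (auto simp: plus_fun_def zero_fun_def)

lemma tpow_expand:
  assumes "x \<in> tpow ns k"
  shows "x = (\<Sum>(p, q)\<in>unit_idx ns k. scale (x p q) (mat_unit p q))"
proof (intro ext)
  fix p q
  have "(\<Sum>(p, q)\<in>unit_idx ns k. scale (x p q) (mat_unit p q)) p q
      = (\<Sum>u\<in>unit_idx ns k. if u = (p, q) then x p q else 0)"
    by (subst sum_fun_apply2, intro sum.cong) (auto simp: scale_def mat_unit_def split: if_splits)
  also have "\<dots> = x p q"
    using assms by (simp add: finite_unit_idx tpow_def)
  finally show "x p q = (\<Sum>(p, q)\<in>unit_idx ns k. scale (x p q) (mat_unit p q)) p q" ..
qed

lemma lin_ext_kron:
  assumes x: "x \<in> tpow ns j" and y: "y \<in> tpow ns r"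
    and addl: "\<And>x x' y. F (x + x') y = F x y + F x' y"
    and addr: "\<And>x y y'. F x (y + y') = F x y + F x y'"
    and scl: "\<And>c x y. F (scale c x) y = scale c (F x y)"
    and scr: "\<And>c x y. F x (scale c y) = scale c (F x y)"
  shows "lin_ext ns j r F (kron j x y) = F x y"
proof -
  interpret vector_space scale by (rule vector_space_scale)
  have zl: "F 0 z = 0" and zr: "F z 0 = 0" for z
    using scl[of 0 0 z] scr[of z 0 0] by simp_all
  have suml: "F (\<Sum>i\<in>I. f i) z = (\<Sum>i\<in>I. F (f i) z)" for I :: "'b set" and f z
    by (induction I rule: infinite_finite_induct)
      (simp_all only: sum.infinite sum.empty sum.insert zl addl not_False_eq_True)
  have sumr: "F z (\<Sum>i\<in>I. f i) = (\<Sum>i\<in>I. F z (f i))" for I :: "'b set" and f z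
    by (induction I rule: infinite_finite_induct)
      (simp_all only: sum.infinite sum.empty sum.insert zr addr not_False_eq_True)
  have "F x y = F (\<Sum>(p, q)\<in>unit_idx ns j. scale (x p q) (mat_unit p q))
                  (\<Sum>(p, q)\<in>unit_idx ns r. scale (y p q) (mat_unit p q))"
    using tpow_expand[OF x] tpow_expand[OF y] by simp
  also have "\<dots> = (\<Sum>u\<in>unit_idx ns j. \<Sum>v\<in>unit_idx ns r.
      scale (x (fst u) (snd u) * y (fst v) (snd v))
        (F (mat_unit (fst u) (snd u)) (mat_unit (fst v) (snd v))))"
    by (simp add: suml sumr scl scr case_prod_unfold scale_sum_right)
      (subst sum.swap, simp add: mult.commute)
  also have "\<dots> = lin_ext ns j r F (kron j x y)"
    unfolding lin_ext_def
    by (intro sum.cong refl) (auto simp: kron_def case_prod_unfold dest!: unit_idx_lengthD intro!: sum.cong)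
  finally show ?thesis ..
qed

lemma mul_kron:
  assumes "x \<in> tpow ns j" "x' \<in> tpow ns j"
  shows "mul ns (kron j x y) (kron j x' y') = kron j (mul ns x x') (mul ns y y')"
proof (intro ext)
  fix p q :: index
  let ?R = "\<lambda>n. {r. length r = n \<and> set r \<subseteq> block_idx ns}"
  show "mul ns (kron j x y) (kron j x' y') p q = kron j (mul ns x x') (mul ns y y') p q"
  proof (cases "j \<le> length p")
    case True
    have "kron j (mul ns x x') (mul ns y y') p q
        = (\<Sum>(r, s)\<in>?R j \<times> ?R (length p - j).
             x (take j p) r * x' r (take j q) * (y (drop j p) s * y' s (drop j q)))"
      using True by (simp add: kron_def mul_def sum_product sum.cartesian_product min_absorb2)
    also have "\<dots> = mul ns (kron j x y) (kron j x' y') p q"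
      unfolding mul_def kron_def
      by (rule sum.reindex_bij_witness[of _ "\<lambda>r. (take j r, drop j r)" "\<lambda>(r, s). r @ s"])
        (use True in \<open>auto dest: in_set_takeD in_set_dropD\<close>)
    finally show ?thesis ..
  next
    case False
    have "x (take j p) r = 0" for r
      using assms(1) False by (auto simp: tpow_def unit_idx_def)
    then show ?thesis
      by (simp add: kron_def mul_def)
  qed
qed

section \<open>Finite quantum spaces\<close>

text \<open>A functional \<open>\<psi>\<close> on \<open>B\<close> is a function on tensors of which only the values on \<open>B\<close> matter.\<close>

definition faithful_state :: "nat list \<Rightarrow> (tensor \<Rightarrow> complex) \<Rightarrow> bool" where
  "faithful_state ns \<psi> \<longleftrightarrow>
     (\<forall>x\<in>tpow ns 1. \<forall>y\<in>tpow ns 1. \<psi> (x + y) = \<psi> x + \<psi> y) \<and>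
     (\<forall>c. \<forall>x\<in>tpow ns 1. \<psi> (scale c x) = c * \<psi> x) \<and>
     (\<forall>x\<in>tpow ns 1. \<psi> (mul ns (star x) x) \<in> \<real> \<and> 0 \<le> Re (\<psi> (mul ns (star x) x))) \<and>
     \<psi> (unit_el ns 1) = 1 \<and>
     (\<forall>x\<in>tpow ns 1. \<psi> (mul ns (star x) x) = 0 \<longrightarrow> x = 0)"

text \<open>The functional \<open>\<psi> \<otimes> \<dots> \<otimes> \<psi>\<close> on the \<open>k\<close>-th tensor power.\<close>

definition psi_pow :: "nat list \<Rightarrow> (tensor \<Rightarrow> complex) \<Rightarrow> nat \<Rightarrow> tensor \<Rightarrow> complex" where
  "psi_pow ns \<psi> k x = (\<Sum>(p, q)\<in>unit_idx ns k. x p q * (\<Prod>t<k. \<psi> (mat_unit [p ! t] [q ! t])))"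

text \<open>The inner product of the \<open>k\<close>-th Hilbert space tensor power of \<open>L\<^sup>2(B, \<psi>)\<close>.\<close>

definition l2_inner :: "nat list \<Rightarrow> (tensor \<Rightarrow> complex) \<Rightarrow> nat \<Rightarrow> tensor \<Rightarrow> tensor \<Rightarrow> complex" where
  "l2_inner ns \<psi> k x y = psi_pow ns \<psi> k (mul ns (star x) y)"

text \<open>The Hilbert space adjoint of a linear map from the \<open>j\<close>-th to the \<open>r\<close>-th tensor power.\<close>

definition hilbert_adjoint ::
  "nat list \<Rightarrow> (tensor \<Rightarrow> complex) \<Rightarrow> nat \<Rightarrow> nat \<Rightarrow> (tensor \<Rightarrow> tensor) \<Rightarrow> tensor \<Rightarrow> tensor" where
  "hilbert_adjoint ns \<psi> j r F y =
     (THE x. x \<in> tpow ns j \<and> (\<forall>v\<in>tpow ns j. l2_inner ns \<psi> j v x = l2_inner ns \<psi> r (F v) y))"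

definition mult_map :: "nat list \<Rightarrow> tensor \<Rightarrow> tensor" where
  "mult_map ns = lin_ext ns 1 1 (mul ns)"

definition mult_adj :: "nat list \<Rightarrow> (tensor \<Rightarrow> complex) \<Rightarrow> tensor \<Rightarrow> tensor" where
  "mult_adj ns \<psi> = hilbert_adjoint ns \<psi> 2 1 (mult_map ns)"

definition finite_quantum_space :: "nat list \<Rightarrow> (tensor \<Rightarrow> complex) \<Rightarrow> real \<Rightarrow> bool" where
  "finite_quantum_space ns \<psi> \<delta> \<longleftrightarrow>
     (\<forall>n\<in>set ns. 0 < n) \<and> faithful_state ns \<psi> \<and>
     (\<forall>x\<in>tpow ns 1. mult_map ns (mult_adj ns \<psi> x) = scale (of_real (\<delta>\<^sup>2)) x)"

definition mat_trace :: "nat list \<Rightarrow> tensor \<Rightarrow> complex" where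
  "mat_trace ns x = (\<Sum>u\<in>block_idx ns. x [u] [u])"

definition psi_density :: "nat list \<Rightarrow> (tensor \<Rightarrow> complex) \<Rightarrow> tensor" where
  "psi_density ns \<psi> = (THE Q. Q \<in> tpow ns 1 \<and> (\<forall>b\<in>tpow ns 1. \<psi> b = mat_trace ns (mul ns Q b)))"

definition alg_inverse :: "nat list \<Rightarrow> tensor \<Rightarrow> tensor" where
  "alg_inverse ns x = (THE y. y \<in> tpow ns 1 \<and> mul ns x y = unit_el ns 1 \<and> mul ns y x = unit_el ns 1)"

text \<open>The modular group \<open>\<sigma>\<^sub>z(b) = Q\<^sup>i\<^sup>z b Q\<^sup>-\<^sup>i\<^sup>z\<close> at \<open>z = -i\<close>.\<close>

definition modular :: "nat list \<Rightarrow> (tensor \<Rightarrow> complex) \<Rightarrow> tensor \<Rightarrow> tensor" where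
  "modular ns \<psi> b = mul ns (mul ns (psi_density ns \<psi>) b) (alg_inverse ns (psi_density ns \<psi>))"

definition tensor_flip :: "nat list \<Rightarrow> tensor \<Rightarrow> tensor" where
  "tensor_flip ns = lin_ext ns 1 1 (\<lambda>x y. kron 1 y x)"

definition T_map :: "nat list \<Rightarrow> (tensor \<Rightarrow> complex) \<Rightarrow> tensor \<Rightarrow> tensor" where
  "T_map ns \<psi> = mult_map ns \<circ> tensor_flip ns \<circ> lin_ext ns 1 1 (\<lambda>x y. kron 1 (modular ns \<psi> x) y)"

definition T_adj :: "nat list \<Rightarrow> (tensor \<Rightarrow> complex) \<Rightarrow> tensor \<Rightarrow> tensor" where
  "T_adj ns \<psi> = hilbert_adjoint ns \<psi> 2 1 (T_map ns \<psi>)"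

section \<open>Path indicators and path spaces\<close>

fun path_indicator ::
  "nat list \<Rightarrow> (tensor \<Rightarrow> complex) \<Rightarrow> real \<Rightarrow> (tensor \<Rightarrow> tensor) \<Rightarrow> nat \<Rightarrow> tensor" where
  "path_indicator ns \<psi> \<delta> A 0 = unit_el ns 1"
| "path_indicator ns \<psi> \<delta> A (Suc k) =
     scale (of_real (1 / \<delta>\<^sup>2))
       (amp ns k 1 (amp ns 1 1 A \<circ> T_adj ns \<psi>) (path_indicator ns \<psi> \<delta> A k))"

definition path_space ::
  "nat list \<Rightarrow> (tensor \<Rightarrow> complex) \<Rightarrow> real \<Rightarrow> (tensor \<Rightarrow> tensor) \<Rightarrow> nat \<Rightarrow> tensor set" where
  "path_space ns \<psi> \<delta> A k = module.span scale
     {mul ns (mul ns (kron k x (unit_el ns 1)) (path_indicator ns \<psi> \<delta> A k)) (kron 1 (unit_el ns 1) y)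
      | x y. x \<in> tpow ns k \<and> y \<in> tpow ns k}"

section \<open>Correspondences over a multimatrix algebra\<close>

text \<open>Positivity in \<open>B\<close>, as a matrix algebra: positive semidefiniteness.\<close>

definition positive_elt :: "nat list \<Rightarrow> tensor \<Rightarrow> bool" where
  "positive_elt ns b \<longleftrightarrow> b \<in> tpow ns 1 \<and>
     (\<forall>v :: nat \<times> nat \<Rightarrow> complex.
        let s = (\<Sum>u\<in>block_idx ns. \<Sum>w\<in>block_idx ns. cnj (v u) * b [u] [w] * v w)
        in s \<in> \<real> \<and> 0 \<le> Re s)"

record correspondence =
  corr_space :: "tensor set"
  lact :: "tensor \<Rightarrow> tensor \<Rightarrow> tensor"
  ract :: "tensor \<Rightarrow> tensor \<Rightarrow> tensor"
  inner_B :: "tensor \<Rightarrow> tensor \<Rightarrow> tensor"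

text \<open>
  A Hilbert module over \<open>B\<close> with a left action of \<open>B\<close> by a \<open>*\<close>-homomorphism into the adjointable
  operators. The underlying space is required to lie in some tensor power; it is then finite
  dimensional, so completeness is automatic.
\<close>

definition cstar_correspondence :: "nat list \<Rightarrow> correspondence \<Rightarrow> bool" where
  "cstar_correspondence ns E \<longleftrightarrow>
     (\<exists>r. corr_space E \<subseteq> tpow ns r) \<and> module.subspace scale (corr_space E) \<and>
     \<comment> \<open>right module\<close>
     (\<forall>x\<in>corr_space E. \<forall>b\<in>tpow ns 1. ract E x b \<in> corr_space E) \<and>
     (\<forall>x\<in>corr_space E. \<forall>y\<in>corr_space E. \<forall>b\<in>tpow ns 1. ract E (x + y) b = ract E x b + ract E y b) \<and>
     (\<forall>x\<in>corr_space E. \<forall>b\<in>tpow ns 1. \<forall>c\<in>tpow ns 1. ract E x (b + c) = ract E x b + ract E x c) \<and>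
     (\<forall>d. \<forall>x\<in>corr_space E. \<forall>b\<in>tpow ns 1.
        ract E (scale d x) b = scale d (ract E x b) \<and> ract E x (scale d b) = scale d (ract E x b)) \<and>
     (\<forall>x\<in>corr_space E. \<forall>b\<in>tpow ns 1. \<forall>c\<in>tpow ns 1. ract E (ract E x b) c = ract E x (mul ns b c)) \<and>
     (\<forall>x\<in>corr_space E. ract E x (unit_el ns 1) = x) \<and>
     \<comment> \<open>\<open>B\<close>-valued inner product\<close>
     (\<forall>x\<in>corr_space E. \<forall>y\<in>corr_space E.
        inner_B E x y \<in> tpow ns 1 \<and> inner_B E y x = star (inner_B E x y)) \<and>
     (\<forall>x\<in>corr_space E. \<forall>y\<in>corr_space E. \<forall>z\<in>corr_space E.
        inner_B E x (y + z) = inner_B E x y + inner_B E x z) \<and>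
     (\<forall>d. \<forall>x\<in>corr_space E. \<forall>y\<in>corr_space E. inner_B E x (scale d y) = scale d (inner_B E x y)) \<and>
     (\<forall>x\<in>corr_space E. \<forall>y\<in>corr_space E. \<forall>b\<in>tpow ns 1.
        inner_B E x (ract E y b) = mul ns (inner_B E x y) b) \<and>
     (\<forall>x\<in>corr_space E. positive_elt ns (inner_B E x x)) \<and>
     (\<forall>x\<in>corr_space E. inner_B E x x = 0 \<longrightarrow> x = 0) \<and>
     \<comment> \<open>left action\<close>
     (\<forall>b\<in>tpow ns 1. \<forall>x\<in>corr_space E. lact E b x \<in> corr_space E) \<and>
     (\<forall>b\<in>tpow ns 1. \<forall>x\<in>corr_space E. \<forall>y\<in>corr_space E. lact E b (x + y) = lact E b x + lact E b y) \<and>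
     (\<forall>b\<in>tpow ns 1. \<forall>c\<in>tpow ns 1. \<forall>x\<in>corr_space E. lact E (b + c) x = lact E b x + lact E c x) \<and>
     (\<forall>d. \<forall>b\<in>tpow ns 1. \<forall>x\<in>corr_space E.
        lact E b (scale d x) = scale d (lact E b x) \<and> lact E (scale d b) x = scale d (lact E b x)) \<and>
     (\<forall>b\<in>tpow ns 1. \<forall>c\<in>tpow ns 1. \<forall>x\<in>corr_space E. lact E (mul ns b c) x = lact E b (lact E c x)) \<and>
     (\<forall>b\<in>tpow ns 1. \<forall>x\<in>corr_space E. \<forall>y\<in>corr_space E.
        inner_B E (lact E b x) y = inner_B E x (lact E (star b) y)) \<and>
     (\<forall>b\<in>tpow ns 1. \<forall>x\<in>corr_space E. \<forall>c\<in>tpow ns 1. lact E b (ract E x c) = ract E (lact E b x) c)"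

definition subcorrespondence :: "nat list \<Rightarrow> tensor set \<Rightarrow> correspondence \<Rightarrow> bool" where
  "subcorrespondence ns S E \<longleftrightarrow>
     cstar_correspondence ns E \<and> S \<subseteq> corr_space E \<and> cstar_correspondence ns (E\<lparr>corr_space := S\<rparr>)"

definition correspondence_iso ::
  "nat list \<Rightarrow> correspondence \<Rightarrow> correspondence \<Rightarrow> (tensor \<Rightarrow> tensor) \<Rightarrow> bool" where
  "correspondence_iso ns E E' \<Phi> \<longleftrightarrow>
     cstar_correspondence ns E \<and> cstar_correspondence ns E' \<and>
     bij_betw \<Phi> (corr_space E) (corr_space E') \<and>
     (\<forall>x\<in>corr_space E. \<forall>y\<in>corr_space E. \<Phi> (x + y) = \<Phi> x + \<Phi> y) \<and>
     (\<forall>c. \<forall>x\<in>corr_space E. \<Phi> (scale c x) = scale c (\<Phi> x)) \<and>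
     (\<forall>b\<in>tpow ns 1. \<forall>x\<in>corr_space E. \<Phi> (lact E b x) = lact E' b (\<Phi> x)) \<and>
     (\<forall>x\<in>corr_space E. \<forall>b\<in>tpow ns 1. \<Phi> (ract E x b) = ract E' (\<Phi> x) b) \<and>
     (\<forall>x\<in>corr_space E. \<forall>y\<in>corr_space E. inner_B E' (\<Phi> x) (\<Phi> y) = inner_B E x y)"

definition standard_corr :: "nat list \<Rightarrow> correspondence" where
  "standard_corr ns =
     \<lparr>corr_space = tpow ns 1, lact = mul ns, ract = mul ns, inner_B = (\<lambda>b c. mul ns (star b) c)\<rparr>"

text \<open>
  The external tensor product of the Hilbert space \<open>L\<^sup>2(B, \<psi>)\<close> to the tensor power \<open>j\<close> with a
  correspondence \<open>E\<close> whose space is the full \<open>r\<close>-th tensor power. Its inner product is the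
  sesquilinear extension of \<open>\<langle>x \<otimes> e, x' \<otimes> e'\<rangle> = \<langle>x, x'\<rangle> \<langle>e, e'\<rangle>\<^sub>B\<close>.
\<close>

definition ext_tensor ::
  "nat list \<Rightarrow> (tensor \<Rightarrow> complex) \<Rightarrow> nat \<Rightarrow> nat \<Rightarrow> correspondence \<Rightarrow> correspondence" where
  "ext_tensor ns \<psi> j r E =
     \<lparr>corr_space = tpow ns (j + r),
      lact = (\<lambda>b. amp ns j r (lact E b)),
      ract = (\<lambda>\<xi> b. amp ns j r (\<lambda>e. ract E e b) \<xi>),
      inner_B = (\<lambda>\<xi> \<eta>.
        \<Sum>(p, q)\<in>unit_idx ns j. \<Sum>(s, t)\<in>unit_idx ns r. \<Sum>(p', q')\<in>unit_idx ns j. \<Sum>(s', t')\<in>unit_idx ns r.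
          scale (cnj (\<xi> (p @ s) (q @ t)) * \<eta> (p' @ s') (q' @ t')
                   * l2_inner ns \<psi> j (mat_unit p q) (mat_unit p' q'))
            (inner_B E (mat_unit s t) (mat_unit s' t')))\<rparr>"

text \<open>The correspondence on the tensor power \<open>k + 1\<close>, with
  \<open>\<langle>\<xi>, \<eta>\<rangle>\<^sub>B = (\<psi> \<otimes> \<dots> \<otimes> \<psi> \<otimes> id) (\<xi>\<^sup>* \<eta>)\<close>.\<close>

definition tpow_corr :: "nat list \<Rightarrow> (tensor \<Rightarrow> complex) \<Rightarrow> nat \<Rightarrow> correspondence" where
  "tpow_corr ns \<psi> k =
     \<lparr>corr_space = tpow ns (k + 1),
      lact = (\<lambda>b. lin_ext ns 1 k (\<lambda>x y. kron 1 (mul ns b x) y)),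
      ract = (\<lambda>\<xi> b. lin_ext ns k 1 (\<lambda>x y. kron k x (mul ns y b)) \<xi>),
      inner_B = (\<lambda>\<xi> \<eta>. lin_ext ns k 1 (\<lambda>x y. scale (psi_pow ns \<psi> k x) y) (mul ns (star \<xi>) \<eta>))\<rparr>"

text \<open>The \<open>k\<close>-th tensor power of the summand with index \<open>a\<close>, inside that of \<open>B\<close>.\<close>

definition block_tpow :: "nat list \<Rightarrow> nat \<Rightarrow> nat \<Rightarrow> tensor set" where
  "block_tpow ns a k = {x \<in> tpow ns k. \<forall>p q. x p q \<noteq> 0 \<longrightarrow> fst ` set p \<subseteq> {a} \<and> fst ` set q \<subseteq> {a}}"

text \<open>The sum over \<open>a\<close> of these subspaces; it is direct for \<open>k \<ge> 1\<close>.\<close>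

definition block_sum :: "nat list \<Rightarrow> nat \<Rightarrow> tensor set" where
  "block_sum ns k = {\<Sum>a<length ns. x a | x. \<forall>a<length ns. x a \<in> block_tpow ns a k}"

text \<open>The map \<open>x \<otimes> (a \<otimes> b) \<mapsto> a \<otimes> x \<otimes> b\<close> with \<open>x\<close> in the tensor power \<open>k - 1\<close>.\<close>

definition f_map :: "nat list \<Rightarrow> nat \<Rightarrow> tensor \<Rightarrow> tensor" where
  "f_map ns k = lin_ext ns (k - 1) 2
     (\<lambda>x. lin_ext ns 1 1 (\<lambda>a b. kron 1 a (kron (k - 1) x b)))"

end

theory Submission
  imports Defs
begin

text \<open>
  Everything is computed in matrix entries. Let \<open>M(u, w) = \<psi>(e\<^sub>u\<^sub>w)\<close> be the Gram matrix of the state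
  (\<open>gram\<close>). The density is its transpose, \<open>Q(u, w) = M(w, u)\<close>; let \<open>N = Q\<^sup>-\<^sup>1\<close> (\<open>gram_inv\<close>).
  Faithfulness says that \<open>M\<close> is positive definite, hence so are its Kronecker powers
  (\<open>gram_pow_pos_def\<close>). This makes Hilbert space adjoints unique and the \<open>B\<close>-valued inner products
  positive and definite. Both ambient correspondences have the same shape: \<open>B\<close> acts through matrix
  products, and the inner product of \<open>\<xi>\<close> and \<open>\<eta>\<close> is obtained by applying the state to all legs of
  \<open>\<xi>\<^sup>*\<eta>\<close> but the last. One lemma, \<open>cstar_correspondenceI\<close>, treats them and their subspaces.

  The adjoints are \<open>m\<^sup>*(b) = \<Sum> b e\<^sub>i\<^sub>j \<otimes> Q\<^sup>-\<^sup>1 e\<^sub>j\<^sub>i\<close> and \<open>T\<^sup>*(b) = \<Sum> e\<^sub>i\<^sub>j \<otimes> b Q\<^sup>-\<^sup>1 e\<^sub>j\<^sub>i\<close>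
  (\<open>mult_adj_eq\<close>, \<open>T_adj_eq\<close>). For \<open>z\<close> in the tensor power \<open>k\<close> let \<open>loop_tensor k z\<close> be the tensor
  with the entries \<open>z(p\<^sub>1\<dots>p\<^sub>k, q\<^sub>2\<dots>q\<^sub>k\<^sub>+\<^sub>1) N(p\<^sub>k\<^sub>+\<^sub>1, q\<^sub>1)\<close>. Iterating \<open>T\<^sup>*\<close> gives
  \<open>\<epsilon>\<^sup>k = \<delta>\<^sup>-\<^sup>2\<^sup>k loop_tensor k c\<close> with an element \<open>c\<close> that is invertible in the tensor power \<open>k\<close>
  (\<open>path_indicator_eq\<close>, \<open>chain_left_inverse\<close>). The shift between the row and the column legs turns
  the generators of the path space into a product:
  \<open>(x \<otimes> 1) loop_tensor k c (1 \<otimes> y) = loop_tensor k (x c y)\<close> (\<open>loop_tensor_bimodule\<close>).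
  Therefore the path space is the whole image of the tensor power \<open>k\<close> under \<open>loop_tensor k\<close>
  (\<open>path_space_eq\<close>). Moreover, row and column of a tensor lie in the same sequence of blocks; for
  \<open>loop_tensor k z\<close> this sequence is invariant under a shift, hence constant, and only the part of
  \<open>z\<close> in the block sum matters (\<open>loop_tensor_cong\<close>).

  On the other side, \<open>f\<^sub>k \<circ> (id \<otimes> m\<^sup>*)\<close> maps \<open>x\<close> to \<open>loop_tensor k\<close> of \<open>x\<close> with its row index rotated
  (\<open>f_map_amp_mult_adj\<close>). On the block sum this rotation is a bijection, so the range is the path
  space (\<open>loop_tensor_row_rot_image\<close>). In the inner product of two images, the sum over the factors
  \<open>N\<close> is \<open>Tr(Q\<^sub>a\<^sup>-\<^sup>1)\<close>, and this is \<open>\<delta>\<^sup>2\<close> for every block \<open>a\<close> because \<open>\<psi>\<close> is a \<open>\<delta>\<close>-form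
  (\<open>block_trace_gram_inv\<close>, \<open>loop_tensor_inner\<close>). So \<open>1/\<delta>\<close> is the right normalisation, and
  injectivity follows from definiteness.
\<close>

section \<open>Positive definite matrices\<close>

text \<open>The form \<open>v\<^sup>* M v\<close> of a complex matrix with rows and columns in \<open>A\<close>.\<close>

definition qform :: "'a set \<Rightarrow> ('a \<Rightarrow> 'a \<Rightarrow> complex) \<Rightarrow> ('a \<Rightarrow> complex) \<Rightarrow> complex" where
  "qform A M v = (\<Sum>u\<in>A. \<Sum>w\<in>A. cnj (v u) * M u w * v w)"

text \<open>
  Hermitian with \<open>v\<^sup>* M v > 0\<close> unless \<open>v\<close> vanishes on \<open>A\<close>. The entries of \<open>M\<close> and \<open>v\<close> outside \<open>A\<close>
  are irrelevant.
\<close>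

definition pos_def :: "'a set \<Rightarrow> ('a \<Rightarrow> 'a \<Rightarrow> complex) \<Rightarrow> bool" where
  "pos_def A M \<longleftrightarrow> (\<forall>u\<in>A. \<forall>w\<in>A. M w u = cnj (M u w)) \<and>
     (\<forall>v. (\<exists>u\<in>A. v u \<noteq> 0) \<longrightarrow> 0 < Re (qform A M v))"

lemma pos_def_hermitian:
  assumes "pos_def A M" "u \<in> A" "w \<in> A"
  shows "cnj (M u w) = M w u"
proof -
  have "M w u = cnj (M u w)" using assms unfolding pos_def_def by blast
  then show ?thesis by (rule sym)
qed

lemma pos_def_qform_pos:
  assumes "pos_def A M" "u \<in> A" "v u \<noteq> 0"
  shows "0 < Re (qform A M v)"
  using assms unfolding pos_def_def by blast

lemma pos_def_qform_Reals:
  assumes "pos_def A M"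
  shows "qform A M v \<in> \<real>"
proof -
  note herm = pos_def_hermitian[OF assms]
  have "cnj (qform A M v) = (\<Sum>u\<in>A. \<Sum>w\<in>A. v u * M w u * cnj (v w))"
    unfolding qform_def cnj_sum
    by (intro sum.cong refl) (simp add: herm)
  also have "\<dots> = qform A M v"
    unfolding qform_def by (subst sum.swap) (simp add: mult_ac)
  finally show ?thesis
    by (simp add: complex_is_Real_iff complex_eq_iff)
qed

lemma qform_vanishing: "(\<And>u. u \<in> A \<Longrightarrow> v u = 0) \<Longrightarrow> qform A M v = 0"
  by (simp add: qform_def)

lemma pos_def_qform_nonneg:
  assumes "pos_def A M"
  shows "0 \<le> Re (qform A M v)"
proof (cases "\<exists>u\<in>A. v u \<noteq> 0")
  case True
  then show ?thesis using assms unfolding pos_def_def by (blast intro: less_imp_le)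
next
  case False
  then show ?thesis by (simp add: qform_vanishing)
qed

lemma pos_def_qform_eq_0:
  assumes "pos_def A M" "qform A M v = 0" "u \<in> A"
  shows "v u = 0"
  using assms using pos_def_qform_pos[of A M u v] by force

lemma qform_insert:
  assumes "finite A" "a \<notin> A"
  shows "qform (insert a A) M v = cnj (v a) * M a a * v a + cnj (v a) * (\<Sum>w\<in>A. M a w * v w)
           + (\<Sum>u\<in>A. cnj (v u) * M u a) * v a + qform A M v"
  using assms
  by (simp add: qform_def sum.distrib sum_distrib_left sum_distrib_right mult_ac)

lemma pos_def_pivot:
  assumes "finite A" "a \<in> A" "pos_def A M"
  shows "0 < Re (M a a)" "Im (M a a) = 0"
proof -
  have "qform A M (\<lambda>u. if u = a then 1 else 0) = M a a"
  proof -
    have "qform A M (\<lambda>u. if u = a then 1 else 0)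
        = (\<Sum>u\<in>A. \<Sum>w\<in>A. if w = a then if u = a then M a a else 0 else 0)"
      unfolding qform_def by (intro sum.cong refl) simp
    also have "\<dots> = M a a" using assms(1,2) by simp
    finally show ?thesis .
  qed
  moreover have "0 < Re (qform A M (\<lambda>u. if u = a then 1 else 0))"
    using assms(2,3) by (intro pos_def_qform_pos[of A M a]) auto
  ultimately show "0 < Re (M a a)" by simp
  have "Im (M a a) = Im (cnj (M a a))" using pos_def_hermitian[OF assms(3,2,2)] by simp
  then show "Im (M a a) = 0" by simp
qed

lemma pos_def_Schur_complement:
  assumes fin: "finite A" "a \<notin> A" and pd: "pos_def (insert a A) M"
  shows "pos_def A (\<lambda>u w. M u w - M u a * M a w / M a a)"
  unfolding pos_def_def
proof (intro conjI ballI allI impI)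
  let ?d = "M a a"
  have d: "?d \<noteq> 0" "cnj ?d = ?d"
    using pos_def_pivot[OF _ _ pd, of a] fin by (auto simp: complex_eq_iff)
  note herm = pos_def_hermitian[OF pd]
  show "M w u - M w a * M a u / ?d = cnj (M u w - M u a * M a w / ?d)" if "u \<in> A" "w \<in> A" for u w
    using that d herm by simp
  fix v :: "'a \<Rightarrow> complex"
  assume nz: "\<exists>u\<in>A. v u \<noteq> 0"
  define s where "s = (\<Sum>w\<in>A. M a w * v w)"
  \<comment> \<open>this value at \<open>a\<close> minimises the form of the full matrix\<close>
  define v' where "v' = v(a := - s / ?d)"
  have v': "v' u = v u" if "u \<in> A" for u using that fin by (auto simp: v'_def)
  have s1: "(\<Sum>w\<in>A. M a w * v' w) = s" by (simp add: v' s_def)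
  have s2: "(\<Sum>u\<in>A. cnj (v u) * M u a) = cnj s"
    unfolding s_def cnj_sum
    by (intro sum.cong refl) (simp add: herm[of a] mult.commute)
  have s2': "(\<Sum>u\<in>A. cnj (v' u) * M u a) = cnj s" using s2 by (simp add: v')
  have va: "v' a = - s / ?d" by (simp add: v'_def)
  have qv: "qform A M v' = qform A M v" by (simp add: qform_def v')
  have "qform A (\<lambda>u w. M u w - M u a * M a w / ?d) v
      = qform A M v - (\<Sum>u\<in>A. \<Sum>w\<in>A. (cnj (v u) * M u a) * (M a w * v w)) / ?d"
    unfolding qform_def sum_divide_distrib sum_subtractf[symmetric]
    by (intro sum.cong refl) (simp add: algebra_simps)
  also have "\<dots> = qform A M v - cnj s * s / ?d"
    unfolding sum_product[symmetric] s2 s_def[symmetric] ..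
  also have "\<dots> = qform (insert a A) M v'"
    unfolding qform_insert[OF fin] s1 s2' va qv
    using d by (simp add: field_simps)
  finally have eq: "qform (insert a A) M v' = qform A (\<lambda>u w. M u w - M u a * M a w / ?d) v" ..
  have "\<exists>u\<in>insert a A. v' u \<noteq> 0" using nz v' by force
  then have "0 < Re (qform (insert a A) M v')" using pd unfolding pos_def_def by blast
  then show "0 < Re (qform A (\<lambda>u w. M u w - M u a * M a w / ?d) v)" by (simp only: eq)
qed

text \<open>Induction on \<open>A\<close>, eliminating one index at a time by the Schur complement.\<close>

lemma pos_def_Cholesky:
  assumes "finite A" "pos_def A M"
  shows "\<exists>R. \<forall>u\<in>A. \<forall>w\<in>A. M u w = (\<Sum>i\<in>A. cnj (R i u) * R i w)"
  using assms
proof (induction A arbitrary: M)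
  case empty
  then show ?case by simp
next
  case (insert a A)
  let ?d = "M a a"
  from insert.IH[OF pos_def_Schur_complement[OF insert.hyps insert.prems]]
  obtain R where R: "\<And>u w. u \<in> A \<Longrightarrow> w \<in> A \<Longrightarrow>
      M u w - M u a * M a w / ?d = (\<Sum>i\<in>A. cnj (R i u) * R i w)" by blast
  have d: "0 < Re ?d" "Im ?d = 0"
    using pos_def_pivot[OF _ _ insert.prems, of a] insert.hyps by auto
  note herm = pos_def_hermitian[OF insert.prems]
  define c where "c = complex_of_real (sqrt (Re ?d))"
  have c: "cnj c = c" "c * c = ?d" "?d \<noteq> 0"
    using d by (auto simp: c_def complex_eq_iff)
  \<comment> \<open>the new row of the triangular factor is the row of the pivot, divided by its square root\<close>
  define R' where "R' i w = (if i = a then M a w / c else if w = a then 0 else R i w)" for i w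
  have "M u w = (\<Sum>i\<in>insert a A. cnj (R' i u) * R' i w)" if "u \<in> insert a A" "w \<in> insert a A" for u w
  proof -
    have "(\<Sum>i\<in>A. cnj (R' i u) * R' i w) = (if u = a \<or> w = a then 0 else \<Sum>i\<in>A. cnj (R i u) * R i w)"
      using insert.hyps by (auto simp: R'_def intro!: sum.neutral sum.cong)
    also have "\<dots> = M u w - M u a * M a w / ?d"
      using that R[of u w] c by auto
    finally have "(\<Sum>i\<in>A. cnj (R' i u) * R' i w) = M u w - M u a * M a w / ?d" .
    moreover have "cnj (R' a u) * R' a w = M u a * M a w / ?d"
      using that c herm by (simp add: R'_def)
    ultimately show ?thesis using insert.hyps by simp
  qed
  then show ?case by blast
qed

text \<open>Gaussian elimination with the same pivots.\<close>

lemma pos_def_solvable: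
  assumes "finite A" "pos_def A M"
  shows "\<exists>x. \<forall>u\<in>A. (\<Sum>w\<in>A. M u w * x w) = y u"
  using assms
proof (induction A arbitrary: M y)
  case empty
  then show ?case by simp
next
  case (insert a A)
  let ?d = "M a a"
  have d: "?d \<noteq> 0"
    using pos_def_pivot[OF _ _ insert.prems, of a] insert.hyps by auto
  from insert.IH[OF pos_def_Schur_complement[OF insert.hyps insert.prems], of "\<lambda>u. y u - M u a * y a / ?d"]
  obtain x where x: "\<And>u. u \<in> A \<Longrightarrow>
     (\<Sum>w\<in>A. (M u w - M u a * M a w / ?d) * x w) = y u - M u a * y a / ?d" by blast
  define s where "s = (\<Sum>w\<in>A. M a w * x w)"
  define x' where "x' = x(a := (y a - s) / ?d)"
  have x': "(\<Sum>w\<in>A. M u w * x' w) = (\<Sum>w\<in>A. M u w * x w)" for u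
    using insert.hyps by (intro sum.cong) (auto simp: x'_def)
  have xa: "x' a = (y a - s) / ?d" by (simp add: x'_def)
  have "(\<Sum>w\<in>insert a A. M u w * x' w) = y u" if u: "u \<in> insert a A" for u
  proof (cases "u = a")
    case True
    then show ?thesis using insert.hyps d by (simp add: x' xa s_def)
  next
    case False
    have "(\<Sum>w\<in>A. (M u w - M u a * M a w / ?d) * x w) = (\<Sum>w\<in>A. M u w * x w) - M u a * s / ?d"
      by (simp add: s_def left_diff_distrib sum_subtractf sum_distrib_left sum_divide_distrib mult.assoc)
    with x[of u] u False have "(\<Sum>w\<in>A. M u w * x w) - M u a * s / ?d = y u - M u a * y a / ?d"
      by (metis insertE)
    then have "(\<Sum>w\<in>A. M u w * x w) = y u - M u a * y a / ?d + M u a * s / ?d"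
      by (simp add: algebra_simps)
    then show ?thesis using insert.hyps d by (simp add: x' xa) (simp add: field_simps)
  qed
  then show ?case by blast
qed

text \<open>Polarisation with the vectors \<open>e\<^sub>u + c e\<^sub>w\<close> for \<open>c\<close> in \<open>0, 1, -1, \<i>\<close>.\<close>

lemma hermitian_of_real_qform:
  assumes fin: "finite A" and real: "\<And>v. qform A M v \<in> \<real>" and u: "u \<in> A" and w: "w \<in> A"
  shows "M w u = cnj (M u w)"
proof -
  have pick: "(\<Sum>x\<in>A. ((if x = u then a else 0) + (if x = w then c else 0)) * f x) = a * f u + c * f w"
    for a c :: complex and f
    using fin u w by (simp add: distrib_right sum.distrib if_distrib[of "\<lambda>y. y * _"] cong: if_cong)
  have expand: "qform A M (\<lambda>x. (if x = u then 1 else 0) + (if x = w then c else 0))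
      = M u u + c * M u w + cnj c * M w u + cnj c * c * M w w" for c
  proof -
    have "qform A M (\<lambda>x. (if x = u then 1 else 0) + (if x = w then c else 0))
        = (\<Sum>x\<in>A. ((if x = u then 1 else 0) + (if x = w then cnj c else 0)) *
            (\<Sum>y\<in>A. ((if y = u then 1 else 0) + (if y = w then c else 0)) * M x y))"
      unfolding qform_def sum_distrib_left
      by (intro sum.cong refl) (auto simp: algebra_simps)
    then show ?thesis by (simp only: pick) (simp add: algebra_simps)
  qed
  have diag: "Im (M x x) = 0" if "x \<in> {u, w}" for x
    using real[of "\<lambda>y. (if y = u then 1 else 0) + (if y = w then 0 else 0)"]
      real[of "\<lambda>y. (if y = u then 1 else 0) + (if y = w then 1 else 0)"]
      real[of "\<lambda>y. (if y = u then 1 else 0) + (if y = w then - 1 else 0)"] that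
    unfolding expand by (auto simp: complex_is_Real_iff)
  have "Im (M u w + M w u) = 0" "Re (M u w) - Re (M w u) = 0"
    using real[of "\<lambda>y. (if y = u then 1 else 0) + (if y = w then 1 else 0)"]
      real[of "\<lambda>y. (if y = u then 1 else 0) + (if y = w then \<i> else 0)"] diag
    unfolding expand by (auto simp: complex_is_Real_iff)
  then show ?thesis by (simp add: complex_eq_iff)
qed

text \<open>
  Kronecker products. With \<open>M = R\<^sup>* R\<close> the form of the product is a sum of forms of \<open>H\<close>, one for each row
  of \<open>R\<close>.
\<close>

lemma pos_def_product:
  assumes fin: "finite A" "finite C" and M: "pos_def A M" and H: "pos_def C H"
  shows "pos_def (A \<times> C) (\<lambda>x y. M (fst x) (fst y) * H (snd x) (snd y))"
proof -
  define K where "K x y = M (fst x) (fst y) * H (snd x) (snd y)" for x y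
  obtain R where R: "\<And>u w. u \<in> A \<Longrightarrow> w \<in> A \<Longrightarrow> M u w = (\<Sum>i\<in>A. cnj (R i u) * R i w)"
    using pos_def_Cholesky[OF fin(1) M] by blast
  have "pos_def (A \<times> C) K"
    unfolding pos_def_def
  proof (intro conjI ballI allI impI)
    show "K y x = cnj (K x y)" if "x \<in> A \<times> C" "y \<in> A \<times> C" for x y
      using that pos_def_hermitian[OF M, of "fst x" "fst y"] pos_def_hermitian[OF H, of "snd x" "snd y"]
      by (auto simp: K_def)
    fix v assume nz: "\<exists>x\<in>A \<times> C. v x \<noteq> (0::complex)"
    define c where "c i p = (\<Sum>u\<in>A. R i u * v (u, p))" for i p
    have "qform (A \<times> C) K v
        = (\<Sum>u\<in>A. \<Sum>p\<in>C. \<Sum>w\<in>A. \<Sum>q\<in>C. cnj (v (u, p)) * (M u w * H p q) * v (w, q))"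
      by (simp add: qform_def K_def sum.cartesian_product')
    also have "\<dots> = (\<Sum>u\<in>A. \<Sum>p\<in>C. \<Sum>w\<in>A. \<Sum>q\<in>C. \<Sum>i\<in>A.
        cnj (R i u * v (u, p)) * H p q * (R i w * v (w, q)))"
      by (intro sum.cong refl) (simp add: R sum_distrib_left sum_distrib_right mult_ac)
    also have "\<dots> = (\<Sum>p\<in>C. \<Sum>q\<in>C. \<Sum>i\<in>A. \<Sum>u\<in>A. \<Sum>w\<in>A.
        cnj (R i u * v (u, p)) * H p q * (R i w * v (w, q)))" (is "_ = ?S")
    proof -
      let ?T = "\<lambda>u p w q i. cnj (R i u * v (u, p)) * H p q * (R i w * v (w, q))"
      have "(\<Sum>u\<in>A. \<Sum>p\<in>C. \<Sum>w\<in>A. \<Sum>q\<in>C. \<Sum>i\<in>A. ?T u p w q i)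
          = (\<Sum>p\<in>C. \<Sum>u\<in>A. \<Sum>w\<in>A. \<Sum>q\<in>C. \<Sum>i\<in>A. ?T u p w q i)"
        by (rule sum.swap)
      also have "\<dots> = (\<Sum>p\<in>C. \<Sum>u\<in>A. \<Sum>q\<in>C. \<Sum>w\<in>A. \<Sum>i\<in>A. ?T u p w q i)"
        by (intro sum.cong refl sum.swap)
      also have "\<dots> = (\<Sum>p\<in>C. \<Sum>q\<in>C. \<Sum>u\<in>A. \<Sum>w\<in>A. \<Sum>i\<in>A. ?T u p w q i)"
        by (intro sum.cong refl sum.swap)
      also have "\<dots> = (\<Sum>p\<in>C. \<Sum>q\<in>C. \<Sum>u\<in>A. \<Sum>i\<in>A. \<Sum>w\<in>A. ?T u p w q i)"
        by (intro sum.cong refl sum.swap)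
      also have "\<dots> = (\<Sum>p\<in>C. \<Sum>q\<in>C. \<Sum>i\<in>A. \<Sum>u\<in>A. \<Sum>w\<in>A. ?T u p w q i)"
        by (intro sum.cong refl sum.swap)
      finally show ?thesis .
    qed
    also have "?S = (\<Sum>p\<in>C. \<Sum>q\<in>C. \<Sum>i\<in>A. cnj (c i p) * H p q * c i q)"
      by (simp add: c_def sum_distrib_left sum_distrib_right mult_ac)
    also have "\<dots> = (\<Sum>p\<in>C. \<Sum>i\<in>A. \<Sum>q\<in>C. cnj (c i p) * H p q * c i q)"
      by (intro sum.cong refl sum.swap)
    also have "\<dots> = (\<Sum>i\<in>A. qform C H (c i))"
      unfolding qform_def by (rule sum.swap)
    finally have eq: "qform (A \<times> C) K v = (\<Sum>i\<in>A. qform C H (c i))" .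
    show "0 < Re (qform (A \<times> C) K v)"
    proof (rule ccontr)
      assume "\<not> ?thesis"
      then have "(\<Sum>i\<in>A. Re (qform C H (c i))) \<le> 0" by (simp add: eq)
      then have "Re (qform C H (c i)) = 0" if "i \<in> A" for i
        using that fin pos_def_qform_nonneg[OF H]
        by (metis (mono_tags, lifting) order_antisym sum_nonneg sum_nonneg_eq_0_iff)
      then have "qform C H (c i) = 0" if "i \<in> A" for i
        using that pos_def_qform_Reals[OF H, of "c i"]
        by (auto simp: complex_eq_iff complex_is_Real_iff)
      then have c0: "c i p = 0" if "i \<in> A" "p \<in> C" for i p
        using that pos_def_qform_eq_0[OF H] by blast
      have "v (u, p) = 0" if "u \<in> A" "p \<in> C" for u p
      proof -
        have "qform A M (\<lambda>u. v (u, p))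
            = (\<Sum>u\<in>A. \<Sum>w\<in>A. \<Sum>i\<in>A. cnj (R i u * v (u, p)) * (R i w * v (w, p)))"
          unfolding qform_def
          by (intro sum.cong refl) (simp add: R sum_distrib_left sum_distrib_right mult_ac)
        also have "\<dots> = (\<Sum>u\<in>A. \<Sum>i\<in>A. \<Sum>w\<in>A. cnj (R i u * v (u, p)) * (R i w * v (w, p)))"
          by (intro sum.cong refl sum.swap)
        also have "\<dots> = (\<Sum>u\<in>A. \<Sum>i\<in>A. cnj (R i u * v (u, p)) * c i p)"
          by (simp add: c_def sum_distrib_left)
        also have "\<dots> = 0" using c0 that by simp
        finally show ?thesis using pos_def_qform_eq_0[OF M] that by blast
      qed
      then show False using nz by auto
    qed
  qed
  then show ?thesis unfolding K_def .
qed

lemma pos_def_transpose: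
  assumes "pos_def A M"
  shows "pos_def A (\<lambda>u w. M w u)"
  unfolding pos_def_def
proof (intro conjI ballI allI impI)
  show "M u w = cnj (M w u)" if "u \<in> A" "w \<in> A" for u w
    using pos_def_hermitian[OF assms that(2,1)] by simp
  fix v :: "'a \<Rightarrow> complex" assume "\<exists>u\<in>A. v u \<noteq> 0"
  then obtain u where u: "u \<in> A" "cnj (v u) \<noteq> 0" by auto
  have "qform A (\<lambda>u w. M w u) v = qform A M (\<lambda>u. cnj (v u))"
    unfolding qform_def by (subst sum.swap) (simp add: mult_ac)
  then show "0 < Re (qform A (\<lambda>u w. M w u) v)"
    using pos_def_qform_pos[OF assms u(1), of "\<lambda>u. cnj (v u)"] u(2) by simp
qed

section \<open>Entries of tensors and linear maps\<close>

text \<open>The possible row (or column) indices of the \<open>k\<close>-th tensor power.\<close>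

definition idx :: "nat list \<Rightarrow> nat \<Rightarrow> index set" where
  "idx ns k = {r. length r = k \<and> set r \<subseteq> block_idx ns}"

lemma finite_idx: "finite (idx ns k)"
  using finite_lists_length_eq[OF finite_block_idx, of ns k] by (simp add: idx_def conj_commute)

lemma unit_idx_iff: "(p, q) \<in> unit_idx ns k \<longleftrightarrow> p \<in> idx ns k \<and> q \<in> idx ns k \<and> map fst p = map fst q"
  by (auto simp: unit_idx_def idx_def dest: map_eq_imp_length_eq)

lemma idx_length: "p \<in> idx ns k \<Longrightarrow> length p = k"
  by (simp add: idx_def)

lemma idx_0 [simp]: "idx ns 0 = {[]}"
  by (auto simp: idx_def)

lemma Cons_in_idx: "u # p \<in> idx ns (Suc k) \<longleftrightarrow> u \<in> block_idx ns \<and> p \<in> idx ns k"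
  by (auto simp: idx_def)

lemma append_in_idx: "length p = j \<Longrightarrow> p @ s \<in> idx ns (j + r) \<longleftrightarrow> p \<in> idx ns j \<and> s \<in> idx ns r"
  by (auto simp: idx_def)

lemma singleton_in_idx: "[u] \<in> idx ns 1 \<longleftrightarrow> u \<in> block_idx ns"
  by (auto simp: idx_def)

lemma snoc_in_idx: "p @ [u] \<in> idx ns (Suc k) \<longleftrightarrow> p \<in> idx ns k \<and> u \<in> block_idx ns"
  by (auto simp: idx_def)

lemma idx_1E:
  assumes "p \<in> idx ns 1"
  obtains u where "p = [u]" "u \<in> block_idx ns"
  using assms by (auto simp: idx_def length_Suc_conv)

lemma idx_SucE:
  assumes "p \<in> idx ns (Suc k)"
  obtains u p' where "p = u # p'" "u \<in> block_idx ns" "p' \<in> idx ns k"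
  using assms by (auto simp: idx_def length_Suc_conv)

lemma idx_snocE:
  assumes "p \<in> idx ns (Suc k)"
  obtains p' u where "p = p' @ [u]" "p' \<in> idx ns k" "u \<in> block_idx ns"
proof (cases p rule: rev_cases)
  case Nil
  then show ?thesis using assms by (simp add: idx_def)
next
  case (snoc p' u)
  then show ?thesis using assms that by (simp add: snoc_in_idx)
qed

lemma idx_appendE:
  assumes "p \<in> idx ns (j + r)"
  obtains p' s where "p = p' @ s" "p' \<in> idx ns j" "s \<in> idx ns r"
proof
  show "p = take j p @ drop j p" by simp
  show "take j p \<in> idx ns j" "drop j p \<in> idx ns r"
    using assms by (auto simp: idx_def dest: in_set_takeD in_set_dropD)
qed

lemma sum_idx_append:
  "(\<Sum>p\<in>idx ns (j + r). f p) = (\<Sum>p\<in>idx ns j. \<Sum>s\<in>idx ns r. f (p @ s))"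
  unfolding sum.cartesian_product
  by (rule sum.reindex_bij_witness[of _ "\<lambda>(p, s). p @ s" "\<lambda>p. (take j p, drop j p)"])
     (auto simp: idx_def dest: in_set_takeD in_set_dropD)

lemma sum_idx_1: "(\<Sum>p\<in>idx ns 1. f p) = (\<Sum>u\<in>block_idx ns. f [u])"
  by (rule sum.reindex_bij_witness[of _ "\<lambda>u. [u]" hd]) (auto simp: idx_def length_Suc_conv)

lemma sum_idx_Suc: "(\<Sum>p\<in>idx ns (Suc k). f p) = (\<Sum>u\<in>block_idx ns. \<Sum>p\<in>idx ns k. f (u # p))"
  using sum_idx_append[of f ns 1 k] by (simp add: sum_idx_1[unfolded One_nat_def])

lemma sum_idx_snoc: "(\<Sum>p\<in>idx ns (Suc k). f p) = (\<Sum>p\<in>idx ns k. \<Sum>u\<in>block_idx ns. f (p @ [u]))"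
  using sum_idx_append[of f ns k 1] by (simp add: sum_idx_1[unfolded One_nat_def])

lemma idx_2E:
  assumes "p \<in> idx ns 2"
  obtains u w where "p = [u, w]" "u \<in> block_idx ns" "w \<in> block_idx ns"
  using assms by (auto simp: idx_def length_Suc_conv numeral_2_eq_2)

lemma sum_idx_2: "(\<Sum>p\<in>idx ns 2. f p) = (\<Sum>u\<in>block_idx ns. \<Sum>w\<in>block_idx ns. f [u, w])"
  by (simp add: numeral_2_eq_2 sum_idx_Suc)

lemma pair_in_idx: "[u, w] \<in> idx ns 2 \<longleftrightarrow> u \<in> block_idx ns \<and> w \<in> block_idx ns"
  by (auto simp: idx_def)

lemma idx_endsE:
  assumes "p \<in> idx ns (j + 2)"
  obtains u p' w where "p = u # p' @ [w]" "u \<in> block_idx ns" "p' \<in> idx ns j" "w \<in> block_idx ns"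
proof -
  from assms have "p \<in> idx ns (Suc (Suc j))" by simp
  then obtain u p1 where "p = u # p1" "u \<in> block_idx ns" "p1 \<in> idx ns (Suc j)"
    by (rule idx_SucE)
  moreover from this(3) obtain p' w where "p1 = p' @ [w]" "p' \<in> idx ns j" "w \<in> block_idx ns"
    by (rule idx_snocE)
  ultimately show thesis using that by simp
qed

lemma idx_last2E:
  assumes "p \<in> idx ns (j + 2)"
  obtains p' u w where "p = p' @ [u, w]" "p' \<in> idx ns j" "u \<in> block_idx ns" "w \<in> block_idx ns"
proof -
  from assms have "p \<in> idx ns (Suc (Suc j))" by simp
  then obtain p1 w where "p = p1 @ [w]" "p1 \<in> idx ns (Suc j)" "w \<in> block_idx ns"
    by (rule idx_snocE)
  moreover from this(2) obtain p' u where "p1 = p' @ [u]" "p' \<in> idx ns j" "u \<in> block_idx ns"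
    by (rule idx_snocE)
  ultimately show thesis using that by simp
qed

lemma sum_unit_idx:
  assumes "\<And>p q. p \<in> idx ns k \<Longrightarrow> q \<in> idx ns k \<Longrightarrow> map fst p \<noteq> map fst q \<Longrightarrow> f p q = 0"
  shows "(\<Sum>(p, q)\<in>unit_idx ns k. f p q) = (\<Sum>p\<in>idx ns k. \<Sum>q\<in>idx ns k. f p q)"
  unfolding sum.cartesian_product
  by (rule sum.mono_neutral_left) (auto simp: unit_idx_iff finite_idx assms)

lemma mul_apply: "mul ns x y p q = (\<Sum>r\<in>idx ns (length p). x p r * y r q)"
  by (simp add: mul_def idx_def)

lemma unit_idx_append:
  assumes "length p = j" "length q = j"
  shows "(p @ s, q @ t) \<in> unit_idx ns (j + r) \<longleftrightarrow> (p, q) \<in> unit_idx ns j \<and> (s, t) \<in> unit_idx ns r"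
  using assms by (auto simp: unit_idx_def)

lemma unit_idx_take_drop:
  assumes "(p, q) \<in> unit_idx ns (j + r)"
  shows "(take j p, take j q) \<in> unit_idx ns j" "(drop j p, drop j q) \<in> unit_idx ns r"
  using assms unit_idx_lengthD[OF assms]
    unit_idx_append[of "take j p" j "take j q" "drop j p" "drop j q" ns r] by simp_all

lemma unit_idx_appendI:
  "(p, q) \<in> unit_idx ns j \<Longrightarrow> (s, t) \<in> unit_idx ns r \<Longrightarrow> (p @ s, q @ t) \<in> unit_idx ns (j + r)"
  using unit_idx_append unit_idx_lengthD by blast

lemma tpowI: "(\<And>p q. x p q \<noteq> 0 \<Longrightarrow> (p, q) \<in> unit_idx ns k) \<Longrightarrow> x \<in> tpow ns k"
  by (auto simp: tpow_def)

lemma tpow_zero: "x \<in> tpow ns k \<Longrightarrow> (p, q) \<notin> unit_idx ns k \<Longrightarrow> x p q = 0"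
  by (auto simp: tpow_def)

lemma tpow_nonzero: "x \<in> tpow ns k \<Longrightarrow> x p q \<noteq> 0 \<Longrightarrow> p \<in> idx ns k \<and> q \<in> idx ns k \<and> map fst p = map fst q"
  using tpow_zero unit_idx_iff by blast

lemma tpow_eqI:
  assumes "x \<in> tpow ns k" "y \<in> tpow ns k"
    and "\<And>p q. p \<in> idx ns k \<Longrightarrow> q \<in> idx ns k \<Longrightarrow> map fst p = map fst q \<Longrightarrow> x p q = y p q"
  shows "x = y"
proof (intro ext)
  fix p q
  show "x p q = y p q"
    using assms(3)[of p q] tpow_zero[OF assms(1)] tpow_zero[OF assms(2)]
    by (cases "(p, q) \<in> unit_idx ns k") (auto simp: unit_idx_iff)
qed

lemma tpow_subspace: "module.subspace scale (tpow ns k)"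
proof -
  interpret vector_space scale by (rule vector_space_scale)
  show ?thesis by (auto simp: subspace_def tpow_def scale_def)
qed

lemma tpow_add: "x \<in> tpow ns k \<Longrightarrow> y \<in> tpow ns k \<Longrightarrow> x + y \<in> tpow ns k"
  and tpow_scale: "x \<in> tpow ns k \<Longrightarrow> scale c x \<in> tpow ns k"
  by (auto simp: tpow_def scale_def)

lemma tpow_diff: "x \<in> tpow ns k \<Longrightarrow> y \<in> tpow ns k \<Longrightarrow> x - y \<in> tpow ns k"
  by (auto simp: tpow_def)

lemma tpow_star: "x \<in> tpow ns k \<Longrightarrow> star x \<in> tpow ns k"
  by (rule tpowI) (auto simp: star_def unit_idx_iff dest: tpow_nonzero)

lemma tpow_mul: 
  assumes "x \<in> tpow ns k" "y \<in> tpow ns k" 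
  shows "mul ns x y \<in> tpow ns k"
proof (rule tpowI)
  fix p q assume "mul ns x y p q \<noteq> 0"
  then obtain r where "x p r * y r q \<noteq> 0" unfolding mul_apply by (rule sum.not_neutral_contains_not_neutral)
  then show "(p, q) \<in> unit_idx ns k"
    using tpow_nonzero[OF assms(1), of p r] tpow_nonzero[OF assms(2), of r q] by (auto simp: unit_idx_iff)
qed

lemma tpow_mat_unit: "(p, q) \<in> unit_idx ns k \<Longrightarrow> mat_unit p q \<in> tpow ns k"
  by (auto simp: tpow_def mat_unit_def)

lemma tpow_unit_el: "unit_el ns k \<in> tpow ns k"
  by (auto simp: tpow_def unit_el_def)

lemma unit_el_apply: "unit_el ns k p q = (if p = q \<and> p \<in> idx ns k then 1 else 0)"
  by (simp add: unit_el_def unit_idx_iff)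

lemma tpow_kron:
  assumes "x \<in> tpow ns j" "y \<in> tpow ns r"
  shows "kron j x y \<in> tpow ns (j + r)"
proof (rule tpowI)
  fix p q assume "kron j x y p q \<noteq> 0"
  then have "(take j p, take j q) \<in> unit_idx ns j" "(drop j p, drop j q) \<in> unit_idx ns r"
    using assms by (auto simp: kron_def tpow_def)
  then show "(p, q) \<in> unit_idx ns (j + r)"
    using unit_idx_append[of "take j p" j "take j q" "drop j p" "drop j q" ns r]
    by (auto dest: unit_idx_lengthD)
qed

lemma kron_append:
  "length p = j \<Longrightarrow> length q = j \<Longrightarrow> kron j x y (p @ s) (q @ t) = x p q * y s t"
  by (simp add: kron_def)

lemma kron_mat_unit:
  "length p = j \<Longrightarrow> length q = j \<Longrightarrow> kron j (mat_unit p q) (mat_unit s t) = mat_unit (p @ s) (q @ t)"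
  by (auto simp: kron_def mat_unit_def fun_eq_iff) (metis append_take_drop_id)+

lemma star_kron: "star (kron j x y) = kron j (star x) (star y)"
  by (simp add: star_def kron_def)

lemma star_unit_el: "star (unit_el ns k) = unit_el ns k"
  by (auto simp: star_def unit_el_apply fun_eq_iff)

lemma star_star: "star (star x) = x"
  by (simp add: star_def)

lemma unit_el_kron: "unit_el ns (j + r) = kron j (unit_el ns j) (unit_el ns r)"
proof (rule tpow_eqI[OF tpow_unit_el tpow_kron[OF tpow_unit_el tpow_unit_el]])
  fix p q assume "p \<in> idx ns (j + r)" "q \<in> idx ns (j + r)"
  then obtain p1 p2 q1 q2 where "p = p1 @ p2" "q = q1 @ q2" "p1 \<in> idx ns j" "p2 \<in> idx ns r"
    "q1 \<in> idx ns j" "q2 \<in> idx ns r" by (metis idx_appendE)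
  then show "unit_el ns (j + r) p q = kron j (unit_el ns j) (unit_el ns r) p q"
    by (auto simp: kron_append unit_el_apply append_in_idx idx_length)
qed

lemma mul_assoc: "mul ns (mul ns x y) z = mul ns x (mul ns y z)"
proof (intro ext)
  fix p q
  have "mul ns (mul ns x y) z p q = (\<Sum>s\<in>idx ns (length p). \<Sum>r\<in>idx ns (length p). x p r * y r s * z s q)"
    by (simp add: mul_apply sum_distrib_right)
  also have "\<dots> = (\<Sum>r\<in>idx ns (length p). \<Sum>s\<in>idx ns (length p). x p r * y r s * z s q)"
    by (rule sum.swap)
  also have "\<dots> = mul ns x (mul ns y z) p q"
    by (simp add: mul_apply sum_distrib_left mult.assoc idx_length)
  finally show "mul ns (mul ns x y) z p q = mul ns x (mul ns y z) p q" .
qed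

lemma mul_add_left: "mul ns (x + y) z = mul ns x z + mul ns y z"
  and mul_add_right: "mul ns z (x + y) = mul ns z x + mul ns z y"
  and mul_scale_left: "mul ns (scale c x) z = scale c (mul ns x z)"
  and mul_scale_right: "mul ns z (scale c x) = scale c (mul ns z x)"
  by (simp_all add: fun_eq_iff mul_apply scale_def sum.distrib sum_distrib_left algebra_simps)

lemma star_scale: "star (scale c x) = scale (cnj c) (star x)"
  by (simp add: fun_eq_iff star_def scale_def)

lemma kron_add_left: "kron j (x + y) z = kron j x z + kron j y z"
  and kron_add_right: "kron j z (x + y) = kron j z x + kron j z y"
  and kron_scale_left: "kron j (scale c x) z = scale c (kron j x z)"
  and kron_scale_right: "kron j z (scale c x) = scale c (kron j z x)"
  by (simp_all add: fun_eq_iff kron_def scale_def algebra_simps)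

lemma star_mul:
  assumes "x \<in> tpow ns k" "y \<in> tpow ns k"
  shows "star (mul ns x y) = mul ns (star y) (star x)"
proof (rule tpow_eqI[OF tpow_star[OF tpow_mul[OF assms]] tpow_mul[OF tpow_star[OF assms(2)] tpow_star[OF assms(1)]]])
  fix p q assume "p \<in> idx ns k" "q \<in> idx ns k"
  then show "star (mul ns x y) p q = mul ns (star y) (star x) p q"
    by (simp add: star_def mul_apply idx_length mult.commute)
qed

lemma mul_unit_left:
  assumes "x \<in> tpow ns k"
  shows "mul ns (unit_el ns k) x = x"
proof (rule tpow_eqI[OF tpow_mul[OF tpow_unit_el assms] assms])
  fix p q assume "p \<in> idx ns k"
  then show "mul ns (unit_el ns k) x p q = x p q"
    by (simp add: mul_apply unit_el_apply idx_length finite_idx if_distrib[of "\<lambda>c. c * _"] cong: if_cong)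
qed

lemma mul_unit_right:
  assumes "x \<in> tpow ns k"
  shows "mul ns x (unit_el ns k) = x"
proof (rule tpow_eqI[OF tpow_mul[OF assms tpow_unit_el] assms])
  fix p q assume pq: "p \<in> idx ns k" "q \<in> idx ns k"
  have "mul ns x (unit_el ns k) p q = (\<Sum>r\<in>idx ns k. if r = q then x p q else 0)"
    unfolding mul_apply using pq by (intro sum.cong) (auto simp: unit_el_apply idx_length)
  then show "mul ns x (unit_el ns k) p q = x p q"
    using pq by (simp add: finite_idx)
qed

lemma mat_unit_kron2: "kron 1 (mat_unit [a] [b]) (mat_unit [c] [d]) = mat_unit [a, c] [b, d]"
  by (simp add: kron_mat_unit)

lemma kron_kron: "kron (j + r) (kron j x y) z = kron j x (kron r y z)"
  by (simp add: kron_def fun_eq_iff take_drop min_def add.commute)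

text \<open>
  The next three lemmas are entries of products with \<open>x \<otimes> 1\<close> and with \<open>1 \<otimes> b\<close>, where only the legs on
  which the factor acts are summed over.
\<close>

lemma mul_kron_left:
  assumes "length p = j" "s \<in> idx ns r"
  shows "mul ns (kron j x (unit_el ns r)) z (p @ s) Q = (\<Sum>t\<in>idx ns j. x p t * z (t @ s) Q)"
proof -
  have "mul ns (kron j x (unit_el ns r)) z (p @ s) Q
      = (\<Sum>t\<in>idx ns j. \<Sum>s'\<in>idx ns r. if s' = s then x p t * z (t @ s) Q else 0)"
    using assms by (auto simp: mul_apply sum_idx_append kron_append idx_length unit_el_apply intro!: sum.cong)
  then show ?thesis using assms by (simp add: finite_idx)
qed

lemma mul_kron_unit_left:
  assumes "z \<in> tpow ns (j + r)" "p \<in> idx ns j" "length s = r"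
  shows "mul ns (kron j (unit_el ns j) b) z (p @ s) Q = (\<Sum>t\<in>idx ns r. b s t * z (p @ t) Q)"
proof -
  have "mul ns (kron j (unit_el ns j) b) z (p @ s) Q
      = (\<Sum>q\<in>idx ns j. \<Sum>t\<in>idx ns r. unit_el ns j p q * b s t * z (q @ t) Q)"
    using assms(2,3) by (simp add: mul_apply sum_idx_append kron_append idx_length)
  also have "\<dots> = (\<Sum>q\<in>idx ns j. if q = p then \<Sum>t\<in>idx ns r. b s t * z (p @ t) Q else 0)"
    by (intro sum.cong refl) (auto simp: unit_el_apply assms(2))
  also have "\<dots> = (\<Sum>t\<in>idx ns r. b s t * z (p @ t) Q)"
    using assms(2) by (simp add: finite_idx)
  finally show ?thesis .
qed

lemma mul_kron_unit_right:
  assumes "z \<in> tpow ns (j + r)" "q \<in> idx ns j"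
  shows "mul ns z (kron j (unit_el ns j) b) P (q @ t) = (\<Sum>s\<in>idx ns r. z P (q @ s) * b s t)"
proof (cases "length P = j + r")
  case True
  have "mul ns z (kron j (unit_el ns j) b) P (q @ t)
      = (\<Sum>p\<in>idx ns j. \<Sum>s\<in>idx ns r. z P (p @ s) * (unit_el ns j p q * b s t))"
    using assms(2) by (simp add: mul_apply True sum_idx_append kron_append idx_length)
  also have "\<dots> = (\<Sum>p\<in>idx ns j. if p = q then \<Sum>s\<in>idx ns r. z P (q @ s) * b s t else 0)"
    by (intro sum.cong refl) (auto simp: unit_el_apply)
  also have "\<dots> = (\<Sum>s\<in>idx ns r. z P (q @ s) * b s t)"
    using assms(2) by (simp add: finite_idx)
  finally show ?thesis .
next
  case False
  then have "z P Q = 0" for Q using tpow_nonzero[OF assms(1)] by (auto simp: idx_def)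
  then show ?thesis by (simp add: mul_apply)
qed

text \<open>
  The element of the \<open>k\<close>-th tensor power with the entries \<open>f p q\<close> at the positions of the blocks. Explicit
  formulas for maps into a tensor power are stated with it, since there \<open>f\<close> is often meaningful only at
  these positions.
\<close>

definition truncate :: "nat list \<Rightarrow> nat \<Rightarrow> tensor \<Rightarrow> tensor" where
  "truncate ns k f = (\<lambda>p q. if (p, q) \<in> unit_idx ns k then f p q else 0)"

lemma tpow_truncate: "truncate ns k f \<in> tpow ns k"
  by (simp add: truncate_def tpow_def)

lemma truncate_apply:
  "p \<in> idx ns k \<Longrightarrow> q \<in> idx ns k \<Longrightarrow> map fst p = map fst q \<Longrightarrow> truncate ns k f p q = f p q"
  by (simp add: truncate_def unit_idx_iff)

abbreviation tensor_linear :: "(tensor \<Rightarrow> tensor) \<Rightarrow> bool" where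
  "tensor_linear \<equiv> Vector_Spaces.linear scale scale"

lemma tensor_linearI:
  "(\<And>x y. F (x + y) = F x + F y) \<Longrightarrow> (\<And>c x. F (scale c x) = scale c (F x)) \<Longrightarrow> tensor_linear F"
  unfolding Vector_Spaces.linear_iff by (simp add: vector_space_scale)

lemma tensor_linear_add: "tensor_linear F \<Longrightarrow> F (x + y) = F x + F y"
  and tensor_linear_scale: "tensor_linear F \<Longrightarrow> F (scale c x) = scale c (F x)"
  by (simp_all add: Vector_Spaces.linear_iff)

lemma tensor_linear_sum:
  assumes "tensor_linear F"
  shows "F (\<Sum>i\<in>I. g i) = (\<Sum>i\<in>I. F (g i))"
  using assms module_hom.sum[of scale scale F g I] by (simp add: Vector_Spaces.linear_def)

lemma tpow_expand_append:
  assumes "x \<in> tpow ns (j + r)"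
  shows "x = (\<Sum>(p, q)\<in>unit_idx ns j. \<Sum>(s, t)\<in>unit_idx ns r.
                scale (x (p @ s) (q @ t)) (kron j (mat_unit p q) (mat_unit s t)))"
proof -
  have "x = (\<Sum>(p, q)\<in>unit_idx ns (j + r). scale (x p q) (mat_unit p q))"
    by (rule tpow_expand[OF assms])
  also have "\<dots> = (\<Sum>((p, q), (s, t))\<in>unit_idx ns j \<times> unit_idx ns r.
                scale (x (p @ s) (q @ t)) (mat_unit (p @ s) (q @ t)))"
    by (rule sum.reindex_bij_witness[of _ "\<lambda>((p, q), (s, t)). (p @ s, q @ t)"
          "\<lambda>(p, q). ((take j p, take j q), (drop j p, drop j q))"])
       (auto intro: unit_idx_appendI dest: unit_idx_take_drop unit_idx_lengthD)
  also have "\<dots> = (\<Sum>(p, q)\<in>unit_idx ns j. \<Sum>(s, t)\<in>unit_idx ns r.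
                scale (x (p @ s) (q @ t)) (kron j (mat_unit p q) (mat_unit s t)))"
    unfolding sum.cartesian_product[symmetric]
    by (auto simp: kron_mat_unit case_prod_unfold dest!: unit_idx_lengthD intro!: sum.cong)
  finally show ?thesis .
qed

text \<open>
  The extension by \<open>lin_ext\<close> is found by guessing a linear map \<open>G\<close> and comparing it on matrix units only.
\<close>

lemma lin_ext_linear:
  assumes "x \<in> tpow ns (j + r)" "tensor_linear G"
    and "\<And>p q s t. (p, q) \<in> unit_idx ns j \<Longrightarrow> (s, t) \<in> unit_idx ns r \<Longrightarrow>
           F (mat_unit p q) (mat_unit s t) = G (kron j (mat_unit p q) (mat_unit s t))"
  shows "lin_ext ns j r F x = G x"
proof -
  have "G x = (\<Sum>(p, q)\<in>unit_idx ns j. \<Sum>(s, t)\<in>unit_idx ns r.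
                scale (x (p @ s) (q @ t)) (G (kron j (mat_unit p q) (mat_unit s t))))"
    by (subst tpow_expand_append[OF assms(1)])
       (simp add: tensor_linear_sum[OF assms(2)] tensor_linear_scale[OF assms(2)] case_prod_unfold)
  also have "\<dots> = lin_ext ns j r F x"
    unfolding lin_ext_def using assms(3) by (intro sum.cong refl) (auto intro!: sum.cong)
  finally show ?thesis ..
qed

lemma scale_apply: "scale c x p q = c * x p q"
  by (simp add: scale_def)

lemma truncate_linearI:
  assumes "\<And>x y p q. (p, q) \<in> unit_idx ns k \<Longrightarrow> f (x + y) p q = f x p q + f y p q"
    and "\<And>c x p q. (p, q) \<in> unit_idx ns k \<Longrightarrow> f (scale c x) p q = c * f x p q"
  shows "tensor_linear (\<lambda>x. truncate ns k (f x))"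
  by (rule tensor_linearI) (auto simp: truncate_def scale_apply fun_eq_iff assms)

lemma lin_ext_tensor_linear: "tensor_linear (lin_ext ns j r F)"
  by (rule tensor_linearI)
     (simp_all add: lin_ext_def fun_eq_iff sum_fun_apply2 scale_def case_prod_unfold
        distrib_right sum.distrib sum_distrib_left mult.assoc)

lemma tpow_sum: "(\<And>i. i \<in> I \<Longrightarrow> f i \<in> tpow ns k) \<Longrightarrow> (\<Sum>i\<in>I. f i) \<in> tpow ns k"
  by (auto simp: tpow_def sum_fun_apply2)

section \<open>The Gram matrix of a faithful state\<close>

text \<open>
  For \<open>u\<close> and \<open>w\<close> in different blocks the matrix unit is not an element of \<open>B\<close>, and the entry is set to \<open>0\<close>.
\<close>

definition gram :: "(tensor \<Rightarrow> complex) \<Rightarrow> nat \<times> nat \<Rightarrow> nat \<times> nat \<Rightarrow> complex" where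
  "gram \<psi> u w = (if fst u = fst w then \<psi> (mat_unit [u] [w]) else 0)"

text \<open>The Kronecker power of the Gram matrix: the values of \<open>\<psi> \<otimes> \<dots> \<otimes> \<psi>\<close> on matrix units.\<close>

definition gram_pow :: "(tensor \<Rightarrow> complex) \<Rightarrow> index \<Rightarrow> index \<Rightarrow> complex" where
  "gram_pow \<psi> p q = (\<Prod>t<length p. gram \<psi> (p ! t) (q ! t))"

lemma gram_pow_Nil [simp]: "gram_pow \<psi> [] [] = 1"
  by (simp add: gram_pow_def)

lemma gram_pow_Cons: "gram_pow \<psi> (u # p) (w # q) = gram \<psi> u w * gram_pow \<psi> p q"
  unfolding gram_pow_def length_Cons prod.lessThan_Suc_shift by simp

lemma gram_pow_eq_0:
  assumes "length p = length q" "map fst p \<noteq> map fst q"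
  shows "gram_pow \<psi> p q = 0"
proof -
  obtain t where "t < length p" "fst (p ! t) \<noteq> fst (q ! t)"
    using assms by (auto simp: list_eq_iff_nth_eq)
  then show ?thesis unfolding gram_pow_def by (intro prod_zero) (auto simp: gram_def)
qed

lemma psi_pow_eq:
  "psi_pow ns \<psi> k x = (\<Sum>p\<in>idx ns k. \<Sum>q\<in>idx ns k. x p q * gram_pow \<psi> p q)"
proof -
  have "psi_pow ns \<psi> k x = (\<Sum>(p, q)\<in>unit_idx ns k. x p q * gram_pow \<psi> p q)"
    unfolding psi_pow_def
  proof (intro sum.cong refl, clarify)
    fix p q assume pq: "(p, q) \<in> unit_idx ns k"
    have "(\<Prod>t<k. \<psi> (mat_unit [p ! t] [q ! t])) = gram_pow \<psi> p q"
      unfolding gram_pow_def using unit_idx_lengthD[OF pq] pq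
      by (intro prod.cong) (auto simp: gram_def unit_idx_def list_eq_iff_nth_eq)
    then show "x p q * (\<Prod>t<k. \<psi> (mat_unit [p ! t] [q ! t])) = x p q * gram_pow \<psi> p q" by simp
  qed
  also have "\<dots> = (\<Sum>p\<in>idx ns k. \<Sum>q\<in>idx ns k. x p q * gram_pow \<psi> p q)"
    by (rule sum_unit_idx) (simp add: gram_pow_eq_0 idx_length)
  finally show ?thesis .
qed

lemma l2_inner_eq:
  "l2_inner ns \<psi> k x y =
     (\<Sum>p\<in>idx ns k. \<Sum>q\<in>idx ns k. \<Sum>r\<in>idx ns k. cnj (x r p) * gram_pow \<psi> p q * y r q)"
  unfolding l2_inner_def psi_pow_eq
  by (intro sum.cong refl) (simp add: mul_apply star_def idx_length sum_distrib_left sum_distrib_right mult_ac)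

text \<open>The map \<open>\<psi> \<otimes> \<dots> \<otimes> \<psi> \<otimes> id\<close>, with the functional on the first \<open>j\<close> legs.\<close>

definition psi_slice :: "nat list \<Rightarrow> (tensor \<Rightarrow> complex) \<Rightarrow> nat \<Rightarrow> tensor \<Rightarrow> tensor" where
  "psi_slice ns \<psi> j z = (\<lambda>s t. \<Sum>p\<in>idx ns j. \<Sum>q\<in>idx ns j. gram_pow \<psi> p q * z (p @ s) (q @ t))"

lemma psi_slice_linear: "tensor_linear (psi_slice ns \<psi> j)"
  by (rule tensor_linearI)
     (simp_all add: psi_slice_def fun_eq_iff scale_def distrib_left sum.distrib sum_distrib_left mult_ac)

lemma psi_slice_kron: "psi_slice ns \<psi> j (kron j x y) = scale (psi_pow ns \<psi> j x) y"
  by (simp add: psi_slice_def psi_pow_eq fun_eq_iff scale_def kron_append idx_length sum_distrib_left sum_distrib_right mult_ac)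

lemma tpow_psi_slice:
  assumes "z \<in> tpow ns (j + r)"
  shows "psi_slice ns \<psi> j z \<in> tpow ns r"
proof (rule tpowI)
  fix s t assume "psi_slice ns \<psi> j z s t \<noteq> 0"
  then obtain p where p: "p \<in> idx ns j" "(\<Sum>q\<in>idx ns j. gram_pow \<psi> p q * z (p @ s) (q @ t)) \<noteq> 0"
    unfolding psi_slice_def by (rule sum.not_neutral_contains_not_neutral)
  from p(2) obtain q where q: "q \<in> idx ns j" "gram_pow \<psi> p q * z (p @ s) (q @ t) \<noteq> 0"
    by (rule sum.not_neutral_contains_not_neutral)
  then have "(p @ s, q @ t) \<in> unit_idx ns (j + r)" using assms by (auto simp: tpow_def)
  then show "(s, t) \<in> unit_idx ns r"
    using unit_idx_append[of p j q s t ns r] p(1) q(1) by (simp add: idx_length)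
qed

lemma psi_slice_mul_right:
  assumes "z \<in> tpow ns (j + r)" "b \<in> tpow ns r"
  shows "psi_slice ns \<psi> j (mul ns z (kron j (unit_el ns j) b)) = mul ns (psi_slice ns \<psi> j z) b"
proof (rule tpow_eqI)
  show "psi_slice ns \<psi> j (mul ns z (kron j (unit_el ns j) b)) \<in> tpow ns r"
    using assms by (intro tpow_psi_slice tpow_mul tpow_kron tpow_unit_el)
  show "mul ns (psi_slice ns \<psi> j z) b \<in> tpow ns r"
    using assms by (intro tpow_psi_slice tpow_mul)
  fix s t assume st: "s \<in> idx ns r" "t \<in> idx ns r"
  have "psi_slice ns \<psi> j (mul ns z (kron j (unit_el ns j) b)) s t
      = (\<Sum>p\<in>idx ns j. \<Sum>q\<in>idx ns j. \<Sum>s'\<in>idx ns r. gram_pow \<psi> p q * (z (p @ s) (q @ s') * b s' t))"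
    using assms(1) by (simp add: psi_slice_def mul_kron_unit_right sum_distrib_left)
  also have "\<dots> = (\<Sum>p\<in>idx ns j. \<Sum>s'\<in>idx ns r. \<Sum>q\<in>idx ns j. gram_pow \<psi> p q * (z (p @ s) (q @ s') * b s' t))"
    by (intro sum.cong refl sum.swap)
  also have "\<dots> = (\<Sum>s'\<in>idx ns r. \<Sum>p\<in>idx ns j. \<Sum>q\<in>idx ns j. gram_pow \<psi> p q * (z (p @ s) (q @ s') * b s' t))"
    by (rule sum.swap)
  also have "\<dots> = mul ns (psi_slice ns \<psi> j z) b s t"
    using st by (simp add: mul_apply idx_length psi_slice_def sum_distrib_left sum_distrib_right mult_ac)
  finally show "psi_slice ns \<psi> j (mul ns z (kron j (unit_el ns j) b)) s t
      = mul ns (psi_slice ns \<psi> j z) b s t" .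
qed

text \<open>A faithful state on a multimatrix algebra all of whose blocks are nonempty.\<close>

locale multimatrix_state =
  fixes ns :: "nat list" and \<psi> :: "tensor \<Rightarrow> complex"
  assumes sizes: "\<forall>n\<in>set ns. 0 < n" and faithful: "faithful_state ns \<psi>"
begin

lemma psi_expand:
  assumes "z \<in> tpow ns 1"
  shows "\<psi> z = (\<Sum>u\<in>block_idx ns. \<Sum>w\<in>block_idx ns. z [u] [w] * gram \<psi> u w)"
proof -
  have add: "\<psi> (x + y) = \<psi> x + \<psi> y" if "x \<in> tpow ns 1" "y \<in> tpow ns 1" for x y
    using that faithful by (simp add: faithful_state_def)
  have scl: "\<psi> (scale c x) = c * \<psi> x" if "x \<in> tpow ns 1" for c x
    using that faithful by (simp add: faithful_state_def)
  have zero: "0 \<in> tpow ns 1" by (simp add: tpow_def)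
  have "\<psi> 0 = 0" using scl[OF zero, of 0] by (simp add: scale_def zero_fun_def)
  have sum: "(\<Sum>i\<in>I. f i) \<in> tpow ns 1 \<and> \<psi> (\<Sum>i\<in>I. f i) = (\<Sum>i\<in>I. \<psi> (f i))"
    if "\<And>i. i \<in> I \<Longrightarrow> f i \<in> tpow ns 1" for I :: "(index \<times> index) set" and f
    using that
    by (induction I rule: infinite_finite_induct)
       (simp_all only: sum.infinite sum.empty sum.insert not_False_eq_True add zero \<open>\<psi> 0 = 0\<close>
         tpow_add insert_iff simp_thms)
  have "\<psi> z = \<psi> (\<Sum>(p, q)\<in>unit_idx ns 1. scale (z p q) (mat_unit p q))"
    using tpow_expand[OF assms] by simp
  also have "\<dots> = (\<Sum>(p, q)\<in>unit_idx ns 1. z p q * \<psi> (mat_unit p q))"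
    using sum[of "unit_idx ns 1" "\<lambda>(p, q). scale (z p q) (mat_unit p q)"]
    by (auto simp: tpow_scale tpow_mat_unit scl intro!: sum.cong)
  also have "\<dots> = (\<Sum>p\<in>idx ns 1. \<Sum>q\<in>idx ns 1. z p q * \<psi> (mat_unit p q))"
    using tpow_nonzero[OF assms] by (intro sum_unit_idx) auto
  also have "\<dots> = (\<Sum>u\<in>block_idx ns. \<Sum>w\<in>block_idx ns. z [u] [w] * \<psi> (mat_unit [u] [w]))"
    by (simp only: sum_idx_1)
  also have "\<dots> = (\<Sum>u\<in>block_idx ns. \<Sum>w\<in>block_idx ns. z [u] [w] * gram \<psi> u w)"
    using tpow_nonzero[OF assms] by (intro sum.cong refl) (fastforce simp: gram_def)
  finally show ?thesis .
qed

lemma block_rep: "u \<in> block_idx ns \<Longrightarrow> (fst u, 0) \<in> block_idx ns"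
  using sizes by (auto simp: block_idx_def)

text \<open>
  A vector supported in the block \<open>a\<close> is the row with index \<open>(a, 0)\<close> of an element \<open>x\<close> of \<open>B\<close>, and the value
  of the form is then \<open>\<psi>(x\<^sup>* x)\<close>.
\<close>

lemma gram_block_qform:
  fixes v :: "nat \<times> nat \<Rightarrow> complex" and a :: nat
  defines "v' \<equiv> (\<lambda>u. if fst u = a then v u else 0)"
  shows "qform (block_idx ns) (gram \<psi>) v' \<in> \<real>" "0 \<le> Re (qform (block_idx ns) (gram \<psi>) v')"
    and "qform (block_idx ns) (gram \<psi>) v' = 0 \<Longrightarrow> u \<in> block_idx ns \<Longrightarrow> v' u = 0"
proof -
  define x :: tensor where
    "x = (\<lambda>p q. if \<exists>w. p = [(a, 0)] \<and> q = [w] \<and> w \<in> block_idx ns \<and> fst w = a then v (hd q) else 0)"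
  have x: "x \<in> tpow ns 1"
    by (rule tpowI) (auto simp: x_def unit_idx_iff idx_def dest: block_rep split: if_splits)
  have xx: "mul ns (star x) x [u] [w] = cnj (v' u) * v' w" if "u \<in> block_idx ns" "w \<in> block_idx ns" for u w
  proof -
    have x_app: "x [r] [w] = (if r = (a, 0) then v' w else 0)" if "w \<in> block_idx ns" for r w
      using that by (cases w) (auto simp: x_def v'_def)
    have "mul ns (star x) x [u] [w]
        = (\<Sum>r\<in>block_idx ns. if r = (a, 0) then cnj (v' u) * v' w else 0)"
      by (simp add: mul_apply star_def sum_idx_1[unfolded One_nat_def] x_app that if_distrib cong: if_cong)
    also have "\<dots> = cnj (v' u) * v' w"
      using block_rep[OF that(1)] by (auto simp: finite_block_idx v'_def)
    finally show ?thesis .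
  qed
  have "\<psi> (mul ns (star x) x) = qform (block_idx ns) (gram \<psi>) v'"
    by (subst psi_expand[OF tpow_mul[OF tpow_star[OF x] x]]) (simp add: xx qform_def mult_ac)
  moreover have "\<psi> (mul ns (star x) x) \<in> \<real> \<and> 0 \<le> Re (\<psi> (mul ns (star x) x))"
      "\<psi> (mul ns (star x) x) = 0 \<longrightarrow> x = 0"
    using x faithful by (auto simp: faithful_state_def)
  ultimately show "qform (block_idx ns) (gram \<psi>) v' \<in> \<real>" "0 \<le> Re (qform (block_idx ns) (gram \<psi>) v')"
    and "qform (block_idx ns) (gram \<psi>) v' = 0 \<Longrightarrow> u \<in> block_idx ns \<Longrightarrow> v' u = 0"
  proof -
    assume "qform (block_idx ns) (gram \<psi>) v' = 0" "u \<in> block_idx ns"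
    then have "x [(a, 0)] [u] = 0"
      using \<open>\<psi> (mul ns (star x) x) = 0 \<longrightarrow> x = 0\<close> \<open>\<psi> (mul ns (star x) x) = _\<close> by simp
    then show "v' u = 0" using \<open>u \<in> block_idx ns\<close> by (cases u) (auto simp: x_def v'_def split: if_splits)
  qed auto
qed

lemma gram_qform_blocks:
  "qform (block_idx ns) (gram \<psi>) v
     = (\<Sum>a<length ns. qform (block_idx ns) (gram \<psi>) (\<lambda>u. if fst u = a then v u else 0))"
proof -
  let ?T = "\<lambda>a u w. if a = fst u then cnj (v u) * gram \<psi> u w * v w else 0"
  have "(\<Sum>a<length ns. qform (block_idx ns) (gram \<psi>) (\<lambda>u. if fst u = a then v u else 0))
      = (\<Sum>a<length ns. \<Sum>u\<in>block_idx ns. \<Sum>w\<in>block_idx ns. ?T a u w)"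
    unfolding qform_def by (intro sum.cong refl) (auto simp: gram_def)
  also have "\<dots> = (\<Sum>u\<in>block_idx ns. \<Sum>a<length ns. \<Sum>w\<in>block_idx ns. ?T a u w)"
    by (rule sum.swap)
  also have "\<dots> = (\<Sum>u\<in>block_idx ns. \<Sum>w\<in>block_idx ns. \<Sum>a<length ns. ?T a u w)"
    by (intro sum.cong refl sum.swap)
  also have "\<dots> = qform (block_idx ns) (gram \<psi>) v"
    unfolding qform_def by (intro sum.cong refl) (auto simp: block_idx_def)
  finally show ?thesis ..
qed

lemma gram_pos_def: "pos_def (block_idx ns) (gram \<psi>)"
  unfolding pos_def_def
proof (intro conjI ballI allI impI)
  let ?q = "qform (block_idx ns) (gram \<psi>)"
  have "?q v \<in> \<real>" for v
    by (subst gram_qform_blocks) (intro sum_in_Reals gram_block_qform)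
  then show "gram \<psi> w u = cnj (gram \<psi> u w)" if "u \<in> block_idx ns" "w \<in> block_idx ns" for u w
    using that by (intro hermitian_of_real_qform[OF finite_block_idx])
  fix v :: "nat \<times> nat \<Rightarrow> complex"
  assume "\<exists>u\<in>block_idx ns. v u \<noteq> 0"
  then obtain u where u: "u \<in> block_idx ns" "v u \<noteq> 0" by blast
  let ?c = "\<lambda>a u. if fst u = a then v u else 0"
  have "?q (?c (fst u)) \<noteq> 0"
    using gram_block_qform(3)[of "fst u" v u] u by auto
  then have "Re (?q (?c (fst u))) \<noteq> 0"
    using gram_block_qform(1)[of "fst u" v] by (auto simp: complex_is_Real_iff complex_eq_iff)
  then have "0 < Re (?q (?c (fst u)))" using gram_block_qform(2)[of "fst u" v] by linarith
  also have "\<dots> \<le> (\<Sum>a<length ns. Re (?q (?c a)))"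
    using u gram_block_qform(2) by (intro member_le_sum) (auto simp: block_idx_def)
  also have "\<dots> = Re (?q v)" by (subst (2) gram_qform_blocks) simp
  finally show "0 < Re (?q v)" .
qed

lemma gram_pow_pos_def: "pos_def (idx ns k) (gram_pow \<psi>)"
proof (induction k)
  case 0
  show ?case by (auto simp: pos_def_def qform_def complex_neq_0 simp flip: power2_eq_square)
next
  case (Suc k)
  let ?K = "\<lambda>x y. gram \<psi> (fst x) (fst y) * gram_pow \<psi> (snd x) (snd y)"
  have pd: "pos_def (block_idx ns \<times> idx ns k) ?K"
    by (rule pos_def_product[OF finite_block_idx finite_idx gram_pos_def Suc])
  have eq: "qform (idx ns (Suc k)) (gram_pow \<psi>) v
      = qform (block_idx ns \<times> idx ns k) ?K (\<lambda>x. v (fst x # snd x))" for v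
    by (simp add: qform_def sum_idx_Suc sum.cartesian_product' gram_pow_Cons)
  show ?case
    unfolding pos_def_def
  proof (intro conjI ballI allI impI)
    fix p q assume "p \<in> idx ns (Suc k)" "q \<in> idx ns (Suc k)"
    then show "gram_pow \<psi> q p = cnj (gram_pow \<psi> p q)"
      by (elim idx_SucE)
         (simp add: gram_pow_Cons pos_def_hermitian[OF Suc] pos_def_hermitian[OF gram_pos_def])
  next
    fix v assume "\<exists>p\<in>idx ns (Suc k). v p \<noteq> (0::complex)"
    then obtain u p where "(u, p) \<in> block_idx ns \<times> idx ns k" "v (u # p) \<noteq> 0"
      by (auto elim!: idx_SucE)
    then show "0 < Re (qform (idx ns (Suc k)) (gram_pow \<psi>) v)"
      unfolding eq by (intro pos_def_qform_pos[OF pd, of "(u, p)"]) auto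
  qed
qed

end

section \<open>Correspondences on tensor powers\<close>

context multimatrix_state
begin

lemma star_psi_slice: "star (psi_slice ns \<psi> j z) = psi_slice ns \<psi> j (star z)"
proof (intro ext)
  fix s t
  have "star (psi_slice ns \<psi> j z) s t
      = (\<Sum>p\<in>idx ns j. \<Sum>q\<in>idx ns j. gram_pow \<psi> q p * cnj (z (p @ t) (q @ s)))"
    by (simp add: star_def psi_slice_def pos_def_hermitian[OF gram_pow_pos_def])
  also have "\<dots> = psi_slice ns \<psi> j (star z) s t"
    unfolding psi_slice_def star_def by (rule sum.swap)
  finally show "star (psi_slice ns \<psi> j z) s t = psi_slice ns \<psi> j (star z) s t" .
qed

text \<open>
  This identity gives both positivity and definiteness of the \<open>B\<close>-valued inner product
  \<open>\<langle>\<xi>, \<eta>\<rangle> = (\<psi> \<otimes> \<dots> \<otimes> \<psi> \<otimes> id)(\<xi>\<^sup>* \<eta>)\<close>.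
\<close>

lemma psi_slice_quadratic_form:
  "(\<Sum>u\<in>block_idx ns. \<Sum>w\<in>block_idx ns. cnj (v u) * psi_slice ns \<psi> j (mul ns (star x) x) [u] [w] * v w)
    = (\<Sum>r\<in>idx ns (j + 1). qform (idx ns j) (gram_pow \<psi>) (\<lambda>p. \<Sum>u\<in>block_idx ns. x r (p @ [u]) * v u))"
proof -
  let ?B = "block_idx ns" and ?J = "idx ns j" and ?R = "idx ns (j + 1)"
  let ?T = "\<lambda>p q r u w. cnj (x r (p @ [u]) * v u) * gram_pow \<psi> p q * (x r (q @ [w]) * v w)"
  have "(\<Sum>u\<in>?B. \<Sum>w\<in>?B. cnj (v u) * psi_slice ns \<psi> j (mul ns (star x) x) [u] [w] * v w)
      = (\<Sum>u\<in>?B. \<Sum>w\<in>?B. \<Sum>p\<in>?J. \<Sum>q\<in>?J. \<Sum>r\<in>?R. ?T p q r u w)"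
    by (intro sum.cong refl)
       (simp add: psi_slice_def mul_apply star_def idx_length sum_distrib_left sum_distrib_right mult_ac)
  also have "\<dots> = (\<Sum>(u, w)\<in>?B \<times> ?B. \<Sum>(p, q)\<in>?J \<times> ?J. \<Sum>r\<in>?R. ?T p q r u w)"
    by (simp add: sum.cartesian_product')
  also have "\<dots> = (\<Sum>(u, w)\<in>?B \<times> ?B. \<Sum>r\<in>?R. \<Sum>(p, q)\<in>?J \<times> ?J. ?T p q r u w)"
    unfolding case_prod_unfold by (intro sum.cong refl sum.swap)
  also have "\<dots> = (\<Sum>r\<in>?R. \<Sum>(u, w)\<in>?B \<times> ?B. \<Sum>(p, q)\<in>?J \<times> ?J. ?T p q r u w)"
    unfolding case_prod_unfold by (rule sum.swap)
  also have "\<dots> = (\<Sum>r\<in>?R. \<Sum>(p, q)\<in>?J \<times> ?J. \<Sum>(u, w)\<in>?B \<times> ?B. ?T p q r u w)"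
    unfolding case_prod_unfold by (intro sum.cong refl sum.swap)
  also have "\<dots> = (\<Sum>r\<in>?R. qform ?J (gram_pow \<psi>) (\<lambda>p. \<Sum>u\<in>?B. x r (p @ [u]) * v u))"
    unfolding qform_def sum.cartesian_product'
    by (intro sum.cong refl) (simp add: sum_distrib_left sum_distrib_right mult_ac)
  finally show ?thesis .
qed

lemma psi_slice_positive:
  assumes "x \<in> tpow ns (j + 1)"
  shows "positive_elt ns (psi_slice ns \<psi> j (mul ns (star x) x))"
  unfolding positive_elt_def Let_def psi_slice_quadratic_form
  using assms pos_def_qform_Reals[OF gram_pow_pos_def] pos_def_qform_nonneg[OF gram_pow_pos_def]
  by (auto intro!: tpow_psi_slice tpow_mul tpow_star sum_in_Reals sum_nonneg)

lemma psi_slice_definite: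
  assumes x: "x \<in> tpow ns (j + 1)" and 0: "psi_slice ns \<psi> j (mul ns (star x) x) = 0"
  shows "x = 0"
proof (rule tpow_eqI[OF x])
  show "0 \<in> tpow ns (j + 1)" by (simp add: tpow_def)
  fix r q assume r: "r \<in> idx ns (j + 1)" and "q \<in> idx ns (j + 1)"
  then obtain p u where q: "q = p @ [u]" "p \<in> idx ns j" "u \<in> block_idx ns"
    by (auto elim: idx_snocE)
  have "(\<Sum>w\<in>block_idx ns. x r (p @ [w]) * (if w = u then 1 else 0)) = x r (p @ [u])" for r p
    using q(3) by (simp add: finite_block_idx if_distrib cong: if_cong)
  then have "(\<Sum>r\<in>idx ns (j + 1). qform (idx ns j) (gram_pow \<psi>) (\<lambda>p. x r (p @ [u]))) = 0"
    using psi_slice_quadratic_form[of "\<lambda>w. if w = u then 1 else 0" j x] by (simp add: 0)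
  then have "(\<Sum>r\<in>idx ns (j + 1). Re (qform (idx ns j) (gram_pow \<psi>) (\<lambda>p. x r (p @ [u])))) = 0"
    by (metis Re_sum zero_complex.sel(1))
  then have "Re (qform (idx ns j) (gram_pow \<psi>) (\<lambda>p. x r (p @ [u]))) = 0"
    using r pos_def_qform_nonneg[OF gram_pow_pos_def] by (simp add: sum_nonneg_eq_0_iff finite_idx)
  then have "x r (p @ [u]) = 0"
    using pos_def_qform_pos[OF gram_pow_pos_def q(2), of "\<lambda>p. x r (p @ [u])"] by force
  then show "x r q = 0 r q" by (simp add: q)
qed

text \<open>
  A subspace of a tensor power is a correspondence if \<open>B\<close> acts on the right on the last leg, acts on the
  left by multiplication through a \<open>*\<close>-homomorphism \<open>\<pi>\<close>, and the inner product is the slice of \<open>\<xi>\<^sup>* \<eta>\<close>. The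
  record \<open>E\<close> only needs to agree with these formulas on the tensor power and on \<open>B\<close>.
\<close>

lemma cstar_correspondenceI:
  assumes space: "corr_space E \<subseteq> tpow ns (j + 1)" "module.subspace scale (corr_space E)"
    and closed: "\<And>b x. b \<in> tpow ns 1 \<Longrightarrow> x \<in> corr_space E \<Longrightarrow> lact E b x \<in> corr_space E"
      "\<And>b x. b \<in> tpow ns 1 \<Longrightarrow> x \<in> corr_space E \<Longrightarrow> ract E x b \<in> corr_space E"
    and pi: "\<And>b. b \<in> tpow ns 1 \<Longrightarrow> \<pi> b \<in> tpow ns (j + 1)"
      "\<And>b c. \<pi> (b + c) = \<pi> b + \<pi> c" "\<And>d b. \<pi> (scale d b) = scale d (\<pi> b)"
      "\<And>b c. b \<in> tpow ns 1 \<Longrightarrow> c \<in> tpow ns 1 \<Longrightarrow> \<pi> (mul ns b c) = mul ns (\<pi> b) (\<pi> c)"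
      "\<And>b. \<pi> (star b) = star (\<pi> b)"
    and lact: "\<And>b x. b \<in> tpow ns 1 \<Longrightarrow> x \<in> tpow ns (j + 1) \<Longrightarrow> lact E b x = mul ns (\<pi> b) x"
    and ract: "\<And>b x. b \<in> tpow ns 1 \<Longrightarrow> x \<in> tpow ns (j + 1) \<Longrightarrow>
       ract E x b = mul ns x (kron j (unit_el ns j) b)"
    and inner: "\<And>x y. x \<in> tpow ns (j + 1) \<Longrightarrow> y \<in> tpow ns (j + 1) \<Longrightarrow>
       inner_B E x y = psi_slice ns \<psi> j (mul ns (star x) y)"
  shows "cstar_correspondence ns E"
proof -
  let ?V = "tpow ns (j + 1)" and ?B = "tpow ns 1"
  let ?i = "\<lambda>x y. psi_slice ns \<psi> j (mul ns (star x) y)"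
  have K: "kron j (unit_el ns j) b \<in> ?V" if "b \<in> ?B" for b
    using that by (intro tpow_kron tpow_unit_el)
  have KK: "mul ns (kron j (unit_el ns j) b) (kron j (unit_el ns j) c) = kron j (unit_el ns j) (mul ns b c)" for b c
    by (simp add: mul_kron[OF tpow_unit_el tpow_unit_el] mul_unit_left[OF tpow_unit_el])
  have K1: "mul ns x (kron j (unit_el ns j) (unit_el ns 1)) = x" if "x \<in> ?V" for x
    using that by (simp add: unit_el_kron[symmetric] mul_unit_right)
  have sym: "?i y x = star (?i x y)" if "x \<in> ?V" "y \<in> ?V" for x y
    using that by (simp add: star_psi_slice star_mul[OF tpow_star] star_star)
  have adj: "?i (mul ns (\<pi> b) x) y = ?i x (mul ns (star (\<pi> b)) y)" if "x \<in> ?V" "y \<in> ?V" "b \<in> ?B" for x y b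
    using that by (simp add: star_mul[of _ _ "j + 1", simplified] mul_assoc pi(1)[simplified])
  note B = tpow_add[of _ ns 1] tpow_scale[of _ ns 1] tpow_star[of _ ns 1] tpow_mul[of _ ns 1]
  have V: "x + y \<in> ?V" if "x \<in> ?V" "y \<in> ?V" for x y
    using that by (rule tpow_add)
  have V': "scale d x \<in> ?V" if "x \<in> ?V" for x d
    using that by (rule tpow_scale)
  have V'': "mul ns (\<pi> b) x \<in> ?V" "mul ns x (kron j (unit_el ns j) b) \<in> ?V"
    if "x \<in> ?V" "b \<in> ?B" for x b
    using that by (blast intro: tpow_mul pi(1) K)+
  have V3: "mul ns (star (\<pi> b)) x \<in> ?V" if "x \<in> ?V" "b \<in> ?B" for x b
    using that by (blast intro: tpow_mul pi(1) tpow_star)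
  have z: "unit_el ns 1 \<in> ?B" by (rule tpow_unit_el)
  have in_B: "?i x y \<in> ?B" if "x \<in> ?V" "y \<in> ?V" for x y
    using that by (intro tpow_psi_slice tpow_mul tpow_star)
  have rB: "?i x (mul ns y (kron j (unit_el ns j) b)) = mul ns (?i x y) b" if "x \<in> ?V" "y \<in> ?V" "b \<in> ?B" for x y b
    using that unfolding mul_assoc[symmetric] by (intro psi_slice_mul_right tpow_mul tpow_star)
  note facts = B V V' V'' V3 z K KK K1 lact ract inner adj in_B rB pi subsetD[OF space(1)]
  note lin = mul_add_left mul_add_right mul_scale_left mul_scale_right kron_add_right kron_scale_right
     tensor_linear_add[OF psi_slice_linear] tensor_linear_scale[OF psi_slice_linear]
  show ?thesis
    unfolding cstar_correspondence_def
    apply (intro conjI ballI allI impI)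
    apply (rule exI[of _ "j + 1"], rule space(1))
    apply (rule space(2))
    apply (simp_all only: closed)
    apply (simp_all only: facts lin mul_assoc)
    apply (rule sym; simp only: facts)
    apply (rule psi_slice_positive; simp only: facts)
    apply (rule psi_slice_definite[of _ j]; simp only: facts)
    done
qed

lemma tpow_corr_ops:
  assumes b: "b \<in> tpow ns 1" and x: "x \<in> tpow ns (k + 1)"
  shows "lact (tpow_corr ns \<psi> k) b x = mul ns (kron 1 b (unit_el ns k)) x"
    and "ract (tpow_corr ns \<psi> k) x b = mul ns x (kron k (unit_el ns k) b)"
proof -
  have x': "x \<in> tpow ns (1 + k)" using x by (simp add: add.commute)
  show "lact (tpow_corr ns \<psi> k) b x = mul ns (kron 1 b (unit_el ns k)) x"
    unfolding tpow_corr_def correspondence.simps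
    using x' b by (intro lin_ext_linear tensor_linearI mul_add_right mul_scale_right)
       (simp_all add: mul_kron tpow_mat_unit mul_unit_left[OF tpow_mat_unit])
  show "ract (tpow_corr ns \<psi> k) x b = mul ns x (kron k (unit_el ns k) b)"
    unfolding tpow_corr_def correspondence.simps
    using x by (intro lin_ext_linear tensor_linearI mul_add_left mul_scale_left)
       (simp_all add: mul_kron tpow_mat_unit tpow_unit_el mul_unit_right[OF tpow_mat_unit])
qed

lemma tpow_corr_inner:
  assumes "x \<in> tpow ns (k + 1)" "y \<in> tpow ns (k + 1)"
  shows "inner_B (tpow_corr ns \<psi> k) x y = psi_slice ns \<psi> k (mul ns (star x) y)"
  unfolding tpow_corr_def correspondence.simps
  using assms by (intro lin_ext_linear psi_slice_linear tpow_mul tpow_star) (simp_all add: psi_slice_kron)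

lemma tpow_corr_sub_cstar:
  assumes S: "S \<subseteq> tpow ns (k + 1)" "module.subspace scale S"
    and closed: "\<And>b x. b \<in> tpow ns 1 \<Longrightarrow> x \<in> S \<Longrightarrow> mul ns (kron 1 b (unit_el ns k)) x \<in> S"
      "\<And>b x. b \<in> tpow ns 1 \<Longrightarrow> x \<in> S \<Longrightarrow> mul ns x (kron k (unit_el ns k) b) \<in> S"
  shows "cstar_correspondence ns ((tpow_corr ns \<psi> k)\<lparr>corr_space := S\<rparr>)"
proof -
  let ?E = "(tpow_corr ns \<psi> k)\<lparr>corr_space := S\<rparr>"
  have sel: "corr_space ?E = S" "lact ?E = lact (tpow_corr ns \<psi> k)" "ract ?E = ract (tpow_corr ns \<psi> k)"
    "inner_B ?E = inner_B (tpow_corr ns \<psi> k)"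
    by simp_all
  have pi: "kron 1 b (unit_el ns k) \<in> tpow ns (k + 1)" if "b \<in> tpow ns 1" for b
    using tpow_kron[OF that tpow_unit_el[of ns k]] by (simp add: add.commute)
  show ?thesis
    by (rule cstar_correspondenceI[where j = k and \<pi> = "\<lambda>b. kron 1 b (unit_el ns k)"])
      (simp_all only: sel S closed pi subsetD[OF S(1)] kron_add_left kron_scale_left mul_kron
        mul_unit_left[OF tpow_unit_el] star_kron star_unit_el tpow_corr_ops tpow_corr_inner)
qed

lemma tpow_corr_cstar: "cstar_correspondence ns (tpow_corr ns \<psi> k)"
proof -
  have "kron 1 b (unit_el ns k) \<in> tpow ns (k + 1)" if "b \<in> tpow ns 1" for b
    using tpow_kron[OF that tpow_unit_el[of ns k]] by (simp add: add.commute)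
  then have "cstar_correspondence ns ((tpow_corr ns \<psi> k)\<lparr>corr_space := tpow ns (k + 1)\<rparr>)"
    by (intro tpow_corr_sub_cstar subset_refl tpow_subspace tpow_mul tpow_kron tpow_unit_el)
  then show ?thesis by (simp add: tpow_corr_def)
qed

text \<open>The external tensor product of the Hilbert space \<open>L\<^sup>2(B, \<psi>)\<close> to the power \<open>j\<close> with \<open>B\<close>.\<close>

abbreviation standard_ext :: "nat \<Rightarrow> correspondence" where
  "standard_ext j \<equiv> ext_tensor ns \<psi> j 1 (standard_corr ns)"

lemma standard_ext_ops:
  assumes b: "b \<in> tpow ns 1" and x: "x \<in> tpow ns (j + 1)"
  shows "lact (standard_ext j) b x = mul ns (kron j (unit_el ns j) b) x"
    and "ract (standard_ext j) x b = mul ns x (kron j (unit_el ns j) b)"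
proof -
  show "lact (standard_ext j) b x = mul ns (kron j (unit_el ns j) b) x"
    unfolding ext_tensor_def standard_corr_def correspondence.simps amp_def
    using x b by (intro lin_ext_linear tensor_linearI mul_add_right mul_scale_right)
       (simp_all add: mul_kron tpow_mat_unit tpow_unit_el mul_unit_left[OF tpow_mat_unit])
  show "ract (standard_ext j) x b = mul ns x (kron j (unit_el ns j) b)"
    unfolding ext_tensor_def standard_corr_def correspondence.simps amp_def
    using x b by (intro lin_ext_linear tensor_linearI mul_add_left mul_scale_left)
       (simp_all add: mul_kron tpow_mat_unit tpow_unit_el mul_unit_right[OF tpow_mat_unit])
qed

text \<open>
  The sesquilinear extension that defines the inner product of the external tensor product is the slice of
  \<open>x\<^sup>* y\<close>; both sides are expanded in matrix units.
\<close>

lemma standard_ext_inner: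
  assumes x: "x \<in> tpow ns (j + 1)" and y: "y \<in> tpow ns (j + 1)"
  shows "inner_B (standard_ext j) x y = psi_slice ns \<psi> j (mul ns (star x) y)"
proof -
  interpret vector_space scale by (rule vector_space_scale)
  let ?E = "\<lambda>u v. kron j (mat_unit (fst u) (snd u)) (mat_unit (fst v) (snd v))"
  let ?c = "\<lambda>x u v. x (fst u @ fst v) (snd u @ snd v)"
  let ?U = "unit_idx ns j" and ?W = "unit_idx ns 1"
  have ex: "z = (\<Sum>u\<in>?U. \<Sum>v\<in>?W. scale (?c z u v) (?E u v))" if "z \<in> tpow ns (j + 1)" for z
    using tpow_expand_append[OF that] by (simp add: case_prod_unfold)
  have L1: "tensor_linear (\<lambda>z. psi_slice ns \<psi> j (mul ns w z))" for w
    by (rule tensor_linearI) (simp_all add: mul_add_right mul_scale_right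
      tensor_linear_add[OF psi_slice_linear] tensor_linear_scale[OF psi_slice_linear])
  have star_sum: "star (\<Sum>i\<in>I. f i) = (\<Sum>i\<in>I. star (f i))" for I :: "(index \<times> index) set" and f
    by (simp add: star_def fun_eq_iff sum_fun_apply2)
  have mul_sum: "mul ns (\<Sum>i\<in>I. f i) z = (\<Sum>i\<in>I. mul ns (f i) z)" for I :: "(index \<times> index) set" and f z
    using tensor_linear_sum[of "\<lambda>x. mul ns x z" f I] by (simp add: tensor_linearI mul_add_left mul_scale_left)
  have slice_sum: "psi_slice ns \<psi> j (\<Sum>i\<in>I. f i) = (\<Sum>i\<in>I. psi_slice ns \<psi> j (f i))"
    for I :: "(index \<times> index) set" and f
    by (rule tensor_linear_sum[OF psi_slice_linear])
  have unit: "psi_slice ns \<psi> j (mul ns (star (?E u v)) (?E u' v'))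
      = scale (l2_inner ns \<psi> j (mat_unit (fst u) (snd u)) (mat_unit (fst u') (snd u')))
          (mul ns (star (mat_unit (fst v) (snd v))) (mat_unit (fst v') (snd v')))"
    if "u \<in> ?U" "u' \<in> ?U" for u u' v v'
    using that by (simp add: star_kron mul_kron tpow_star tpow_mat_unit psi_slice_kron l2_inner_def)
  have "psi_slice ns \<psi> j (mul ns (star x) y)
      = (\<Sum>u\<in>?U. \<Sum>v\<in>?W. scale (cnj (?c x u v)) (psi_slice ns \<psi> j (mul ns (star (?E u v)) y)))"
    by (subst ex[OF x])
       (simp add: star_sum star_scale mul_sum mul_scale_left slice_sum tensor_linear_scale[OF psi_slice_linear])
  also have "\<dots> = (\<Sum>u\<in>?U. \<Sum>v\<in>?W. scale (cnj (?c x u v)) (\<Sum>u'\<in>?U. \<Sum>v'\<in>?W. scale (?c y u' v')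
       (psi_slice ns \<psi> j (mul ns (star (?E u v)) (?E u' v')))))"
    by (subst (1) ex[OF y]) (simp add: tensor_linear_sum[OF L1] tensor_linear_scale[OF L1])
  also have "\<dots> = (\<Sum>u\<in>?U. \<Sum>v\<in>?W. \<Sum>u'\<in>?U. \<Sum>v'\<in>?W. scale (cnj (?c x u v) * ?c y u' v' *
         l2_inner ns \<psi> j (mat_unit (fst u) (snd u)) (mat_unit (fst u') (snd u')))
          (mul ns (star (mat_unit (fst v) (snd v))) (mat_unit (fst v') (snd v'))))"
    by (intro sum.cong refl)
       (simp add: unit scale_sum_right mult.assoc)
  also have "\<dots> = inner_B (standard_ext j) x y"
    by (simp add: ext_tensor_def standard_corr_def case_prod_unfold)
  finally show ?thesis ..
qed

lemma standard_ext_sub_cstar: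
  assumes S: "S \<subseteq> tpow ns (j + 1)" "module.subspace scale S"
    and closed: "\<And>b x. b \<in> tpow ns 1 \<Longrightarrow> x \<in> S \<Longrightarrow> mul ns (kron j (unit_el ns j) b) x \<in> S"
      "\<And>b x. b \<in> tpow ns 1 \<Longrightarrow> x \<in> S \<Longrightarrow> mul ns x (kron j (unit_el ns j) b) \<in> S"
  shows "cstar_correspondence ns ((standard_ext j)\<lparr>corr_space := S\<rparr>)"
proof -
  let ?E = "(standard_ext j)\<lparr>corr_space := S\<rparr>"
  have sel: "corr_space ?E = S" "lact ?E = lact (standard_ext j)" "ract ?E = ract (standard_ext j)"
    "inner_B ?E = inner_B (standard_ext j)"
    by simp_all
  show ?thesis
    by (rule cstar_correspondenceI[where j = j and \<pi> = "kron j (unit_el ns j)"])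
      (simp_all only: sel S closed tpow_kron tpow_unit_el subsetD[OF S(1)] kron_add_right kron_scale_right
        mul_kron mul_unit_left[OF tpow_unit_el] star_kron star_unit_el standard_ext_ops standard_ext_inner)
qed

lemma standard_ext_cstar: "cstar_correspondence ns (standard_ext j)"
proof -
  have "cstar_correspondence ns ((standard_ext j)\<lparr>corr_space := tpow ns (j + 1)\<rparr>)"
    by (intro standard_ext_sub_cstar subset_refl tpow_subspace tpow_mul tpow_kron tpow_unit_el)
  then show ?thesis by (simp add: ext_tensor_def)
qed

end

section \<open>The inverse density and the adjoints of multiplication and of its twisted flip\<close>

lemma l2_inner_diff_right: "l2_inner ns \<psi> k x (y - z) = l2_inner ns \<psi> k x y - l2_inner ns \<psi> k x z"
  and l2_inner_scale_left: "l2_inner ns \<psi> k (scale c x) y = cnj c * l2_inner ns \<psi> k x y"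
  by (simp_all add: l2_inner_eq right_diff_distrib sum_subtractf scale_def sum_distrib_left mult_ac)

lemma l2_inner_sum_left: "l2_inner ns \<psi> k (\<Sum>i\<in>I. f i) y = (\<Sum>i\<in>I. l2_inner ns \<psi> k (f i) y)"
proof (induction I rule: infinite_finite_induct)
  case (insert i I)
  have "l2_inner ns \<psi> k (f i + sum f I) y = l2_inner ns \<psi> k (f i) y + l2_inner ns \<psi> k (sum f I) y"
    by (simp add: l2_inner_eq distrib_left distrib_right sum.distrib)
  then show ?case using insert by (simp only: sum.insert not_False_eq_True)
qed (simp_all add: l2_inner_eq)

lemma l2_inner_mat_unit:
  assumes "r \<in> idx ns k" "p \<in> idx ns k"
  shows "l2_inner ns \<psi> k (mat_unit r p) y = (\<Sum>q\<in>idx ns k. gram_pow \<psi> p q * y r q)"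
proof -
  have "l2_inner ns \<psi> k (mat_unit r p) y
      = (\<Sum>p'\<in>idx ns k. \<Sum>q\<in>idx ns k. \<Sum>r'\<in>idx ns k.
          if r' = r then if p' = p then gram_pow \<psi> p q * y r q else 0 else 0)"
    unfolding l2_inner_eq by (intro sum.cong refl) (simp add: mat_unit_def)
  also have "\<dots> = (\<Sum>p'\<in>idx ns k. if p' = p then \<Sum>q\<in>idx ns k. gram_pow \<psi> p q * y r q else 0)"
    using assms(1) by (intro sum.cong refl) (simp add: finite_idx)
  also have "\<dots> = (\<Sum>q\<in>idx ns k. gram_pow \<psi> p q * y r q)"
    using assms(2) by (simp add: finite_idx)
  finally show ?thesis .
qed

context multimatrix_state
begin

lemma l2_inner_definite:
  assumes x: "x \<in> tpow ns k" and 0: "l2_inner ns \<psi> k x x = 0"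
  shows "x = 0"
proof (rule tpow_eqI[OF x])
  show "0 \<in> tpow ns k" by (simp add: tpow_def)
  fix r p assume r: "r \<in> idx ns k" and p: "p \<in> idx ns k"
  have "l2_inner ns \<psi> k x x
      = (\<Sum>p\<in>idx ns k. \<Sum>r\<in>idx ns k. \<Sum>q\<in>idx ns k. cnj (x r p) * gram_pow \<psi> p q * x r q)"
    unfolding l2_inner_eq by (intro sum.cong refl sum.swap)
  also have "\<dots> = (\<Sum>r\<in>idx ns k. qform (idx ns k) (gram_pow \<psi>) (x r))"
    unfolding qform_def by (rule sum.swap)
  finally have "(\<Sum>r\<in>idx ns k. Re (qform (idx ns k) (gram_pow \<psi>) (x r))) = 0"
    using 0 by (metis Re_sum zero_complex.sel(1))
  then have "Re (qform (idx ns k) (gram_pow \<psi>) (x r)) = 0"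
    using r pos_def_qform_nonneg[OF gram_pow_pos_def] by (simp add: sum_nonneg_eq_0_iff finite_idx)
  then show "x r p = 0 r p"
    using pos_def_qform_pos[OF gram_pow_pos_def p, of "x r"] by force
qed

text \<open>
  A candidate for the adjoint is compared with the map on matrix units; uniqueness is definiteness of the
  inner product.
\<close>

lemma hilbert_adjoint_eqI:
  assumes F: "tensor_linear F" and X: "X \<in> tpow ns 2"
    and adj: "\<And>a b c d. a \<in> block_idx ns \<Longrightarrow> b \<in> block_idx ns \<Longrightarrow> fst a = fst b \<Longrightarrow>
       c \<in> block_idx ns \<Longrightarrow> d \<in> block_idx ns \<Longrightarrow> fst c = fst d \<Longrightarrow>
       l2_inner ns \<psi> 2 (mat_unit [a, c] [b, d]) X = l2_inner ns \<psi> 1 (F (mat_unit [a, c] [b, d])) y"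
  shows "hilbert_adjoint ns \<psi> 2 1 F y = X"
  unfolding hilbert_adjoint_def
proof (rule the_equality)
  have "l2_inner ns \<psi> 2 v X = l2_inner ns \<psi> 1 (F v) y" if v: "v \<in> tpow ns 2" for v
  proof -
    have e: "v = (\<Sum>(p, q)\<in>unit_idx ns 2. scale (v p q) (mat_unit p q))"
      by (rule tpow_expand[OF v])
    have "l2_inner ns \<psi> 2 (mat_unit p q) X = l2_inner ns \<psi> 1 (F (mat_unit p q)) y"
      if "(p, q) \<in> unit_idx ns 2" for p q
      using that adj by (auto simp: unit_idx_iff elim!: idx_2E)
    then show ?thesis
      by (subst (1 2) e) (auto simp: tensor_linear_sum[OF F] tensor_linear_scale[OF F]
          l2_inner_sum_left l2_inner_scale_left case_prod_unfold intro!: sum.cong)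
  qed
  then show *: "X \<in> tpow ns 2 \<and> (\<forall>v\<in>tpow ns 2. l2_inner ns \<psi> 2 v X = l2_inner ns \<psi> 1 (F v) y)"
    using X by blast
  fix X' assume X': "X' \<in> tpow ns 2 \<and> (\<forall>v\<in>tpow ns 2. l2_inner ns \<psi> 2 v X' = l2_inner ns \<psi> 1 (F v) y)"
  then have "l2_inner ns \<psi> 2 (X' - X) (X' - X) = 0"
    using * by (simp add: l2_inner_diff_right tpow_diff)
  then have "X' - X = 0"
    using X' X by (intro l2_inner_definite[of _ 2] tpow_diff) auto
  then show "X' = X" by simp
qed

text \<open>
  The inverse of the density, that is of the transposed Gram matrix. It is chosen with support in the
  blocks, so that it vanishes between different blocks and whenever an index is out of range.
\<close>

definition gram_inv :: "nat \<times> nat \<Rightarrow> nat \<times> nat \<Rightarrow> complex" where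
  "gram_inv = (SOME N. (\<forall>u w. N u w \<noteq> 0 \<longrightarrow> u \<in> block_idx ns \<and> w \<in> block_idx ns \<and> fst u = fst w) \<and>
     (\<forall>u\<in>block_idx ns. \<forall>v\<in>block_idx ns.
        (\<Sum>w\<in>block_idx ns. gram \<psi> w u * N w v) = (if u = v then 1 else 0)))"

lemma gram_inv_exists:
  "\<exists>N. (\<forall>u w. N u w \<noteq> 0 \<longrightarrow> u \<in> block_idx ns \<and> w \<in> block_idx ns \<and> fst u = fst w) \<and>
     (\<forall>u\<in>block_idx ns. \<forall>v\<in>block_idx ns.
        (\<Sum>w\<in>block_idx ns. gram \<psi> w u * N w v) = (if u = v then 1 else 0))"
proof -
  have "\<forall>v. \<exists>x. \<forall>u\<in>block_idx ns. (\<Sum>w\<in>block_idx ns. gram \<psi> w u * x w) = (if u = v then 1 else 0)"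
    by (intro allI pos_def_solvable[OF finite_block_idx pos_def_transpose[OF gram_pos_def]])
  then obtain X where X: "\<And>v u. u \<in> block_idx ns \<Longrightarrow>
      (\<Sum>w\<in>block_idx ns. gram \<psi> w u * X v w) = (if u = v then 1 else 0)"
    by metis
  \<comment> \<open>cutting a right inverse of a block diagonal matrix down to the blocks leaves a right inverse\<close>
  define N where "N w v = (if w \<in> block_idx ns \<and> v \<in> block_idx ns \<and> fst w = fst v then X v w else 0)" for w v
  have "(\<Sum>w\<in>block_idx ns. gram \<psi> w u * N w v) = (if u = v then 1 else 0)"
    if "u \<in> block_idx ns" "v \<in> block_idx ns" for u v
  proof (cases "fst u = fst v")
    case True
    have "(\<Sum>w\<in>block_idx ns. gram \<psi> w u * N w v) = (\<Sum>w\<in>block_idx ns. gram \<psi> w u * X v w)"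
      using True that by (intro sum.cong refl) (auto simp: N_def gram_def)
    then show ?thesis using X that by simp
  next
    case False
    then show ?thesis by (auto simp: N_def gram_def intro!: sum.neutral)
  qed
  moreover have "\<forall>u w. N u w \<noteq> 0 \<longrightarrow> u \<in> block_idx ns \<and> w \<in> block_idx ns \<and> fst u = fst w"
    by (simp add: N_def)
  ultimately show ?thesis by blast
qed

lemma gram_inv_nonzero:
    "gram_inv u w \<noteq> 0 \<Longrightarrow> u \<in> block_idx ns \<and> w \<in> block_idx ns \<and> fst u = fst w"
  and gram_gram_inv: "u \<in> block_idx ns \<Longrightarrow> v \<in> block_idx ns \<Longrightarrow>
    (\<Sum>w\<in>block_idx ns. gram \<psi> w u * gram_inv w v) = (if u = v then 1 else 0)"
  using someI_ex[OF gram_inv_exists] unfolding gram_inv_def[symmetric] by blast+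

lemma gram_cnj: "u \<in> block_idx ns \<Longrightarrow> w \<in> block_idx ns \<Longrightarrow> cnj (gram \<psi> u w) = gram \<psi> w u"
  by (rule pos_def_hermitian[OF gram_pos_def])

lemma gram_inv_cnj: "cnj (gram_inv v u) = gram_inv u v"
proof (cases "u \<in> block_idx ns \<and> v \<in> block_idx ns")
  case True
  let ?B = "block_idx ns"
  have left: "(\<Sum>w\<in>?B. cnj (gram_inv w u) * gram \<psi> x w) = (if x = u then 1 else 0)" if "x \<in> ?B" for x
  proof -
    have "(\<Sum>w\<in>?B. cnj (gram_inv w u) * gram \<psi> x w) = cnj (\<Sum>w\<in>?B. gram \<psi> w x * gram_inv w u)"
      unfolding cnj_sum using that by (intro sum.cong refl) (simp add: gram_cnj)
    then show ?thesis using gram_gram_inv[of x u] that True by simp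
  qed
  have "cnj (gram_inv v u) = (\<Sum>w\<in>?B. if w = v then cnj (gram_inv w u) else 0)"
    using True by (simp add: finite_block_idx)
  also have "\<dots> = (\<Sum>w\<in>?B. \<Sum>x\<in>?B. cnj (gram_inv w u) * gram \<psi> x w * gram_inv x v)"
    using True by (intro sum.cong refl) (simp add: mult.assoc sum_distrib_left[symmetric] gram_gram_inv)
  also have "\<dots> = (\<Sum>x\<in>?B. \<Sum>w\<in>?B. cnj (gram_inv w u) * gram \<psi> x w * gram_inv x v)"
    by (rule sum.swap)
  also have "\<dots> = (\<Sum>x\<in>?B. if x = u then gram_inv x v else 0)"
    by (intro sum.cong refl) (simp add: sum_distrib_right[symmetric] left)
  also have "\<dots> = gram_inv u v" using True by (simp add: finite_block_idx)
  finally show ?thesis .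
next
  case False
  then show ?thesis using gram_inv_nonzero[of u v] gram_inv_nonzero[of v u]
    by (metis complex_cnj_zero)
qed

lemma gram_inv_gram:
  assumes "u \<in> block_idx ns" "v \<in> block_idx ns"
  shows "(\<Sum>w\<in>block_idx ns. gram_inv u w * gram \<psi> v w) = (if u = v then 1 else 0)"
proof -
  have "(\<Sum>w\<in>block_idx ns. gram_inv u w * gram \<psi> v w)
      = cnj (\<Sum>w\<in>block_idx ns. gram \<psi> w v * gram_inv w u)"
    unfolding cnj_sum using assms by (intro sum.cong refl) (simp add: gram_cnj gram_inv_cnj)
  then show ?thesis using gram_gram_inv[of v u] assms by simp
qed

text \<open>The element of \<open>B\<close> with the entries of \<open>f\<close> inside the blocks.\<close>

definition mat1 :: "(nat \<times> nat \<Rightarrow> nat \<times> nat \<Rightarrow> complex) \<Rightarrow> tensor" where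
  "mat1 f = truncate ns 1 (\<lambda>p q. f (hd p) (hd q))"

lemma tpow_mat1: "mat1 f \<in> tpow ns 1"
  unfolding mat1_def by (rule tpow_truncate)

lemma mul_apply_1:
  "mul ns x y [u] [w] = (\<Sum>r\<in>block_idx ns. x [u] [r] * y [r] [w])"
  by (simp add: mul_apply sum_idx_1[unfolded One_nat_def])

lemma mat1_gram_inv_apply: 
  assumes "u \<in> block_idx ns" "w \<in> block_idx ns"
  shows "mat1 gram_inv [u] [w] = gram_inv u w"
  using assms gram_inv_nonzero[of u w]
  by (auto simp: mat1_def truncate_def unit_idx_iff idx_def)

lemma mat1_gram_apply: 
  assumes "u \<in> block_idx ns" "w \<in> block_idx ns"
  shows "mat1 (\<lambda>u w. gram \<psi> w u) [u] [w] = gram \<psi> w u"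
  using assms by (auto simp: mat1_def truncate_def unit_idx_iff gram_def idx_def)

lemma psi_density_eq: "psi_density ns \<psi> = mat1 (\<lambda>u w. gram \<psi> w u)"
  unfolding psi_density_def
proof (rule the_equality)
  have "\<psi> b = mat_trace ns (mul ns (mat1 (\<lambda>u w. gram \<psi> w u)) b)" if "b \<in> tpow ns 1" for b
    unfolding psi_expand[OF that] mat_trace_def mul_apply_1
    by (subst sum.swap) (simp add: mat1_gram_apply mult.commute)
  then show "mat1 (\<lambda>u w. gram \<psi> w u) \<in> tpow ns 1 \<and>
      (\<forall>b\<in>tpow ns 1. \<psi> b = mat_trace ns (mul ns (mat1 (\<lambda>u w. gram \<psi> w u)) b))"
    by (simp add: tpow_mat1[simplified])
  fix Q assume Q: "Q \<in> tpow ns 1 \<and> (\<forall>b\<in>tpow ns 1. \<psi> b = mat_trace ns (mul ns Q b))"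
  show "Q = mat1 (\<lambda>u w. gram \<psi> w u)"
  proof (rule tpow_eqI[OF _ tpow_mat1])
    show "Q \<in> tpow ns 1" using Q by blast
    fix p q assume "p \<in> idx ns 1" "q \<in> idx ns 1" and fst: "map fst p = map fst q"
    then obtain u w where uw: "p = [u]" "q = [w]" "u \<in> block_idx ns" "w \<in> block_idx ns"
      by (metis idx_1E)
    have "mat_unit [w] [u] \<in> tpow ns 1"
      using uw fst by (intro tpow_mat_unit) (simp add: unit_idx_def)
    then have "\<psi> (mat_unit [w] [u]) = mat_trace ns (mul ns Q (mat_unit [w] [u]))"
      using Q by blast
    also have "\<dots> = (\<Sum>v\<in>block_idx ns. if v = u then \<Sum>r\<in>block_idx ns. if r = w then Q [v] [r] else 0 else 0)"
      unfolding mat_trace_def mul_apply_1 by (intro sum.cong refl) (auto simp: mat_unit_def intro!: sum.cong)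
    also have "\<dots> = Q [u] [w]" using uw by (simp add: finite_block_idx)
    finally show "Q p q = mat1 (\<lambda>u w. gram \<psi> w u) p q"
      using uw fst by (simp add: mat1_gram_apply) (simp add: gram_def)
  qed
qed

lemma alg_inverse_density: "alg_inverse ns (psi_density ns \<psi>) = mat1 gram_inv"
  unfolding alg_inverse_def psi_density_eq
proof (rule the_equality)
  let ?Q = "mat1 (\<lambda>u w. gram \<psi> w u)"
  have QN: "mul ns ?Q (mat1 gram_inv) = unit_el ns 1"
  proof (rule tpow_eqI[OF tpow_mul[OF tpow_mat1 tpow_mat1] tpow_unit_el])
    fix p q assume "p \<in> idx ns 1" "q \<in> idx ns 1"
    then obtain u w where uw: "p = [u]" "q = [w]" "u \<in> block_idx ns" "w \<in> block_idx ns"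
      by (metis idx_1E)
    then show "mul ns ?Q (mat1 gram_inv) p q = unit_el ns 1 p q"
      by (simp add: mul_apply_1 mat1_gram_apply mat1_gram_inv_apply gram_gram_inv unit_el_apply idx_def)
  qed
  have NQ: "mul ns (mat1 gram_inv) ?Q = unit_el ns 1"
  proof (rule tpow_eqI[OF tpow_mul[OF tpow_mat1 tpow_mat1] tpow_unit_el])
    fix p q assume "p \<in> idx ns 1" "q \<in> idx ns 1"
    then obtain u w where uw: "p = [u]" "q = [w]" "u \<in> block_idx ns" "w \<in> block_idx ns"
      by (metis idx_1E)
    then show "mul ns (mat1 gram_inv) ?Q p q = unit_el ns 1 p q"
      by (simp add: mul_apply_1 mat1_gram_apply mat1_gram_inv_apply gram_inv_gram unit_el_apply idx_def)
  qed
  show "mat1 gram_inv \<in> tpow ns 1 \<and> mul ns ?Q (mat1 gram_inv) = unit_el ns 1 \<and>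
      mul ns (mat1 gram_inv) ?Q = unit_el ns 1"
    using QN NQ tpow_mat1 by blast
  fix y assume y: "y \<in> tpow ns 1 \<and> mul ns ?Q y = unit_el ns 1 \<and> mul ns y ?Q = unit_el ns 1"
  then have "y = mul ns y (mul ns ?Q (mat1 gram_inv))" by (metis QN mul_unit_right)
  also have "\<dots> = mat1 gram_inv"
    using y by (metis mul_assoc mul_unit_left tpow_mat1)
  finally show "y = mat1 gram_inv" .
qed

text \<open>The entries of \<open>Q e\<^sub>a\<^sub>b Q\<^sup>-\<^sup>1\<close>.\<close>

lemma modular_mat_unit:
  assumes "a \<in> block_idx ns" "b \<in> block_idx ns" "u \<in> block_idx ns" "w \<in> block_idx ns"
  shows "modular ns \<psi> (mat_unit [a] [b]) [u] [w] = gram \<psi> a u * gram_inv b w"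
proof -
  have "modular ns \<psi> (mat_unit [a] [b]) [u] [w]
      = (\<Sum>r\<in>block_idx ns. (\<Sum>s\<in>block_idx ns. if s = a then if r = b then gram \<psi> a u else 0 else 0) * gram_inv r w)"
    unfolding modular_def alg_inverse_density unfolding psi_density_eq mul_apply_1 using assms
    by (intro sum.cong refl) (auto simp: mat1_gram_apply mat1_gram_inv_apply mat_unit_def intro!: sum.cong)
  also have "\<dots> = (\<Sum>r\<in>block_idx ns. if r = b then gram \<psi> a u * gram_inv b w else 0)"
    using assms by (intro sum.cong refl) (simp add: finite_block_idx)
  also have "\<dots> = gram \<psi> a u * gram_inv b w"
    using assms by (simp add: finite_block_idx)
  finally show ?thesis .
qed

lemma tpow_modular: "x \<in> tpow ns 1 \<Longrightarrow> modular ns \<psi> x \<in> tpow ns 1"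
  unfolding modular_def alg_inverse_density unfolding psi_density_eq by (intro tpow_mul tpow_mat1)

lemma T_map_kron:
  assumes "x \<in> tpow ns 1" "y \<in> tpow ns 1"
  shows "T_map ns \<psi> (kron 1 x y) = mul ns y (modular ns \<psi> x)"
proof -
  have "lin_ext ns 1 1 (\<lambda>x y. kron 1 (modular ns \<psi> x) y) (kron 1 x y) = kron 1 (modular ns \<psi> x) y"
    using assms by (intro lin_ext_kron)
      (simp_all add: modular_def mul_add_left mul_add_right mul_scale_left mul_scale_right
        kron_add_left kron_add_right kron_scale_left kron_scale_right)
  moreover have "tensor_flip ns (kron 1 (modular ns \<psi> x) y) = kron 1 y (modular ns \<psi> x)"
    unfolding tensor_flip_def using assms by (intro lin_ext_kron)
      (simp_all add: tpow_modular[simplified] kron_add_left kron_add_right kron_scale_left kron_scale_right)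
  moreover have "mult_map ns (kron 1 y (modular ns \<psi> x)) = mul ns y (modular ns \<psi> x)"
    unfolding mult_map_def using assms by (intro lin_ext_kron)
      (simp_all add: tpow_modular[simplified] mul_add_left mul_add_right mul_scale_left mul_scale_right)
  ultimately show ?thesis by (simp add: T_map_def)
qed

lemma T_map_linear: "tensor_linear (T_map ns \<psi>)"
  unfolding T_map_def mult_map_def tensor_flip_def
  by (intro tensor_linearI)
     (simp_all add: tensor_linear_add[OF lin_ext_tensor_linear] tensor_linear_scale[OF lin_ext_tensor_linear])

lemma mult_map_linear: "tensor_linear (mult_map ns)"
  unfolding mult_map_def by (rule lin_ext_tensor_linear)

lemma l2_inner_2_mat_unit:
  assumes "a \<in> block_idx ns" "b \<in> block_idx ns" "c \<in> block_idx ns" "d \<in> block_idx ns"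
  shows "l2_inner ns \<psi> 2 (mat_unit [a, c] [b, d]) X =
    (\<Sum>q\<in>block_idx ns. \<Sum>q'\<in>block_idx ns. gram \<psi> b q * gram \<psi> d q' * X [a, c] [q, q'])"
  using assms by (simp add: l2_inner_mat_unit pair_in_idx sum_idx_2 gram_pow_Cons)

lemma l2_inner_1:
  "l2_inner ns \<psi> 1 x y = (\<Sum>p\<in>block_idx ns. \<Sum>q\<in>block_idx ns. \<Sum>r\<in>block_idx ns.
     cnj (x [r] [p]) * gram \<psi> p q * y [r] [q])"
  unfolding l2_inner_eq sum_idx_1 by (simp add: gram_pow_Cons)

text \<open>This is \<open>m\<^sup>*(y) = \<Sum> y e\<^sub>i\<^sub>j \<otimes> Q\<^sup>-\<^sup>1 e\<^sub>j\<^sub>i\<close>, summed over the matrix units of all blocks.\<close>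

lemma mult_adj_eq:
  assumes y: "y \<in> tpow ns 1"
  shows "mult_adj ns \<psi> y = truncate ns 2 (\<lambda>p q. y [p ! 0] [q ! 1] * gram_inv (p ! 1) (q ! 0))"
  unfolding mult_adj_def
proof (rule hilbert_adjoint_eqI[OF mult_map_linear tpow_truncate])
  fix a b c d
  assume B: "a \<in> block_idx ns" "b \<in> block_idx ns" "c \<in> block_idx ns" "d \<in> block_idx ns"
    and ab: "fst a = fst b" and cd: "fst c = fst d"
  let ?B = "block_idx ns"
  let ?X = "truncate ns 2 (\<lambda>p q. y [p ! 0] [q ! 1] * gram_inv (p ! 1) (q ! 0))"
  have "l2_inner ns \<psi> 2 (mat_unit [a, c] [b, d]) ?X
     = (\<Sum>q\<in>?B. \<Sum>q'\<in>?B. (gram_inv c q * gram \<psi> b q) * (gram \<psi> d q' * y [a] [q']))"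
    unfolding l2_inner_2_mat_unit[OF B(1,2,3,4)]
    using ab cd B by (intro sum.cong refl) (auto simp: truncate_def unit_idx_iff pair_in_idx gram_def)
  also have "\<dots> = (if c = b then \<Sum>q'\<in>?B. gram \<psi> d q' * y [a] [q'] else 0)"
    unfolding sum_product[symmetric] using gram_inv_gram[OF B(3,2)] by simp
  also have "\<dots> = l2_inner ns \<psi> 1 (mult_map ns (mat_unit [a, c] [b, d])) y"
  proof -
    have m: "mult_map ns (mat_unit [a, c] [b, d]) = mul ns (mat_unit [a] [b]) (mat_unit [c] [d])"
      unfolding mult_map_def mat_unit_kron2[symmetric] using ab cd B
      by (intro lin_ext_kron)
         (simp_all add: mul_add_left mul_add_right mul_scale_left mul_scale_right
            tpow_mat_unit unit_idx_def)
    have m': "mul ns (mat_unit [a] [b]) (mat_unit [c] [d]) [r] [p] = (if r = a \<and> p = d \<and> c = b then 1 else 0)" for r p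
    proof -
      have "mul ns (mat_unit [a] [b]) (mat_unit [c] [d]) [r] [p]
          = (\<Sum>s\<in>?B. if s = b then (if r = a \<and> p = d \<and> c = b then 1 else 0) else 0)"
        unfolding mul_apply_1 by (intro sum.cong) (auto simp: mat_unit_def)
      then show ?thesis using B by (simp add: finite_block_idx)
    qed
    have "l2_inner ns \<psi> 1 (mult_map ns (mat_unit [a, c] [b, d])) y
       = (\<Sum>p\<in>?B. \<Sum>q\<in>?B. \<Sum>r\<in>?B. if r = a then if p = d then if c = b then gram \<psi> d q * y [a] [q] else 0 else 0 else 0)"
      unfolding l2_inner_1 m m' by (intro sum.cong refl) auto
    also have "\<dots> = (\<Sum>p\<in>?B. if p = d then \<Sum>q\<in>?B. if c = b then gram \<psi> d q * y [a] [q] else 0 else 0)"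
      using B by (intro sum.cong refl) (simp add: finite_block_idx)
    also have "\<dots> = (if c = b then \<Sum>q'\<in>?B. gram \<psi> d q' * y [a] [q'] else 0)"
      using B by (simp add: finite_block_idx)
    finally show ?thesis ..
  qed
  finally show "l2_inner ns \<psi> 2 (mat_unit [a, c] [b, d]) ?X
      = l2_inner ns \<psi> 1 (mult_map ns (mat_unit [a, c] [b, d])) y" .
qed

text \<open>This is \<open>T\<^sup>*(y) = \<Sum> e\<^sub>i\<^sub>j \<otimes> y Q\<^sup>-\<^sup>1 e\<^sub>j\<^sub>i\<close>, summed over the matrix units of all blocks.\<close>

lemma T_adj_eq:
  assumes y: "y \<in> tpow ns 1"
  shows "T_adj ns \<psi> y = truncate ns 2 (\<lambda>p q.
    if p ! 0 = q ! 1 then \<Sum>w\<in>block_idx ns. y [p ! 1] [w] * gram_inv w (q ! 0) else 0)"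
  unfolding T_adj_def
proof (rule hilbert_adjoint_eqI[OF T_map_linear tpow_truncate])
  fix a b c d
  assume B: "a \<in> block_idx ns" "b \<in> block_idx ns" "c \<in> block_idx ns" "d \<in> block_idx ns"
    and ab: "fst a = fst b" and cd: "fst c = fst d"
  let ?B = "block_idx ns"
  let ?X = "truncate ns 2 (\<lambda>p q.
    if p ! 0 = q ! 1 then \<Sum>w\<in>?B. y [p ! 1] [w] * gram_inv w (q ! 0) else 0)"
  have "l2_inner ns \<psi> 2 (mat_unit [a, c] [b, d]) ?X
     = (\<Sum>q\<in>?B. \<Sum>q'\<in>?B. if q' = a then gram \<psi> d a * (\<Sum>w\<in>?B. y [c] [w] * (gram_inv w q * gram \<psi> b q)) else 0)"
    unfolding l2_inner_2_mat_unit[OF B(1,2,3,4)]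
    using ab cd B
    by (intro sum.cong refl)
       (auto simp: truncate_def unit_idx_iff pair_in_idx gram_def sum_distrib_left mult_ac)
  also have "\<dots> = gram \<psi> d a * (\<Sum>q\<in>?B. \<Sum>w\<in>?B. y [c] [w] * (gram_inv w q * gram \<psi> b q))"
    using B by (simp add: finite_block_idx sum_distrib_left)
  also have "\<dots> = gram \<psi> d a * (\<Sum>w\<in>?B. y [c] [w] * (\<Sum>q\<in>?B. gram_inv w q * gram \<psi> b q))"
    by (subst sum.swap) (simp add: sum_distrib_left)
  also have "\<dots> = gram \<psi> d a * (\<Sum>w\<in>?B. if w = b then y [c] [b] else 0)"
    using B by (intro arg_cong[of _ _ "\<lambda>x. gram \<psi> d a * x"] sum.cong refl) (simp add: gram_inv_gram)
  also have "\<dots> = gram \<psi> d a * y [c] [b]"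
    using B by (simp add: finite_block_idx)
  also have "\<dots> = l2_inner ns \<psi> 1 (T_map ns \<psi> (mat_unit [a, c] [b, d])) y"
  proof -
    have m: "T_map ns \<psi> (mat_unit [a, c] [b, d]) = mul ns (mat_unit [c] [d]) (modular ns \<psi> (mat_unit [a] [b]))"
      unfolding mat_unit_kron2[symmetric] using ab cd B
      by (intro T_map_kron) (simp_all add: tpow_mat_unit unit_idx_def)
    have m': "mul ns (mat_unit [c] [d]) (modular ns \<psi> (mat_unit [a] [b])) [r] [p]
        = (if r = c then gram \<psi> a d * gram_inv b p else 0)" if "p \<in> ?B" for r p
    proof -
      have "mul ns (mat_unit [c] [d]) (modular ns \<psi> (mat_unit [a] [b])) [r] [p]
          = (\<Sum>s\<in>?B. if s = d then (if r = c then modular ns \<psi> (mat_unit [a] [b]) [d] [p] else 0) else 0)"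
        unfolding mul_apply_1 by (intro sum.cong) (auto simp: mat_unit_def)
      then show ?thesis using B that by (simp add: finite_block_idx modular_mat_unit)
    qed
    have "l2_inner ns \<psi> 1 (T_map ns \<psi> (mat_unit [a, c] [b, d])) y
       = (\<Sum>p\<in>?B. \<Sum>q\<in>?B. \<Sum>r\<in>?B. if r = c then gram \<psi> d a * (y [c] [q] * (gram \<psi> p q * gram_inv p b)) else 0)"
      unfolding l2_inner_1 m using B by (intro sum.cong refl) (auto simp: m' gram_cnj gram_inv_cnj)
    also have "\<dots> = (\<Sum>p\<in>?B. \<Sum>q\<in>?B. gram \<psi> d a * (y [c] [q] * (gram \<psi> p q * gram_inv p b)))"
      using B by (simp add: finite_block_idx)
    also have "\<dots> = (\<Sum>q\<in>?B. gram \<psi> d a * (y [c] [q] * (\<Sum>p\<in>?B. gram \<psi> p q * gram_inv p b)))"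
      by (subst sum.swap) (simp add: sum_distrib_left)
    also have "\<dots> = (\<Sum>q\<in>?B. if q = b then gram \<psi> d a * y [c] [b] else 0)"
      using B by (intro sum.cong refl) (simp add: gram_gram_inv)
    also have "\<dots> = gram \<psi> d a * y [c] [b]"
      using B by (simp add: finite_block_idx)
    finally show ?thesis ..
  qed
  finally show "l2_inner ns \<psi> 2 (mat_unit [a, c] [b, d]) ?X
      = l2_inner ns \<psi> 1 (T_map ns \<psi> (mat_unit [a, c] [b, d])) y" .
qed

end

section \<open>Loop tensors and path indicators\<close>

text \<open>The Kronecker power of a matrix \<open>N\<close> of scalars.\<close>

definition entry_pow :: "(nat \<times> nat \<Rightarrow> nat \<times> nat \<Rightarrow> complex) \<Rightarrow> index \<Rightarrow> index \<Rightarrow> complex" where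
  "entry_pow N p q = (\<Prod>t<length p. N (p ! t) (q ! t))"

lemma entry_pow_Nil [simp]: "entry_pow N [] [] = 1"
  by (simp add: entry_pow_def)

lemma entry_pow_Cons: "entry_pow N (u # p) (w # q) = N u w * entry_pow N p q"
  unfolding entry_pow_def length_Cons prod.lessThan_Suc_shift by simp

lemma entry_pow_snoc:
  "length p = length q \<Longrightarrow> entry_pow N (p @ [u]) (q @ [w]) = entry_pow N p q * N u w"
  by (simp add: entry_pow_def nth_append)

context multimatrix_state
begin

lemma amp_mult_adj:
  assumes x: "x \<in> tpow ns (j + 1)"
  shows "amp ns j 1 (mult_adj ns \<psi>) x = truncate ns (j + 2)
    (\<lambda>p q. x (take j p @ [p ! j]) (take j q @ [q ! (j + 1)]) * gram_inv (p ! (j + 1)) (q ! j))"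
  unfolding amp_def
proof (rule lin_ext_linear[OF x])
  let ?f = "\<lambda>x p q. x (take j p @ [p ! j]) (take j q @ [q ! (j + 1)]) * gram_inv (p ! (j + 1)) (q ! j)"
  show "tensor_linear (\<lambda>x. truncate ns (j + 2) (?f x))"
    by (rule truncate_linearI) (simp_all add: scale_apply distrib_right)
  fix p q s t assume pq: "(p, q) \<in> unit_idx ns j" and st: "(s, t) \<in> unit_idx ns 1"
  have tp: "kron j (mat_unit p q) (mult_adj ns \<psi> (mat_unit s t)) \<in> tpow ns (j + 2)"
    using pq st by (intro tpow_kron tpow_mat_unit) (simp_all add: mult_adj_eq tpow_mat_unit tpow_truncate)
  show "kron j (mat_unit p q) (mult_adj ns \<psi> (mat_unit s t))
      = truncate ns (j + 2) (?f (kron j (mat_unit p q) (mat_unit s t)))"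
  proof (rule tpow_eqI[OF tp tpow_truncate])
    fix P Q assume PQ: "P \<in> idx ns (j + 2)" "Q \<in> idx ns (j + 2)" "map fst P = map fst Q"
    then obtain p1 u w q1 v z where P: "P = p1 @ [u, w]" "p1 \<in> idx ns j" "u \<in> block_idx ns" "w \<in> block_idx ns"
      and Q: "Q = q1 @ [v, z]" "q1 \<in> idx ns j" "v \<in> block_idx ns" "z \<in> block_idx ns"
      by (metis idx_last2E)
    have fst: "fst u = fst v" "fst w = fst z" using PQ(3) P Q by (auto simp: idx_length)
    show "kron j (mat_unit p q) (mult_adj ns \<psi> (mat_unit s t)) P Q
        = truncate ns (j + 2) (?f (kron j (mat_unit p q) (mat_unit s t))) P Q"
      unfolding truncate_apply[OF PQ] mult_adj_eq[OF tpow_mat_unit[OF st]]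
      using P Q fst by (simp add: idx_length kron_append truncate_def unit_idx_iff pair_in_idx nth_append)
  qed
qed

lemma amp_T_adj:
  assumes x: "x \<in> tpow ns (k + 1)"
  shows "amp ns k 1 (amp ns 1 1 id \<circ> T_adj ns \<psi>) x = truncate ns (k + 2)
    (\<lambda>p q. if p ! k = q ! (k + 1) then
       \<Sum>w\<in>block_idx ns. x (take k p @ [p ! (k + 1)]) (take k q @ [w]) * gram_inv w (q ! k) else 0)"
  unfolding amp_def[of ns k]
proof (rule lin_ext_linear[OF x])
  let ?f = "\<lambda>x p q. if p ! k = q ! (k + 1) then
     \<Sum>w\<in>block_idx ns. x (take k p @ [p ! (k + 1)]) (take k q @ [w]) * gram_inv w (q ! k) else 0"
  have amp_id: "amp ns 1 1 id y = y" if "y \<in> tpow ns (1 + 1)" for y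
    unfolding amp_def using that
    by (intro lin_ext_linear[of _ _ _ _ "\<lambda>x. x"] tensor_linearI) simp_all
  show "tensor_linear (\<lambda>x. truncate ns (k + 2) (?f x))"
    by (rule truncate_linearI) (simp_all add: scale_apply distrib_right sum.distrib sum_distrib_left mult.assoc)
  fix p q s t assume pq: "(p, q) \<in> unit_idx ns k" and st: "(s, t) \<in> unit_idx ns 1"
  have id: "(amp ns 1 1 id \<circ> T_adj ns \<psi>) (mat_unit s t) = T_adj ns \<psi> (mat_unit s t)"
    using st by (simp add: amp_id[simplified] T_adj_eq tpow_mat_unit tpow_truncate numeral_2_eq_2[symmetric])
  have tp: "kron k (mat_unit p q) (T_adj ns \<psi> (mat_unit s t)) \<in> tpow ns (k + 2)"
    using pq st by (intro tpow_kron tpow_mat_unit) (simp_all add: T_adj_eq tpow_mat_unit tpow_truncate)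
  show "kron k (mat_unit p q) ((amp ns 1 1 id \<circ> T_adj ns \<psi>) (mat_unit s t))
      = truncate ns (k + 2) (?f (kron k (mat_unit p q) (mat_unit s t)))"
    unfolding id
  proof (rule tpow_eqI[OF tp tpow_truncate])
    fix P Q assume PQ: "P \<in> idx ns (k + 2)" "Q \<in> idx ns (k + 2)" "map fst P = map fst Q"
    then obtain p1 u w q1 v z where P: "P = p1 @ [u, w]" "p1 \<in> idx ns k" "u \<in> block_idx ns" "w \<in> block_idx ns"
      and Q: "Q = q1 @ [v, z]" "q1 \<in> idx ns k" "v \<in> block_idx ns" "z \<in> block_idx ns"
      by (metis idx_last2E)
    have fst: "fst u = fst v" "fst w = fst z" using PQ(3) P Q by (auto simp: idx_length)
    show "kron k (mat_unit p q) (T_adj ns \<psi> (mat_unit s t)) P Q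
        = truncate ns (k + 2) (?f (kron k (mat_unit p q) (mat_unit s t))) P Q"
      unfolding truncate_apply[OF PQ] T_adj_eq[OF tpow_mat_unit[OF st]]
      using P Q fst by (simp add: idx_length kron_append truncate_def unit_idx_iff pair_in_idx nth_append
          sum_distrib_left mult.assoc)
  qed
qed

lemma f_map_eq:
  assumes y: "y \<in> tpow ns (j + 2)"
  shows "f_map ns (Suc j) y = truncate ns (j + 2)
    (\<lambda>p q. y (butlast (tl p) @ [hd p, last p]) (butlast (tl q) @ [hd q, last q]))"
  unfolding f_map_def diff_Suc_1
proof (rule lin_ext_linear[OF y])
  let ?f = "\<lambda>y p q. y (butlast (tl p) @ [hd p, last p]) (butlast (tl q) @ [hd q, last q])"
  show "tensor_linear (\<lambda>y. truncate ns (j + 2) (?f y))"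
    by (rule truncate_linearI) (simp_all add: scale_apply)
  fix p q s t assume pq: "(p, q) \<in> unit_idx ns j" and st: "(s, t) \<in> unit_idx ns 2"
  from st have "s \<in> idx ns 2" "t \<in> idx ns 2" and st': "map fst s = map fst t"
    by (simp_all add: unit_idx_iff)
  then obtain s1 s2 t1 t2 where s: "s = [s1, s2]" "s1 \<in> block_idx ns" "s2 \<in> block_idx ns"
    and t: "t = [t1, t2]" "t1 \<in> block_idx ns" "t2 \<in> block_idx ns"
    by (elim idx_2E) blast
  have st1: "([s1], [t1]) \<in> unit_idx ns 1" and st2: "([s2], [t2]) \<in> unit_idx ns 1"
    using s t st' by (simp_all add: unit_idx_def)
  let ?X = "mat_unit p q"
  have X: "?X \<in> tpow ns j" by (rule tpow_mat_unit[OF pq])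
  have "lin_ext ns 1 1 (\<lambda>a b. kron 1 a (kron j ?X b)) (mat_unit s t)
      = kron 1 (mat_unit [s1] [t1]) (kron j ?X (mat_unit [s2] [t2]))"
    unfolding s(1) t(1) mat_unit_kron2[symmetric] using st1 st2
    by (intro lin_ext_kron) (simp_all add: tpow_mat_unit kron_add_left kron_add_right kron_scale_left kron_scale_right)
  also have "\<dots> = truncate ns (j + 2) (?f (kron j ?X (mat_unit s t)))"
  proof (rule tpow_eqI[OF _ tpow_truncate])
    have "kron 1 (mat_unit [s1] [t1]) (kron j ?X (mat_unit [s2] [t2])) \<in> tpow ns (1 + (j + 1))"
      using tpow_mat_unit[OF st1] tpow_mat_unit[OF st2] X by (intro tpow_kron)
    then show "kron 1 (mat_unit [s1] [t1]) (kron j ?X (mat_unit [s2] [t2])) \<in> tpow ns (j + 2)"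
      by simp
    fix P Q assume PQ: "P \<in> idx ns (j + 2)" "Q \<in> idx ns (j + 2)" "map fst P = map fst Q"
    then obtain u p' w v q' z where P: "P = u # p' @ [w]" "p' \<in> idx ns j"
      and Q: "Q = v # q' @ [z]" "q' \<in> idx ns j"
      by (metis idx_endsE)
    show "kron 1 (mat_unit [s1] [t1]) (kron j ?X (mat_unit [s2] [t2])) P Q
        = truncate ns (j + 2) (?f (kron j ?X (mat_unit s t))) P Q"
      unfolding truncate_apply[OF PQ] unfolding s(1) t(1) mat_unit_kron2[symmetric]
      using P Q by (simp add: kron_def idx_length)
  qed
  finally show "lin_ext ns 1 1 (\<lambda>a b. kron 1 a (kron j ?X b)) (mat_unit s t)
      = truncate ns (j + 2) (?f (kron j ?X (mat_unit s t)))" .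
qed

text \<open>
  The tensor with \<open>k + 1\<close> legs that has \<open>z\<close> between the first \<open>k\<close> row legs and the last \<open>k\<close> column legs, and
  closes up the last row leg with the first column leg by the inverse density. The truncation keeps
  the entries for which row and column lie in the same sequence of blocks.
\<close>

definition loop_tensor :: "nat \<Rightarrow> tensor \<Rightarrow> tensor" where
  "loop_tensor k z = truncate ns (k + 1) (\<lambda>p q. z (butlast p) (tl q) * gram_inv (last p) (hd q))"

text \<open>The first leg of the row index is moved to the end; columns are unchanged.\<close>

definition row_rot :: "tensor \<Rightarrow> tensor" where
  "row_rot x = (\<lambda>p q. x (rotate1 p) q)"

lemma tpow_loop_tensor: "loop_tensor k z \<in> tpow ns (k + 1)"
  unfolding loop_tensor_def by (rule tpow_truncate)

lemma loop_tensor_linear: "tensor_linear (loop_tensor k)"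
  unfolding loop_tensor_def by (rule truncate_linearI) (simp_all add: scale_apply distrib_right)

lemma loop_tensor_apply:
  assumes "p \<in> idx ns k" "q \<in> idx ns k" "u \<in> block_idx ns" "v \<in> block_idx ns"
  shows "loop_tensor k z (p @ [u]) (v # q) =
    (if map fst p @ [fst u] = fst v # map fst q then z p q * gram_inv u v else 0)"
  using assms by (simp add: loop_tensor_def truncate_def unit_idx_iff snoc_in_idx Cons_in_idx)

lemma loop_tensor_eqI:
  assumes X: "X \<in> tpow ns (k + 1)"
    and eq: "\<And>p u v q. p \<in> idx ns k \<Longrightarrow> q \<in> idx ns k \<Longrightarrow> u \<in> block_idx ns \<Longrightarrow> v \<in> block_idx ns \<Longrightarrow>
      map fst p @ [fst u] = fst v # map fst q \<Longrightarrow> X (p @ [u]) (v # q) = z p q * gram_inv u v"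
  shows "X = loop_tensor k z"
proof (rule tpow_eqI[OF X tpow_loop_tensor])
  fix P Q assume PQ: "P \<in> idx ns (k + 1)" "Q \<in> idx ns (k + 1)" "map fst P = map fst Q"
  then obtain p u v q where "P = p @ [u]" "Q = v # q" "p \<in> idx ns k" "q \<in> idx ns k"
    "u \<in> block_idx ns" "v \<in> block_idx ns"
    by (metis Suc_eq_plus1 idx_SucE idx_snocE)
  then show "X P Q = loop_tensor k z P Q"
    using PQ(3) by (simp add: loop_tensor_apply eq)
qed

text \<open>
  The first leg of \<open>m\<^sup>*\<close> carries the row and the second leg the column of its argument, and \<open>f\<^sub>k\<close> moves this
  first leg to the front. Hence the row of the last leg of \<open>x\<close> becomes the first row leg, while its column
  stays last.
\<close>

lemma f_map_amp_mult_adj: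
  assumes x: "x \<in> tpow ns (j + 1)"
  shows "f_map ns (Suc j) (amp ns j 1 (mult_adj ns \<psi>) x) = loop_tensor (j + 1) (row_rot x)"
  unfolding amp_mult_adj[OF x] f_map_eq[OF tpow_truncate]
proof (rule loop_tensor_eqI)
  let ?f = "\<lambda>p q. x (take j p @ [p ! j]) (take j q @ [q ! (j + 1)]) * gram_inv (p ! (j + 1)) (q ! j)"
  let ?F = "\<lambda>p q. truncate ns (j + 2) ?f (butlast (tl p) @ [hd p, last p]) (butlast (tl q) @ [hd q, last q])"
  show "truncate ns (j + 2) ?F \<in> tpow ns (j + 1 + 1)"
    using tpow_truncate[of ns "j + 2" ?F] by simp
  fix p u v q assume A: "p \<in> idx ns (j + 1)" "q \<in> idx ns (j + 1)" "u \<in> block_idx ns" "v \<in> block_idx ns"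
    "map fst p @ [fst u] = fst v # map fst q"
  then obtain p0 p' where p: "p = p0 # p'" "p0 \<in> block_idx ns" "p' \<in> idx ns j"
    by (metis Suc_eq_plus1 idx_SucE)
  from A obtain q' qe where q: "q = q' @ [qe]" "qe \<in> block_idx ns" "q' \<in> idx ns j"
    by (metis Suc_eq_plus1 idx_snocE)
  have m: "fst p0 = fst v" "map fst p' = map fst q'" "fst u = fst qe"
    using A(5) p q by (auto simp: idx_length)
  have "(p @ [u], v # q) \<in> unit_idx ns (j + 2)"
    using p q A m by (simp add: unit_idx_iff Cons_in_idx snoc_in_idx)
  moreover have "(p' @ [p0, u], q' @ [v, qe]) \<in> unit_idx ns (j + 2)"
    using p q A m by (auto simp: unit_idx_def idx_def)
  ultimately show "truncate ns (j + 2) ?F (p @ [u]) (v # q) = row_rot x p q * gram_inv u v"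
    using p q by (simp add: truncate_def idx_length nth_append row_rot_def)
qed

text \<open>
  The element \<open>(\<Otimes> Q\<^sup>-\<^sup>1) \<otimes> 1\<close> of the tensor power \<open>k \<ge> 1\<close>, with \<open>k - 1\<close> factors \<open>Q\<^sup>-\<^sup>1\<close>.
\<close>

definition chain :: "nat \<Rightarrow> tensor" where
  "chain k = truncate ns k (\<lambda>p q. if last p = last q then entry_pow gram_inv (butlast p) (butlast q) else 0)"

lemma tpow_chain: "chain k \<in> tpow ns k"
  unfolding chain_def by (rule tpow_truncate)

lemma entry_pow_nonzero:
  assumes "length p = length q" "entry_pow gram_inv p q \<noteq> 0"
  shows "map fst p = map fst q"
  using assms
proof (induction p q rule: list_induct2)
  case (Cons u p w q)
  then show ?case using gram_inv_nonzero[of u w] by (simp add: entry_pow_Cons)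
qed simp

lemma chain_snoc:
  assumes "p \<in> idx ns j" "q \<in> idx ns j" "u \<in> block_idx ns" "w \<in> block_idx ns"
  shows "chain (Suc j) (p @ [u]) (q @ [w]) = (if u = w then entry_pow gram_inv p q else 0)"
  using assms entry_pow_nonzero[of p q]
  by (auto simp: chain_def truncate_def unit_idx_iff snoc_in_idx idx_length)

text \<open>
  In the induction step \<open>T\<^sup>*\<close> replaces the last leg of \<open>\<epsilon>\<^sup>k\<close> by two legs. The identity that was at the end of the
  chain contracts with the factor \<open>Q\<^sup>-\<^sup>1\<close> of \<open>T\<^sup>*\<close>, and a new identity appears behind it.
\<close>

lemma path_indicator_eq:
  "path_indicator ns \<psi> \<delta> id (Suc j) =
     scale (of_real (1 / \<delta>\<^sup>2) ^ Suc j) (loop_tensor (Suc j) (chain (Suc j)))"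
proof (induction j)
  case 0
  have u: "unit_el ns 1 \<in> tpow ns (0 + 1)" using tpow_unit_el[of ns 1] by simp
  have "amp ns 0 1 (amp ns 1 1 id \<circ> T_adj ns \<psi>) (unit_el ns 1) = loop_tensor (Suc 0) (chain (Suc 0))"
    unfolding amp_T_adj[OF u]
  proof (rule loop_tensor_eqI)
    let ?f = "\<lambda>p q. if p ! 0 = q ! (0 + 1) then
       \<Sum>w\<in>block_idx ns. unit_el ns 1 (take 0 p @ [p ! (0 + 1)]) (take 0 q @ [w]) * gram_inv w (q ! 0) else 0"
    show "truncate ns (0 + 2) ?f \<in> tpow ns (Suc 0 + 1)"
      using tpow_truncate[of ns "0 + 2" ?f] by (simp add: numeral_2_eq_2)
    fix p u v q assume A: "p \<in> idx ns (Suc 0)" "q \<in> idx ns (Suc 0)" "u \<in> block_idx ns" "v \<in> block_idx ns"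
      "map fst p @ [fst u] = fst v # map fst q"
    then obtain a b where ab: "p = [a]" "q = [b]" "a \<in> block_idx ns" "b \<in> block_idx ns"
      by (metis One_nat_def idx_1E)
    have "(p @ [u], v # q) \<in> unit_idx ns (0 + 2)"
      using A ab by (simp add: unit_idx_def)
    moreover have "(\<Sum>w\<in>block_idx ns. unit_el ns 1 [u] [w] * gram_inv w v)
        = (\<Sum>w\<in>block_idx ns. if w = u then gram_inv u v else 0)"
      using A(3) by (intro sum.cong refl) (simp add: unit_el_apply singleton_in_idx[simplified])
    ultimately show "truncate ns (0 + 2) ?f (p @ [u]) (v # q) = chain (Suc 0) p q * gram_inv u v"
      using A ab chain_snoc[of "[]" 0 "[]" a b] by (simp add: truncate_def finite_block_idx)
  qed
  then show ?case by (simp only: path_indicator.simps power_Suc power_0 mult_1_right)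
next
  case (Suc j)
  interpret vector_space scale by (rule vector_space_scale)
  let ?c = "complex_of_real (1 / \<delta>\<^sup>2)"
  let ?A = "amp ns (Suc j) 1 (amp ns 1 1 id \<circ> T_adj ns \<psi>)"
  let ?L = "loop_tensor (Suc j) (chain (Suc j))"
  have step: "?A ?L = loop_tensor (Suc (Suc j)) (chain (Suc (Suc j)))"
    unfolding amp_T_adj[OF tpow_loop_tensor]
  proof (rule loop_tensor_eqI)
    let ?f = "\<lambda>p q. if p ! Suc j = q ! (Suc j + 1) then
       \<Sum>w\<in>block_idx ns. ?L (take (Suc j) p @ [p ! (Suc j + 1)]) (take (Suc j) q @ [w]) * gram_inv w (q ! Suc j) else 0"
    show "truncate ns (Suc j + 2) ?f \<in> tpow ns (Suc (Suc j) + 1)"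
      using tpow_truncate[of ns "Suc j + 2" ?f] by simp
    fix P u v Q assume A: "P \<in> idx ns (Suc (Suc j))" "Q \<in> idx ns (Suc (Suc j))"
      "u \<in> block_idx ns" "v \<in> block_idx ns" "map fst P @ [fst u] = fst v # map fst Q"
    then obtain p l m where P: "P = p @ [l, m]" "p \<in> idx ns j" "l \<in> block_idx ns" "m \<in> block_idx ns"
      by (metis Suc_eq_plus1 add_2_eq_Suc' idx_last2E)
    from A obtain q z e where Q: "Q = q @ [z, e]" "q \<in> idx ns j" "z \<in> block_idx ns" "e \<in> block_idx ns"
      by (metis Suc_eq_plus1 add_2_eq_Suc' idx_last2E)
    have blocks: "map fst p @ [fst l] = fst v # map fst q" "fst m = fst z" "fst u = fst e"
      using A(5) P Q by (auto simp: append_eq_Cons_conv Cons_eq_append_conv)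
    have unit: "(P @ [u], v # Q) \<in> unit_idx ns (Suc j + 2)"
      using A by (simp add: unit_idx_iff snoc_in_idx Cons_in_idx)
    have L: "?L ((p @ [l]) @ [u]) (v # (q @ [w])) =
        (if w = l then if map fst p @ [fst l, fst u] = fst v # map fst q @ [fst l]
         then entry_pow gram_inv p q * gram_inv u v else 0 else 0)" if "w \<in> block_idx ns" for w
      using that A P Q by (subst loop_tensor_apply) (simp_all add: snoc_in_idx chain_snoc)
    have "(\<Sum>w\<in>block_idx ns. ?L ((p @ [l]) @ [u]) (v # (q @ [w])) * gram_inv w z)
        = (\<Sum>w\<in>block_idx ns. if w = l then if map fst p @ [fst l, fst u] = fst v # map fst q @ [fst l]
         then entry_pow gram_inv p q * gram_inv u v * gram_inv l z else 0 else 0)"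
      by (intro sum.cong refl, subst L, assumption, auto)
    also have "\<dots> = (if map fst p @ [fst l, fst u] = fst v # map fst q @ [fst l]
         then entry_pow gram_inv p q * gram_inv u v * gram_inv l z else 0)"
      using P by (simp add: finite_block_idx)
    also have "\<dots> = (if fst u = fst l then entry_pow gram_inv p q * gram_inv u v * gram_inv l z else 0)"
      using arg_cong[OF blocks(1), of "\<lambda>xs. xs @ [fst u]"] by auto
    finally have s: "(\<Sum>w\<in>block_idx ns. ?L ((p @ [l]) @ [u]) (v # (q @ [w])) * gram_inv w z)
        = (if fst u = fst l then entry_pow gram_inv p q * gram_inv u v * gram_inv l z else 0)" .
    have "truncate ns (Suc j + 2) ?f (P @ [u]) (v # Q) = (if m = e then
        (if fst u = fst l then entry_pow gram_inv p q * gram_inv u v * gram_inv l z else 0) else 0)"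
      using unit P Q s by (simp add: truncate_def idx_length nth_append)
    also have "\<dots> = (if m = e then entry_pow gram_inv p q * gram_inv l z * gram_inv u v else 0)"
      using blocks gram_inv_nonzero[of l z] by (cases "gram_inv l z = 0") auto
    also have "\<dots> = chain (Suc (Suc j)) P Q * gram_inv u v"
      using P Q chain_snoc[of "p @ [l]" "Suc j" "q @ [z]" m e]
      by (simp add: snoc_in_idx entry_pow_snoc idx_length)
    finally show "truncate ns (Suc j + 2) ?f (P @ [u]) (v # Q) = chain (Suc (Suc j)) P Q * gram_inv u v" .
  qed
  have "path_indicator ns \<psi> \<delta> id (Suc (Suc j)) = scale ?c (?A (scale (?c ^ Suc j) ?L))"
    by (subst path_indicator.simps(2)) (simp only: Suc)
  also have "?A (scale (?c ^ Suc j) ?L) = scale (?c ^ Suc j) (?A ?L)"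
    unfolding amp_def[of ns "Suc j"] by (rule tensor_linear_scale[OF lin_ext_tensor_linear])
  finally show ?case by (simp only: step scale_scale power_Suc)
qed

end

section \<open>Path spaces and block sums\<close>

text \<open>All entries of the index lie in one block.\<close>

definition single_block :: "index \<Rightarrow> bool" where
  "single_block p \<longleftrightarrow> (\<exists>a. fst ` set p \<subseteq> {a})"

text \<open>This makes a block sequence that is invariant under a shift constant.\<close>

lemma append_eq_Cons_constant: "xs @ [a] = a # xs \<Longrightarrow> set xs \<subseteq> {a}"
  by (induction xs) auto

lemma single_block_transfer: "map fst p = map fst q \<Longrightarrow> single_block p \<longleftrightarrow> single_block q"
  unfolding single_block_def by (metis list.set_map)

text \<open>
  For \<open>k = 0\<close> the right-hand side is all of the tensor power even if there is no block, hence the assumption.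
\<close>

lemma block_sum_iff:
  assumes k: "1 \<le> k"
  shows "x \<in> block_sum ns k \<longleftrightarrow> x \<in> tpow ns k \<and> (\<forall>p q. x p q \<noteq> 0 \<longrightarrow> single_block p)"
proof
  assume "x \<in> block_sum ns k"
  then obtain y where x: "x = (\<Sum>a<length ns. y a)" and y: "\<And>a. a < length ns \<Longrightarrow> y a \<in> block_tpow ns a k"
    by (auto simp: block_sum_def)
  have "x \<in> tpow ns k" unfolding x using y by (intro tpow_sum) (simp add: block_tpow_def)
  moreover have "single_block p" if "x p q \<noteq> 0" for p q
  proof -
    have "(\<Sum>a<length ns. y a p q) \<noteq> 0" using that by (simp add: x sum_fun_apply2)
    then obtain a where "a \<in> {..<length ns}" "y a p q \<noteq> 0" by (rule sum.not_neutral_contains_not_neutral)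
    then have "fst ` set p \<subseteq> {a}" using y[of a] by (auto simp: block_tpow_def)
    then show ?thesis unfolding single_block_def ..
  qed
  ultimately show "x \<in> tpow ns k \<and> (\<forall>p q. x p q \<noteq> 0 \<longrightarrow> single_block p)" by blast
next
  assume "x \<in> tpow ns k \<and> (\<forall>p q. x p q \<noteq> 0 \<longrightarrow> single_block p)"
  then have x: "x \<in> tpow ns k" and sb: "\<And>p q. x p q \<noteq> 0 \<Longrightarrow> single_block p" by auto
  define y where "y a = (\<lambda>p q. if fst (hd p) = a then x p q else 0)" for a
  have "y a \<in> block_tpow ns a k" for a
  proof -
    have "fst ` set p \<subseteq> {a} \<and> fst ` set q \<subseteq> {a}" if "y a p q \<noteq> 0" for p q
    proof -
      have nz: "x p q \<noteq> 0" "fst (hd p) = a" using that by (auto simp: y_def split: if_splits)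
      then have pq: "length p = k" "map fst p = map fst q"
        using tpow_nonzero[OF x nz(1)] by (auto simp: idx_def)
      then have "p \<noteq> []" using k by auto
      then have "fst ` set p \<subseteq> {a}"
        using sb[OF nz(1)] nz(2) unfolding single_block_def by (cases p) auto
      then show ?thesis using pq(2) by (metis list.set_map)
    qed
    moreover have "y a \<in> tpow ns k" using x by (auto simp: y_def tpow_def)
    ultimately show ?thesis by (simp add: block_tpow_def)
  qed
  moreover have "x = (\<Sum>a<length ns. y a)"
  proof (rule tpow_eqI[OF x])
    show "(\<Sum>a<length ns. y a) \<in> tpow ns k" using x by (intro tpow_sum) (auto simp: y_def tpow_def)
    fix p q assume "p \<in> idx ns k"
    then have "fst (hd p) < length ns" using k by (cases p) (auto simp: idx_def block_idx_def)
    then show "x p q = (\<Sum>a<length ns. y a) p q" by (simp add: sum_fun_apply2 y_def)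
  qed
  ultimately show "x \<in> block_sum ns k" unfolding block_sum_def by blast
qed

lemma block_sum_subspace:
  assumes "1 \<le> k"
  shows "module.subspace scale (block_sum ns k)"
proof -
  interpret vector_space scale by (rule vector_space_scale)
  note iff = block_sum_iff[OF assms]
  show ?thesis
  proof (rule subspaceI)
    show "0 \<in> block_sum ns k" by (simp add: iff tpow_def)
    show "x + y \<in> block_sum ns k" if "x \<in> block_sum ns k" "y \<in> block_sum ns k" for x y
    proof -
      have "single_block p" if "(x + y) p q \<noteq> 0" for p q
        using that \<open>x \<in> _\<close> \<open>y \<in> _\<close> by (cases "x p q = 0") (auto simp: iff)
      then show ?thesis using that by (simp add: iff tpow_add)
    qed
    show "scale c x \<in> block_sum ns k" if "x \<in> block_sum ns k" for c x
      using that by (auto simp: iff tpow_scale scale_apply)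
  qed
qed

lemma block_sum_tpow: "1 \<le> k \<Longrightarrow> x \<in> block_sum ns k \<Longrightarrow> x \<in> tpow ns k"
  by (simp add: block_sum_iff)

lemma block_sum_single_block: "x \<in> block_sum ns (Suc j) \<Longrightarrow> x p q \<noteq> 0 \<Longrightarrow> single_block p"
  using block_sum_iff[of "Suc j" x ns] by auto

context multimatrix_state
begin

text \<open>
  At a position where \<open>loop_tensor k z\<close> may be nonzero, the block sequence of \<open>p\<close> equals that of \<open>q\<close> because
  \<open>z\<close> has a nonzero entry there, and it also equals the one of \<open>q\<close> shifted by a leg.
\<close>

lemma loop_tensor_cong:
  assumes z: "z \<in> tpow ns k" "z' \<in> tpow ns k"
    and eq: "\<And>p q. p \<in> idx ns k \<Longrightarrow> q \<in> idx ns k \<Longrightarrow> single_block p \<Longrightarrow> z p q = z' p q"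
  shows "loop_tensor k z = loop_tensor k z'"
proof (rule loop_tensor_eqI[OF tpow_loop_tensor])
  fix p u v q assume A: "p \<in> idx ns k" "q \<in> idx ns k" "u \<in> block_idx ns" "v \<in> block_idx ns"
    and m: "map fst p @ [fst u] = fst v # map fst q"
  have "z p q * gram_inv u v = z' p q * gram_inv u v"
  proof (cases "map fst p = map fst q \<and> gram_inv u v \<noteq> 0")
    case True
    then have "set (map fst p) \<subseteq> {fst u}"
      using m gram_inv_nonzero[of u v] by (intro append_eq_Cons_constant) auto
    then have "single_block p" unfolding single_block_def by auto
    then show ?thesis using eq A by simp
  next
    case False
    then show ?thesis using tpow_nonzero[OF z(1), of p q] tpow_nonzero[OF z(2), of p q] by fastforce
  qed
  then show "loop_tensor k z (p @ [u]) (v # q) = z' p q * gram_inv u v"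
    using loop_tensor_apply[OF A, of z] m by simp
qed

text \<open>
  The first \<open>k\<close> row legs and the last \<open>k\<close> column legs are those on which \<open>x \<otimes> 1\<close> and \<open>1 \<otimes> y\<close> act. Since \<open>x\<close>
  and \<open>y\<close> preserve block sequences, the truncation in \<open>loop_tensor\<close> does not interfere.
\<close>

lemma loop_tensor_bimodule:
  assumes x: "x \<in> tpow ns k" and c: "c \<in> tpow ns k" and y: "y \<in> tpow ns k"
  shows "mul ns (mul ns (kron k x (unit_el ns 1)) (loop_tensor k c)) (kron 1 (unit_el ns 1) y)
    = loop_tensor k (mul ns (mul ns x c) y)"
proof (rule loop_tensor_eqI)
  let ?Z = "mul ns (kron k x (unit_el ns 1)) (loop_tensor k c)"
  have Z: "?Z \<in> tpow ns (k + 1)"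
    using x by (intro tpow_mul tpow_kron tpow_unit_el tpow_loop_tensor)
  then have Z': "?Z \<in> tpow ns (1 + k)" by (simp add: add.commute)
  have "kron 1 (unit_el ns 1) y \<in> tpow ns (1 + k)"
    using y by (intro tpow_kron tpow_unit_el)
  then have "kron 1 (unit_el ns 1) y \<in> tpow ns (k + 1)" by (simp only: add.commute)
  with Z show "mul ns ?Z (kron 1 (unit_el ns 1) y) \<in> tpow ns (k + 1)" by (rule tpow_mul)
  fix p u v q assume A: "p \<in> idx ns k" "q \<in> idx ns k" "u \<in> block_idx ns" "v \<in> block_idx ns"
    and m: "map fst p @ [fst u] = fst v # map fst q"
  have "mul ns ?Z (kron 1 (unit_el ns 1) y) (p @ [u]) (v # q)
      = (\<Sum>s\<in>idx ns k. ?Z (p @ [u]) (v # s) * y s q)"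
    using mul_kron_unit_right[OF Z', of "[v]" y "p @ [u]" q] A by (simp add: singleton_in_idx[simplified])
  also have "\<dots> = (\<Sum>s\<in>idx ns k. (\<Sum>r\<in>idx ns k. x p r * loop_tensor k c (r @ [u]) (v # s)) * y s q)"
    using A by (simp add: mul_kron_left[of p k "[u]" ns 1, unfolded One_nat_def] idx_length singleton_in_idx[simplified])
  also have "\<dots> = (\<Sum>s\<in>idx ns k. (\<Sum>r\<in>idx ns k. x p r * c r s) * y s q * gram_inv u v)"
  proof (rule sum.cong[OF refl])
    fix s assume s: "s \<in> idx ns k"
    show "(\<Sum>r\<in>idx ns k. x p r * loop_tensor k c (r @ [u]) (v # s)) * y s q
        = (\<Sum>r\<in>idx ns k. x p r * c r s) * y s q * gram_inv u v"
    proof (cases "y s q = 0")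
      case False
      then have sq: "map fst s = map fst q" using tpow_nonzero[OF y] by blast
      have t: "x p r * loop_tensor k c (r @ [u]) (v # s) = x p r * c r s * gram_inv u v" if "r \<in> idx ns k" for r
      proof (cases "x p r = 0")
        case False
        then have "map fst p = map fst r" using tpow_nonzero[OF x] by blast
        then show ?thesis using A s that m sq by (simp add: loop_tensor_apply)
      qed simp
      have "(\<Sum>r\<in>idx ns k. x p r * loop_tensor k c (r @ [u]) (v # s))
          = (\<Sum>r\<in>idx ns k. x p r * c r s * gram_inv u v)"
        by (rule sum.cong[OF refl t])
      then show ?thesis by (simp only: sum_distrib_right[symmetric]) (simp only: mult_ac)
    qed simp
  qed
  also have "\<dots> = mul ns (mul ns x c) y p q * gram_inv u v"
    using A by (simp add: mul_apply idx_length sum_distrib_right)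
  finally show "mul ns ?Z (kron 1 (unit_el ns 1) y) (p @ [u]) (v # q)
      = mul ns (mul ns x c) y p q * gram_inv u v" .
qed

lemma gram_pow_entry_pow:
  assumes "p \<in> idx ns j" "q \<in> idx ns j"
  shows "(\<Sum>r\<in>idx ns j. gram_pow \<psi> r p * entry_pow gram_inv r q) = (if p = q then 1 else 0)"
  using assms
proof (induction j arbitrary: p q)
  case 0
  then show ?case by simp
next
  case (Suc j)
  from Suc.prems(1) obtain u p' where p: "p = u # p'" "u \<in> block_idx ns" "p' \<in> idx ns j"
    by (rule idx_SucE)
  from Suc.prems(2) obtain w q' where q: "q = w # q'" "w \<in> block_idx ns" "q' \<in> idx ns j"
    by (rule idx_SucE)
  have "(\<Sum>r\<in>idx ns (Suc j). gram_pow \<psi> r p * entry_pow gram_inv r q)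
      = (\<Sum>x\<in>block_idx ns. gram \<psi> x u * gram_inv x w) *
        (\<Sum>r\<in>idx ns j. gram_pow \<psi> r p' * entry_pow gram_inv r q')"
    by (simp add: p q sum_idx_Suc gram_pow_Cons entry_pow_Cons sum_product mult_ac)
  then show ?case using p q by (simp add: gram_gram_inv Suc.IH)
qed

text \<open>The inverse is \<open>(\<Otimes> Q) \<otimes> 1\<close>.\<close>

lemma chain_left_inverse: "\<exists>c\<in>tpow ns (Suc j). mul ns c (chain (Suc j)) = unit_el ns (Suc j)"
proof
  let ?c = "truncate ns (Suc j) (\<lambda>p q. if last p = last q then gram_pow \<psi> (butlast q) (butlast p) else 0)"
  show "?c \<in> tpow ns (Suc j)" by (rule tpow_truncate)
  have c: "?c (p @ [u]) (r @ [x]) = (if u = x then gram_pow \<psi> r p else 0)"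
    if "p \<in> idx ns j" "r \<in> idx ns j" "u \<in> block_idx ns" "x \<in> block_idx ns" for p r u x
    using that gram_pow_eq_0[of r p \<psi>]
    by (auto simp: truncate_def unit_idx_iff snoc_in_idx idx_length)
  show "mul ns ?c (chain (Suc j)) = unit_el ns (Suc j)"
  proof (rule tpow_eqI[OF tpow_mul[OF tpow_truncate tpow_chain] tpow_unit_el])
    fix P Q assume PQ: "P \<in> idx ns (Suc j)" "Q \<in> idx ns (Suc j)"
    from PQ(1) obtain p u where p: "P = p @ [u]" "p \<in> idx ns j" "u \<in> block_idx ns"
      by (rule idx_snocE)
    from PQ(2) obtain q w where q: "Q = q @ [w]" "q \<in> idx ns j" "w \<in> block_idx ns"
      by (rule idx_snocE)
    have "mul ns ?c (chain (Suc j)) P Q = (\<Sum>r\<in>idx ns j. \<Sum>x\<in>block_idx ns.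
        if x = u then if u = w then gram_pow \<psi> r p * entry_pow gram_inv r q else 0 else 0)"
      using p q by (auto simp: mul_apply idx_length sum_idx_snoc c chain_snoc intro!: sum.cong)
    also have "\<dots> = (if u = w then \<Sum>r\<in>idx ns j. gram_pow \<psi> r p * entry_pow gram_inv r q else 0)"
      using p by (simp add: finite_block_idx)
    also have "\<dots> = unit_el ns (Suc j) P Q"
      using p q by (auto simp: gram_pow_entry_pow unit_el_apply snoc_in_idx)
    finally show "mul ns ?c (chain (Suc j)) P Q = unit_el ns (Suc j) P Q" .
  qed
qed

lemma loop_tensor_image_subspace: "module.subspace scale (loop_tensor k ` tpow ns k)"
proof -
  interpret vector_space scale by (rule vector_space_scale)
  note add = tensor_linear_add[OF loop_tensor_linear, symmetric]
  note scl = tensor_linear_scale[OF loop_tensor_linear, symmetric]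
  have "loop_tensor k 0 = 0" using tensor_linear_scale[OF loop_tensor_linear, of k 0 0] by simp
  then have "0 \<in> loop_tensor k ` tpow ns k"
    using subspace_0[OF tpow_subspace] by (metis imageI)
  then show ?thesis
    unfolding subspace_def by (auto simp: add scl intro!: imageI tpow_add tpow_scale)
qed

text \<open>
  Any \<open>loop_tensor k z\<close> is already a single generator: take \<open>y = 1\<close> and let \<open>x\<close> be a multiple of \<open>z\<close> times the
  inverse of \<open>chain k\<close>.
\<close>

lemma path_space_eq:
  assumes "\<delta> \<noteq> 0"
  shows "path_space ns \<psi> \<delta> id (Suc j) = loop_tensor (Suc j) ` tpow ns (Suc j)"
proof -
  interpret vector_space scale by (rule vector_space_scale)
  let ?k = "Suc j" and ?d = "complex_of_real (1 / \<delta>\<^sup>2) ^ Suc j"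
  have d: "?d \<noteq> 0" using assms by simp
  have gen: "mul ns (mul ns (kron ?k x (unit_el ns 1)) (path_indicator ns \<psi> \<delta> id ?k)) (kron 1 (unit_el ns 1) y)
      = loop_tensor ?k (scale ?d (mul ns (mul ns x (chain ?k)) y))"
    if "x \<in> tpow ns ?k" "y \<in> tpow ns ?k" for x y
    unfolding path_indicator_eq mul_scale_left mul_scale_right
      loop_tensor_bimodule[OF that(1) tpow_chain that(2)] tensor_linear_scale[OF loop_tensor_linear] ..
  let ?G = "{mul ns (mul ns (kron ?k x (unit_el ns 1)) (path_indicator ns \<psi> \<delta> id ?k)) (kron 1 (unit_el ns 1) y)
      | x y. x \<in> tpow ns ?k \<and> y \<in> tpow ns ?k}"
  have "span ?G \<subseteq> loop_tensor ?k ` tpow ns ?k"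
  proof (rule span_minimal[OF _ loop_tensor_image_subspace])
    show "?G \<subseteq> loop_tensor ?k ` tpow ns ?k"
    proof
      fix g assume "g \<in> ?G"
      then obtain x y where xy: "x \<in> tpow ns ?k" "y \<in> tpow ns ?k"
        and g: "g = loop_tensor ?k (scale ?d (mul ns (mul ns x (chain ?k)) y))"
        using gen by blast
      then show "g \<in> loop_tensor ?k ` tpow ns ?k"
        unfolding g by (intro imageI tpow_scale tpow_mul tpow_chain)
    qed
  qed
  moreover have "loop_tensor ?k ` tpow ns ?k \<subseteq> span ?G"
  proof
    fix g assume "g \<in> loop_tensor ?k ` tpow ns ?k"
    then obtain z where z: "z \<in> tpow ns ?k" and g: "g = loop_tensor ?k z" by blast
    obtain c where c: "c \<in> tpow ns ?k" "mul ns c (chain ?k) = unit_el ns ?k"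
      using chain_left_inverse by blast
    let ?x = "scale (1 / ?d) (mul ns z c)"
    have x: "?x \<in> tpow ns ?k" using z c by (intro tpow_scale tpow_mul)
    have "mul ns (mul ns ?x (chain ?k)) (unit_el ns ?k) = scale (1 / ?d) z"
      by (simp only: mul_scale_left mul_assoc c mul_unit_right[OF tpow_unit_el] mul_unit_right[OF z])
    then have "scale ?d (mul ns (mul ns ?x (chain ?k)) (unit_el ns ?k)) = z"
      using d by (simp only: scale_scale) simp
    then have "g = mul ns (mul ns (kron ?k ?x (unit_el ns 1)) (path_indicator ns \<psi> \<delta> id ?k)) (kron 1 (unit_el ns 1) (unit_el ns ?k))"
      using gen[OF x tpow_unit_el] g by simp
    then have "g \<in> ?G" using x tpow_unit_el by blast
    then show "g \<in> span ?G" by (rule span_base)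
  qed
  ultimately show ?thesis unfolding path_space_def by blast
qed

text \<open>Within a single block the rotation of the row does not change the block sequence.\<close>

lemma tpow_row_rot:
  assumes x: "x \<in> block_sum ns (Suc j)"
  shows "row_rot x \<in> tpow ns (Suc j)"
proof (rule tpowI)
  fix p q assume nz: "row_rot x p q \<noteq> 0"
  have x': "x \<in> tpow ns (Suc j)" using block_sum_tpow[OF _ x] by simp
  have r: "rotate1 p \<in> idx ns (Suc j)" "q \<in> idx ns (Suc j)" "map fst (rotate1 p) = map fst q"
    using nz tpow_nonzero[OF x'] by (auto simp: row_rot_def)
  have "single_block (rotate1 p)" using nz block_sum_single_block[OF x] by (auto simp: row_rot_def)
  then obtain a where a: "fst ` set p \<subseteq> {a}" by (auto simp: single_block_def)
  have "set (map fst p) \<subseteq> {a}" "set (map fst (rotate1 p)) \<subseteq> {a}" using a by auto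
  then have "map fst p = replicate (length p) a" "map fst (rotate1 p) = replicate (length p) a"
    by (intro replicate_eqI; force)+
  then show "(p, q) \<in> unit_idx ns (Suc j)"
    using r by (auto simp: unit_idx_iff idx_def)
qed

lemma row_rot_kron_left:
  assumes b: "b \<in> tpow ns 1" and x: "x \<in> tpow ns (Suc j)" and p: "p \<in> idx ns (Suc j)"
  shows "row_rot (mul ns (kron j (unit_el ns j) b) x) p q = mul ns (kron 1 b (unit_el ns j)) (row_rot x) p q"
proof -
  obtain u p' where p': "p = u # p'" "p' \<in> idx ns j" using p by (rule idx_SucE)
  have x': "x \<in> tpow ns (j + 1)" using x by simp
  show ?thesis
    using mul_kron_unit_left[OF x', of p' "[u]" b q] mul_kron_left[of "[u]" 1 p' ns j b "row_rot x" q] p'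
    by (simp add: row_rot_def sum_idx_1[unfolded One_nat_def])
qed

lemma row_rot_mul_right: "row_rot (mul ns x y) = mul ns (row_rot x) y"
  by (simp add: row_rot_def mul_apply fun_eq_iff)

lemma block_sum_kron_left:
  assumes b: "b \<in> tpow ns 1" and x: "x \<in> block_sum ns (Suc j)"
  shows "mul ns (kron j (unit_el ns j) b) x \<in> block_sum ns (Suc j)"
proof -
  have x': "x \<in> tpow ns (j + 1)" using block_sum_tpow[OF _ x] by simp
  have t: "mul ns (kron j (unit_el ns j) b) x \<in> tpow ns (j + 1)"
    using b x' by (intro tpow_mul tpow_kron tpow_unit_el)
  have "single_block P" if nz: "mul ns (kron j (unit_el ns j) b) x P Q \<noteq> 0" for P Q
  proof -
    have "P \<in> idx ns (Suc j)" using tpow_nonzero[OF t nz] by simp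
    then obtain p u where P: "P = p @ [u]" "p \<in> idx ns j" by (rule idx_snocE)
    have "(\<Sum>w\<in>block_idx ns. b [u] [w] * x (p @ [w]) Q) \<noteq> 0"
      using nz mul_kron_unit_left[OF x', of p "[u]" b Q] P by (simp add: sum_idx_1[unfolded One_nat_def])
    then obtain w where "b [u] [w] * x (p @ [w]) Q \<noteq> 0" by (rule sum.not_neutral_contains_not_neutral)
    then have "fst u = fst w" "single_block (p @ [w])"
      using tpow_nonzero[OF b, of "[u]" "[w]"] block_sum_single_block[OF x] by auto
    then show ?thesis using single_block_transfer[of "p @ [w]" "p @ [u]"] P by simp
  qed
  then show ?thesis using t by (simp add: block_sum_iff)
qed

lemma block_sum_mul_right:
  assumes y: "y \<in> tpow ns (Suc j)" and x: "x \<in> block_sum ns (Suc j)"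
  shows "mul ns x y \<in> block_sum ns (Suc j)"
proof -
  have x': "x \<in> tpow ns (Suc j)" using block_sum_tpow[OF _ x] by simp
  have "single_block P" if nz: "mul ns x y P Q \<noteq> 0" for P Q
  proof -
    obtain r where "x P r * y r Q \<noteq> 0"
      using nz unfolding mul_apply by (rule sum.not_neutral_contains_not_neutral)
    then show ?thesis using block_sum_single_block[OF x] by auto
  qed
  then show ?thesis using tpow_mul[OF x' y] by (simp add: block_sum_iff)
qed

lemma loop_tensor_row_rot_image:
  "loop_tensor (Suc j) ` tpow ns (Suc j) = (\<lambda>x. loop_tensor (Suc j) (row_rot x)) ` block_sum ns (Suc j)"
proof (intro equalityI subsetI)
  fix g assume "g \<in> loop_tensor (Suc j) ` tpow ns (Suc j)"
  then obtain z where z: "z \<in> tpow ns (Suc j)" and g: "g = loop_tensor (Suc j) z" by blast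
  \<comment> \<open>the part of \<open>z\<close> in the block sum with its row rotated back\<close>
  define x where "x p q = (if p \<noteq> [] \<and> single_block p then z (last p # butlast p) q else 0)" for p q
  have x: "x \<in> tpow ns (Suc j)"
  proof (rule tpowI)
    fix p q assume "x p q \<noteq> 0"
    then have sb: "single_block p" and nz: "z (last p # butlast p) q \<noteq> 0" by (auto simp: x_def split: if_splits)
    have r: "last p # butlast p \<in> idx ns (Suc j)" "q \<in> idx ns (Suc j)"
      "map fst (last p # butlast p) = map fst q"
      using tpow_nonzero[OF z nz] by auto
    have "p \<noteq> []" using \<open>x p q \<noteq> 0\<close> by (auto simp: x_def)
    then obtain p' u where p: "p = p' @ [u]" by (metis append_butlast_last_id)
    obtain a where a: "fst ` set p \<subseteq> {a}" using sb by (auto simp: single_block_def)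
    have "set (map fst (u # p')) \<subseteq> {a}" "set (map fst p) \<subseteq> {a}" using a p by auto
    then have "map fst (u # p') = replicate (length p) a" "map fst p = replicate (length p) a"
      using p by (intro replicate_eqI; force)+
    then show "(p, q) \<in> unit_idx ns (Suc j)" using r p by (auto simp: unit_idx_iff idx_def)
  qed
  have xb: "x \<in> block_sum ns (Suc j)" using x by (simp add: block_sum_iff x_def)
  have "g = loop_tensor (Suc j) (row_rot x)"
    unfolding g
  proof (rule loop_tensor_cong[OF z tpow_row_rot[OF xb]])
    fix p q assume p: "p \<in> idx ns (Suc j)" "single_block p"
    then obtain u p' where "p = u # p'" by (metis idx_SucE)
    then show "z p q = row_rot x p q" using p by (simp add: row_rot_def x_def single_block_def)
  qed
  then show "g \<in> (\<lambda>x. loop_tensor (Suc j) (row_rot x)) ` block_sum ns (Suc j)" using xb by blast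
next
  fix g assume "g \<in> (\<lambda>x. loop_tensor (Suc j) (row_rot x)) ` block_sum ns (Suc j)"
  then show "g \<in> loop_tensor (Suc j) ` tpow ns (Suc j)" using tpow_row_rot by blast
qed

lemma loop_tensor_left:
  assumes b: "b \<in> tpow ns 1" and z: "z \<in> tpow ns (Suc j)"
  shows "mul ns (kron 1 b (unit_el ns (Suc j))) (loop_tensor (Suc j) z)
    = loop_tensor (Suc j) (mul ns (kron 1 b (unit_el ns j)) z)"
proof -
  have k: "kron 1 b (unit_el ns j) \<in> tpow ns (Suc j)"
    using tpow_kron[OF b tpow_unit_el[of ns j]] by simp
  have e: "kron (Suc j) (kron 1 b (unit_el ns j)) (unit_el ns 1) = kron 1 b (unit_el ns (Suc j))"
    using kron_kron[of 1 j b] unit_el_kron[of ns j 1] by simp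
  have u: "kron 1 (unit_el ns 1) (unit_el ns (Suc j)) = unit_el ns (Suc j + 1)"
    using unit_el_kron[of ns 1 "Suc j"] by simp
  have t: "mul ns (kron 1 b (unit_el ns (Suc j))) (loop_tensor (Suc j) z) \<in> tpow ns (Suc j + 1)"
    using tpow_kron[OF b tpow_unit_el[of ns "Suc j"]] by (intro tpow_mul tpow_loop_tensor) simp_all
  show ?thesis
    using loop_tensor_bimodule[OF k z tpow_unit_el]
    unfolding e u mul_unit_right[OF t] mul_unit_right[OF tpow_mul[OF k z]] .
qed

lemma loop_tensor_right:
  assumes b: "b \<in> tpow ns 1" and z: "z \<in> tpow ns (Suc j)"
  shows "mul ns (loop_tensor (Suc j) z) (kron (Suc j) (unit_el ns (Suc j)) b)
    = loop_tensor (Suc j) (mul ns z (kron j (unit_el ns j) b))"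
proof -
  have k: "kron j (unit_el ns j) b \<in> tpow ns (Suc j)"
    using tpow_kron[OF tpow_unit_el[of ns j] b] by simp
  have e: "kron 1 (unit_el ns 1) (kron j (unit_el ns j) b) = kron (Suc j) (unit_el ns (Suc j)) b"
    using kron_kron[of 1 j "unit_el ns 1" "unit_el ns j" b] unit_el_kron[of ns 1 j] by simp
  have u: "kron (Suc j) (unit_el ns (Suc j)) (unit_el ns 1) = unit_el ns (Suc j + 1)"
    using unit_el_kron[of ns "Suc j" 1] by simp
  show ?thesis
    using loop_tensor_bimodule[OF tpow_unit_el z k]
    unfolding e u mul_unit_left[OF tpow_loop_tensor] mul_unit_left[OF z] .
qed

text \<open>
  For \<open>x\<close> in the block sum, the condition that row and column lie in the same sequence of blocks reduces to
  one for the first legs.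
\<close>

lemma loop_tensor_row_rot_apply:
  assumes x: "x \<in> block_sum ns (Suc j)"
    and A: "r \<in> idx ns j" "p \<in> idx ns j" "r0 \<in> block_idx ns" "re \<in> block_idx ns" "p0 \<in> block_idx ns" "u \<in> block_idx ns"
  shows "loop_tensor (Suc j) (row_rot x) ((r0 # r) @ [re]) (p0 # (p @ [u]))
    = (if fst r0 = fst p0 then x (r @ [r0]) (p @ [u]) * gram_inv re p0 else 0)"
proof (cases "x (r @ [r0]) (p @ [u]) = 0 \<or> gram_inv re p0 = 0")
  case True
  then show ?thesis using A by (subst loop_tensor_apply) (auto simp: Cons_in_idx snoc_in_idx row_rot_def)
next
  case False
  have x': "x \<in> tpow ns (Suc j)" using block_sum_tpow[OF _ x] by simp
  have m: "map fst r = map fst p" "fst r0 = fst u" "fst re = fst p0"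
    using False tpow_nonzero[OF x', of "r @ [r0]" "p @ [u]"] gram_inv_nonzero[of re p0]
    by (auto simp: append_eq_append_conv)
  have "single_block (r @ [r0])" using False block_sum_single_block[OF x] by auto
  then have s: "set (map fst r) \<subseteq> {fst r0}" by (auto simp: single_block_def)
  show ?thesis
    using A m by (subst loop_tensor_apply) (auto simp: Cons_in_idx snoc_in_idx row_rot_def)
qed

end

text \<open>A finite quantum space; \<open>\<psi>\<close> is a \<open>\<delta>\<close>-form.\<close>

locale quantum_space =
  fixes ns :: "nat list" and \<psi> :: "tensor \<Rightarrow> complex" and \<delta> :: real
  assumes fqs: "finite_quantum_space ns \<psi> \<delta>"

sublocale quantum_space \<subseteq> multimatrix_state ns \<psi>
  using fqs by unfold_locales (simp_all add: finite_quantum_space_def)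

context quantum_space
begin

lemma mult_map_apply:
  assumes y: "y \<in> tpow ns (1 + 1)"
  shows "mult_map ns y = truncate ns 1 (\<lambda>p q. \<Sum>w\<in>block_idx ns. y (p @ [w]) (w # q))"
  unfolding mult_map_def
proof (rule lin_ext_linear[OF y])
  show "tensor_linear (\<lambda>y. truncate ns 1 (\<lambda>p q. \<Sum>w\<in>block_idx ns. y (p @ [w]) (w # q)))"
    by (rule truncate_linearI) (simp_all add: scale_apply sum.distrib sum_distrib_left)
  fix p q s t assume "(p, q) \<in> unit_idx ns 1" "(s, t) \<in> unit_idx ns 1"
  note m = tpow_mat_unit[OF this(1)] tpow_mat_unit[OF this(2)]
  show "mul ns (mat_unit p q) (mat_unit s t)
      = truncate ns 1 (\<lambda>p' q'. \<Sum>w\<in>block_idx ns. kron 1 (mat_unit p q) (mat_unit s t) (p' @ [w]) (w # q'))"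
  proof (rule tpow_eqI[OF tpow_mul[OF m] tpow_truncate])
    fix P Q assume PQ: "P \<in> idx ns 1" "Q \<in> idx ns 1" "map fst P = map fst Q"
    then obtain u w where "P = [u]" "Q = [w]" by (metis idx_1E)
    then show "mul ns (mat_unit p q) (mat_unit s t) P Q
      = truncate ns 1 (\<lambda>p' q'. \<Sum>w\<in>block_idx ns. kron 1 (mat_unit p q) (mat_unit s t) (p' @ [w]) (w # q')) P Q"
      unfolding truncate_apply[OF PQ] by (simp add: mul_apply_1 kron_def)
  qed
qed

text \<open>
  The trace of \<open>Q\<^sup>-\<^sup>1\<close> over the block of \<open>u\<close>, read off from the entry at \<open>(u, u)\<close> of \<open>m m\<^sup>*(e\<^sub>u\<^sub>u) = \<delta>\<^sup>2 e\<^sub>u\<^sub>u\<close>.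
\<close>

lemma block_trace_gram_inv:
  assumes u: "u \<in> block_idx ns"
  shows "(\<Sum>w\<in>block_idx ns. if fst u = fst w then gram_inv w w else 0) = of_real (\<delta>\<^sup>2)"
proof -
  let ?e = "mat_unit [u] [u]"
  have pq: "([u], [u]) \<in> unit_idx ns 1" using u by (simp add: unit_idx_def)
  have e: "?e \<in> tpow ns 1" by (rule tpow_mat_unit[OF pq])
  let ?a = "truncate ns 2 (\<lambda>p q. ?e [p ! 0] [q ! 1] * gram_inv (p ! 1) (q ! 0))"
  have a: "?a \<in> tpow ns (1 + 1)" using tpow_truncate[of ns 2] by (simp add: numeral_2_eq_2)
  have "mult_map ns (mult_adj ns \<psi> ?e) = scale (of_real (\<delta>\<^sup>2)) ?e"
    using fqs e by (simp add: finite_quantum_space_def)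
  then have "mult_map ns ?a [u] [u] = of_real (\<delta>\<^sup>2)"
    unfolding mult_adj_eq[OF e] by (simp add: scale_apply mat_unit_def)
  moreover have "mult_map ns ?a [u] [u] = (\<Sum>w\<in>block_idx ns. ?a [u, w] [w, u])"
    unfolding mult_map_apply[OF a] using u by (subst truncate_apply) (auto simp: idx_def)
  moreover have "\<dots> = (\<Sum>w\<in>block_idx ns. if fst u = fst w then gram_inv w w else 0)"
    using u by (intro sum.cong refl) (auto simp: truncate_def unit_idx_iff pair_in_idx mat_unit_def)
  ultimately show ?thesis by simp
qed

text \<open>
  The diagonal entries of \<open>Q\<^sup>-\<^sup>1\<close> are positive, and \<open>B \<noteq> 0\<close> because \<open>\<psi>(1) = 1\<close>.
\<close>

lemma delta_nonzero: "\<delta> \<noteq> 0"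
proof
  assume "\<delta> = 0"
  let ?B = "block_idx ns"
  have "\<exists>u. u \<in> ?B"
  proof (rule ccontr)
    assume "\<not> ?thesis"
    then have "block_idx ns = {}" by blast
    then have "\<psi> (unit_el ns 1) = 0" by (subst psi_expand[OF tpow_unit_el]) simp
    then show False using faithful by (simp add: faithful_state_def)
  qed
  then obtain u where u: "u \<in> ?B" ..
  have pos: "0 < Re (gram_inv w w)" if w: "w \<in> ?B" for w
  proof -
    have "qform ?B (\<lambda>u v. gram \<psi> v u) (\<lambda>v. gram_inv v w)
        = (\<Sum>u\<in>?B. cnj (gram_inv u w) * (\<Sum>v\<in>?B. gram \<psi> v u * gram_inv v w))"
      by (simp add: qform_def sum_distrib_left mult.assoc)
    also have "\<dots> = (\<Sum>u\<in>?B. if u = w then gram_inv w w else 0)"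
      using w by (intro sum.cong refl) (simp add: gram_gram_inv gram_inv_cnj)
    also have "\<dots> = gram_inv w w" using w by (simp add: finite_block_idx)
    finally have q: "qform ?B (\<lambda>u v. gram \<psi> v u) (\<lambda>v. gram_inv v w) = gram_inv w w" .
    have "\<exists>v\<in>?B. gram_inv v w \<noteq> 0"
    proof (rule ccontr)
      assume "\<not> ?thesis"
      then show False using gram_gram_inv[OF w w] by simp
    qed
    then obtain v where "v \<in> ?B" "gram_inv v w \<noteq> 0" by blast
    then show ?thesis
      using pos_def_qform_pos[OF pos_def_transpose[OF gram_pos_def], of v "\<lambda>v. gram_inv v w"] q by simp
  qed
  have "0 < Re (gram_inv u u)" by (rule pos[OF u])
  also have "Re (gram_inv u u) = Re (if fst u = fst u then gram_inv u u else 0)" by simp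
  also have "\<dots> \<le> (\<Sum>w\<in>?B. Re (if fst u = fst w then gram_inv w w else 0))"
    using u pos by (intro member_le_sum[where f = "\<lambda>w. Re (if fst u = fst w then gram_inv w w else 0)"])
      (auto simp: finite_block_idx less_imp_le)
  also have "\<dots> = 0" using arg_cong[OF block_trace_gram_inv[OF u], of Re] \<open>\<delta> = 0\<close> by simp
  finally show False by simp
qed

text \<open>
  The weight \<open>Q\<close> of the slice cancels one of the two factors \<open>Q\<^sup>-\<^sup>1\<close>, and the trace of the other remains.
\<close>

lemma weighted_block_trace:
  assumes r: "r \<in> block_idx ns"
  shows "(\<Sum>p\<in>block_idx ns. \<Sum>q\<in>block_idx ns. \<Sum>s\<in>block_idx ns.
      gram \<psi> p q * (if fst r = fst p then cnj (gram_inv s p) else 0) * (if fst r = fst q then gram_inv s q else 0))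
    = of_real (\<delta>\<^sup>2)"
proof -
  let ?B = "block_idx ns"
  let ?g = "\<lambda>p q s. if fst r = fst p then gram_inv p s * (gram_inv s q * gram \<psi> p q) else 0"
  have "(\<Sum>p\<in>?B. \<Sum>q\<in>?B. \<Sum>s\<in>?B.
      gram \<psi> p q * (if fst r = fst p then cnj (gram_inv s p) else 0) * (if fst r = fst q then gram_inv s q else 0))
      = (\<Sum>p\<in>?B. \<Sum>q\<in>?B. \<Sum>s\<in>?B. ?g p q s)"
    by (intro sum.cong refl) (auto simp: gram_inv_cnj gram_def)
  also have "\<dots> = (\<Sum>p\<in>?B. \<Sum>s\<in>?B. \<Sum>q\<in>?B. ?g p q s)"
    by (intro sum.cong refl sum.swap)
  also have "\<dots> = (\<Sum>p\<in>?B. \<Sum>s\<in>?B. if s = p then if fst r = fst p then gram_inv p p else 0 else 0)"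
    by (intro sum.cong refl) (auto simp: sum_distrib_left[symmetric] gram_inv_gram)
  also have "\<dots> = (\<Sum>p\<in>?B. if fst r = fst p then gram_inv p p else 0)"
    by (simp add: finite_block_idx)
  also have "\<dots> = of_real (\<delta>\<^sup>2)" by (rule block_trace_gram_inv[OF r])
  finally show ?thesis .
qed

text \<open>
  The sum over all legs separates into the inner product of \<open>x\<close> and \<open>y\<close>, and the sum over the legs that carry
  the factors \<open>Q\<^sup>-\<^sup>1\<close>, which is \<open>\<delta>\<^sup>2\<close> by \<open>weighted_block_trace\<close>.
\<close>

lemma loop_tensor_inner:
  assumes x: "x \<in> block_sum ns (Suc j)" and y: "y \<in> block_sum ns (Suc j)"
  shows "psi_slice ns \<psi> (Suc j) (mul ns (star (loop_tensor (Suc j) (row_rot x))) (loop_tensor (Suc j) (row_rot y)))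
    = scale (of_real (\<delta>\<^sup>2)) (psi_slice ns \<psi> j (mul ns (star x) y))"
proof (rule tpow_eqI)
  let ?B = "block_idx ns" and ?J = "idx ns j"
  let ?X = "loop_tensor (Suc j) (row_rot x)" and ?Y = "loop_tensor (Suc j) (row_rot y)"
  have x': "x \<in> tpow ns (j + 1)" "y \<in> tpow ns (j + 1)" using block_sum_tpow[OF _ x] block_sum_tpow[OF _ y] by simp_all
  show "psi_slice ns \<psi> (Suc j) (mul ns (star ?X) ?Y) \<in> tpow ns 1"
    by (intro tpow_psi_slice tpow_mul tpow_star tpow_loop_tensor)
  show "scale (of_real (\<delta>\<^sup>2)) (psi_slice ns \<psi> j (mul ns (star x) y)) \<in> tpow ns 1"
    using x' by (intro tpow_scale tpow_psi_slice tpow_mul tpow_star)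
  fix P Q assume "P \<in> idx ns 1" "Q \<in> idx ns 1"
  then obtain u w where P: "P = [u]" "u \<in> ?B" and Q: "Q = [w]" "w \<in> ?B" by (metis idx_1E)
  define W where "W p0 q0 r0 s = gram \<psi> p0 q0 * (if fst r0 = fst p0 then cnj (gram_inv s p0) else 0) *
      (if fst r0 = fst q0 then gram_inv s q0 else 0)" for p0 q0 r0 s :: "nat \<times> nat"
  define T where "T p q r r0 = gram_pow \<psi> p q * (cnj (x (r @ [r0]) (p @ [u])) * y (r @ [r0]) (q @ [w]))" for p q r r0
  have sum_ends: "(\<Sum>r\<in>idx ns (Suc j + 1). f r) = (\<Sum>r0\<in>?B. \<Sum>r\<in>?J. \<Sum>s\<in>?B. f ((r0 # r) @ [s]))" for f :: "index \<Rightarrow> complex"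
    unfolding Suc_eq_plus1[symmetric] by (subst sum_idx_Suc) (simp add: sum_idx_snoc)
  have "psi_slice ns \<psi> (Suc j) (mul ns (star ?X) ?Y) P Q
      = (\<Sum>p0\<in>?B. \<Sum>p\<in>?J. \<Sum>q0\<in>?B. \<Sum>q\<in>?J. \<Sum>r0\<in>?B. \<Sum>r\<in>?J. \<Sum>s\<in>?B.
          gram \<psi> p0 q0 * gram_pow \<psi> p q *
          (cnj (?X ((r0 # r) @ [s]) (p0 # (p @ [u]))) * ?Y ((r0 # r) @ [s]) (q0 # (q @ [w]))))"
    using P Q unfolding psi_slice_def sum_idx_Suc
    by (intro sum.cong refl)
       (simp add: mul_apply star_def idx_length gram_pow_Cons sum_ends[simplified] sum_distrib_left)
  also have "\<dots> = (\<Sum>p0\<in>?B. \<Sum>p\<in>?J. \<Sum>q0\<in>?B. \<Sum>q\<in>?J. \<Sum>r0\<in>?B. \<Sum>r\<in>?J. \<Sum>s\<in>?B. T p q r r0 * W p0 q0 r0 s)"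
    using P Q by (intro sum.cong refl)
      (simp only: loop_tensor_row_rot_apply[OF x] loop_tensor_row_rot_apply[OF y], simp add: T_def W_def)
  also have "\<dots> = (\<Sum>(p0, p, q0, q, r0, r, s)\<in>?B \<times> ?J \<times> ?B \<times> ?J \<times> ?B \<times> ?J \<times> ?B. T p q r r0 * W p0 q0 r0 s)"
    by (simp add: sum.cartesian_product')
  also have "\<dots> = (\<Sum>(p, q, r, r0, p0, q0, s)\<in>?J \<times> ?J \<times> ?J \<times> ?B \<times> ?B \<times> ?B \<times> ?B. T p q r r0 * W p0 q0 r0 s)"
    by (rule sum.reindex_bij_witness[of _ "\<lambda>(p, q, r, r0, p0, q0, s). (p0, p, q0, q, r0, r, s)"
          "\<lambda>(p0, p, q0, q, r0, r, s). (p, q, r, r0, p0, q0, s)"]) auto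
  also have "\<dots> = (\<Sum>p\<in>?J. \<Sum>q\<in>?J. \<Sum>r\<in>?J. \<Sum>r0\<in>?B. T p q r r0 * (\<Sum>p0\<in>?B. \<Sum>q0\<in>?B. \<Sum>s\<in>?B. W p0 q0 r0 s))"
    by (simp add: sum.cartesian_product' sum_distrib_left)
  also have "\<dots> = (\<Sum>p\<in>?J. \<Sum>q\<in>?J. \<Sum>r\<in>?J. \<Sum>r0\<in>?B. T p q r r0 * of_real (\<delta>\<^sup>2))"
    unfolding W_def by (intro sum.cong refl) (simp only: weighted_block_trace)
  also have "\<dots> = scale (of_real (\<delta>\<^sup>2)) (psi_slice ns \<psi> j (mul ns (star x) y)) P Q"
    using P Q by (simp add: scale_apply psi_slice_def mul_apply star_def idx_length T_def
        sum_idx_snoc sum_distrib_left mult_ac)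
  finally show "psi_slice ns \<psi> (Suc j) (mul ns (star ?X) ?Y) P Q
      = scale (of_real (\<delta>\<^sup>2)) (psi_slice ns \<psi> j (mul ns (star x) y)) P Q" .
qed

end

section \<open>The isomorphism\<close>

context quantum_space
begin

lemma path_space_loop_tensor:
  "path_space ns \<psi> \<delta> id (Suc j) = loop_tensor (Suc j) ` tpow ns (Suc j)"
  by (rule path_space_eq[OF delta_nonzero])

lemma block_sum_cstar:
  "cstar_correspondence ns ((standard_ext j)\<lparr>corr_space := block_sum ns (Suc j)\<rparr>)"
proof (rule standard_ext_sub_cstar)
  show "block_sum ns (Suc j) \<subseteq> tpow ns (j + 1)"
    using block_sum_tpow[of "Suc j"] by auto
  show "module.subspace scale (block_sum ns (Suc j))" by (simp add: block_sum_subspace)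
  fix b x assume b: "b \<in> tpow ns 1" and x: "x \<in> block_sum ns (Suc j)"
  show "mul ns (kron j (unit_el ns j) b) x \<in> block_sum ns (Suc j)"
    by (rule block_sum_kron_left[OF b x])
  have "kron j (unit_el ns j) b \<in> tpow ns (Suc j)"
    using tpow_kron[OF tpow_unit_el[of ns j] b] by simp
  then show "mul ns x (kron j (unit_el ns j) b) \<in> block_sum ns (Suc j)"
    by (rule block_sum_mul_right[OF _ x])
qed

lemma path_space_cstar:
  "cstar_correspondence ns ((tpow_corr ns \<psi> (Suc j))\<lparr>corr_space := path_space ns \<psi> \<delta> id (Suc j)\<rparr>)"
  unfolding path_space_loop_tensor
proof (rule tpow_corr_sub_cstar)
  show "loop_tensor (Suc j) ` tpow ns (Suc j) \<subseteq> tpow ns (Suc j + 1)"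
    using tpow_loop_tensor by blast
  show "module.subspace scale (loop_tensor (Suc j) ` tpow ns (Suc j))"
    by (rule loop_tensor_image_subspace)
  fix b x assume b: "b \<in> tpow ns 1" and "x \<in> loop_tensor (Suc j) ` tpow ns (Suc j)"
  then obtain z where z: "z \<in> tpow ns (Suc j)" and x: "x = loop_tensor (Suc j) z" by blast
  have "kron 1 b (unit_el ns j) \<in> tpow ns (Suc j)" "kron j (unit_el ns j) b \<in> tpow ns (Suc j)"
    using tpow_kron[OF tpow_unit_el[of ns j] b] tpow_kron[OF b tpow_unit_el[of ns j]] by simp_all
  then show "mul ns (kron 1 b (unit_el ns (Suc j))) x \<in> loop_tensor (Suc j) ` tpow ns (Suc j)"
    "mul ns x (kron (Suc j) (unit_el ns (Suc j)) b) \<in> loop_tensor (Suc j) ` tpow ns (Suc j)"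
    unfolding x loop_tensor_left[OF b z] loop_tensor_right[OF b z]
    using z by (blast intro: tpow_mul)+
qed

lemma path_isomorphism:
  "correspondence_iso ns ((standard_ext j)\<lparr>corr_space := block_sum ns (Suc j)\<rparr>)
     ((tpow_corr ns \<psi> (Suc j))\<lparr>corr_space := path_space ns \<psi> \<delta> id (Suc j)\<rparr>)
     (\<lambda>x. scale (of_real (1 / \<delta>)) (f_map ns (Suc j) (amp ns j 1 (mult_adj ns \<psi>) x)))"
  (is "correspondence_iso ns ?L ?E ?\<Phi>")
proof -
  interpret vector_space scale by (rule vector_space_scale)
  let ?S = "block_sum ns (Suc j)" and ?P = "path_space ns \<psi> \<delta> id (Suc j)"
  let ?d = "complex_of_real (1 / \<delta>)"
  have L: "corr_space ?L = ?S" "lact ?L = lact (standard_ext j)" "ract ?L = ract (standard_ext j)"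
      "inner_B ?L = inner_B (standard_ext j)"
    and E: "corr_space ?E = ?P" "lact ?E = lact (tpow_corr ns \<psi> (Suc j))"
      "ract ?E = ract (tpow_corr ns \<psi> (Suc j))" "inner_B ?E = inner_B (tpow_corr ns \<psi> (Suc j))"
    by simp_all
  have S: "x \<in> tpow ns (j + 1)" if "x \<in> ?S" for x using block_sum_tpow[OF _ that] by simp
  have phi: "?\<Phi> x = scale ?d (loop_tensor (Suc j) (row_rot x))" if "x \<in> ?S" for x
    using f_map_amp_mult_adj[OF S[OF that]] by simp
  have t: "?\<Phi> x \<in> tpow ns (Suc j + 1)" if "x \<in> ?S" for x
    unfolding phi[OF that] by (intro tpow_scale tpow_loop_tensor)
  have sub: "x + y \<in> ?S" "scale c x \<in> ?S" if "x \<in> ?S" "y \<in> ?S" for x y c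
    using subspace_add[OF block_sum_subspace] subspace_scale[OF block_sum_subspace] that by simp_all
  have add: "?\<Phi> (x + y) = ?\<Phi> x + ?\<Phi> y" if "x \<in> ?S" "y \<in> ?S" for x y
  proof -
    have "row_rot (x + y) = row_rot x + row_rot y" by (simp add: row_rot_def fun_eq_iff)
    then show ?thesis
      unfolding phi[OF that(1)] phi[OF that(2)] phi[OF sub(1)[OF that]]
      by (simp only: tensor_linear_add[OF loop_tensor_linear] scale_right_distrib)
  qed
  have scl: "?\<Phi> (scale c x) = scale c (?\<Phi> x)" if "x \<in> ?S" for c x
  proof -
    have "row_rot (scale c x) = scale c (row_rot x)" by (simp add: row_rot_def scale_def)
    then show ?thesis
      unfolding phi[OF that] phi[OF sub(2)[OF that that]]
      by (simp only: tensor_linear_scale[OF loop_tensor_linear] scale_scale mult.commute)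
  qed
  have inner: "inner_B (tpow_corr ns \<psi> (Suc j)) (?\<Phi> x) (?\<Phi> y) = inner_B (standard_ext j) x y"
    if "x \<in> ?S" "y \<in> ?S" for x y
  proof -
    have "inner_B (tpow_corr ns \<psi> (Suc j)) (?\<Phi> x) (?\<Phi> y)
        = scale (?d * (cnj ?d * of_real (\<delta>\<^sup>2))) (psi_slice ns \<psi> j (mul ns (star x) y))"
      unfolding tpow_corr_inner[OF t[OF that(1)] t[OF that(2)]] unfolding phi[OF that(1)] phi[OF that(2)]
      by (simp only: star_scale mul_scale_left mul_scale_right tensor_linear_scale[OF psi_slice_linear]
          loop_tensor_inner[OF that] scale_scale mult.assoc)
    also have "?d * (cnj ?d * of_real (\<delta>\<^sup>2)) = 1"
      using delta_nonzero by (simp add: power2_eq_square field_simps)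
    finally show ?thesis by (simp only: scale_one standard_ext_inner[OF S[OF that(1)] S[OF that(2)]])
  qed
  have "inj_on ?\<Phi> ?S"
  proof (rule inj_onI)
    fix x y assume x: "x \<in> ?S" and y: "y \<in> ?S" and eq: "?\<Phi> x = ?\<Phi> y"
    let ?z = "x + scale (- 1) y"
    have z: "?z \<in> ?S" using x y by (intro sub)
    have "?\<Phi> ?z = ?\<Phi> y + scale (- 1) (?\<Phi> y)"
      unfolding add[OF x sub(2)[OF y y]] scl[OF y] eq ..
    also have "\<dots> = 0" by (simp add: scale_def fun_eq_iff)
    finally have 0: "?\<Phi> ?z = 0" .
    have "psi_slice ns \<psi> j (mul ns (star ?z) ?z) = inner_B (tpow_corr ns \<psi> (Suc j)) 0 0"
      unfolding standard_ext_inner[OF S[OF z] S[OF z], symmetric] inner[OF z z, symmetric] 0 ..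
    also have "\<dots> = 0"
      unfolding tpow_corr_inner[OF t[OF z] t[OF z], unfolded 0]
      by (simp add: psi_slice_def mul_def fun_eq_iff)
    finally have "?z = 0" by (rule psi_slice_definite[OF S[OF z]])
    then show "x = y" by (simp add: scale_def fun_eq_iff)
  qed
  moreover have "?\<Phi> ` ?S = ?P"
  proof (intro equalityI subsetI)
    fix g assume "g \<in> ?\<Phi> ` ?S"
    then obtain x where "x \<in> ?S" "g = loop_tensor (Suc j) (scale ?d (row_rot x))"
      using phi tensor_linear_scale[OF loop_tensor_linear] by force
    then show "g \<in> ?P"
      unfolding path_space_loop_tensor using tpow_scale tpow_row_rot by blast
  next
    fix g assume "g \<in> ?P"
    then obtain x where x: "x \<in> ?S" "g = loop_tensor (Suc j) (row_rot x)"
      unfolding path_space_loop_tensor loop_tensor_row_rot_image by blast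
    have "?\<Phi> (scale (of_real \<delta>) x) = scale (of_real \<delta> * ?d) g"
      unfolding scl[OF x(1)] phi[OF x(1)] x(2) by (simp only: scale_scale)
    also have "\<dots> = g" using delta_nonzero by simp
    finally show "g \<in> ?\<Phi> ` ?S" using sub(2)[OF x(1) x(1)] by (metis imageI)
  qed
  ultimately have bij: "bij_betw ?\<Phi> ?S ?P" by (simp add: bij_betw_def)
  have left: "?\<Phi> (lact (standard_ext j) b x) = lact (tpow_corr ns \<psi> (Suc j)) b (?\<Phi> x)"
    if b: "b \<in> tpow ns 1" and x: "x \<in> ?S" for b x
  proof -
    have x': "x \<in> tpow ns (Suc j)" using S[OF x] by simp
    note bx = block_sum_kron_left[OF b x]
    have k: "kron 1 b (unit_el ns j) \<in> tpow ns (Suc j)"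
      using tpow_kron[OF b tpow_unit_el[of ns j]] by simp
    have "row_rot (mul ns (kron j (unit_el ns j) b) x) = mul ns (kron 1 b (unit_el ns j)) (row_rot x)"
      by (rule tpow_eqI[OF tpow_row_rot[OF bx] tpow_mul[OF k tpow_row_rot[OF x]]])
        (rule row_rot_kron_left[OF b x'])
    then show ?thesis
      unfolding standard_ext_ops(1)[OF b S[OF x]] tpow_corr_ops(1)[OF b t[OF x]]
      unfolding phi[OF x] phi[OF bx]
      by (simp only: mul_scale_right loop_tensor_left[OF b tpow_row_rot[OF x]])
  qed
  have right: "?\<Phi> (ract (standard_ext j) x b) = ract (tpow_corr ns \<psi> (Suc j)) (?\<Phi> x) b"
    if b: "b \<in> tpow ns 1" and x: "x \<in> ?S" for b x
  proof -
    have k: "kron j (unit_el ns j) b \<in> tpow ns (Suc j)"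
      using tpow_kron[OF tpow_unit_el[of ns j] b] by simp
    show ?thesis
      unfolding standard_ext_ops(2)[OF b S[OF x]] tpow_corr_ops(2)[OF b t[OF x]]
      unfolding phi[OF x] phi[OF block_sum_mul_right[OF k x]]
      by (simp only: mul_scale_left row_rot_mul_right loop_tensor_right[OF b tpow_row_rot[OF x]])
  qed
  show ?thesis
    unfolding correspondence_iso_def L E
    using block_sum_cstar path_space_cstar bij add scl left right inner by blast
qed

end

theorem proposition4p1:
  fixes ns :: "nat list" and \<psi> :: "tensor \<Rightarrow> complex" and \<delta> :: real and k :: nat
  assumes "finite_quantum_space ns \<psi> \<delta>" and "1 \<le> k"
  defines "L \<equiv> ext_tensor ns \<psi> (k - 1) 1 (standard_corr ns)"
    and "E \<equiv> path_space ns \<psi> \<delta> id k"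
  shows "subcorrespondence ns (block_sum ns k) L \<and>
         subcorrespondence ns E (tpow_corr ns \<psi> k) \<and>
         correspondence_iso ns (L\<lparr>corr_space := block_sum ns k\<rparr>) ((tpow_corr ns \<psi> k)\<lparr>corr_space := E\<rparr>)
           (\<lambda>x. scale (of_real (1 / \<delta>)) (f_map ns k (amp ns (k - 1) 1 (mult_adj ns \<psi>) x)))"
proof -
  interpret quantum_space ns \<psi> \<delta> by unfold_locales (rule assms(1))
  obtain j where k: "k = Suc j" using assms(2) by (cases k) auto
  have "block_sum ns (Suc j) \<subseteq> corr_space (standard_ext j)"
    using block_sum_tpow[of "Suc j" _ ns] by (auto simp: ext_tensor_def)
  moreover have "path_space ns \<psi> \<delta> id (Suc j) \<subseteq> corr_space (tpow_corr ns \<psi> (Suc j))"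
    unfolding path_space_loop_tensor using tpow_loop_tensor[of "Suc j"] by (auto simp: tpow_corr_def)
  ultimately show ?thesis
    unfolding L_def E_def k diff_Suc_1 subcorrespondence_def
    using standard_ext_cstar tpow_corr_cstar block_sum_cstar path_space_cstar path_isomorphism by blast
qed

end
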